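(* Let $k$ be an algebraically closed field of characteristic zero and let $n \geq 2$ be an integer. The Lie algebra $\mathfrak{tym}(n)$ is a free Lie algebra, and the associative algebra $\mathrm{TYM}(n) = \mathcal{U}(\mathfrak{tym}(n))$ is a free associative algebra.
   Context: For an integer $n \geq 2$, let $\mathfrak{f}(n)$ be the free Lie algebra over $k$ on generators $x_1,\dots,x_n$. The Lie Yang-Mills algebra is the quotient $\mathfrak{ym}(n) = \mathfrak{f}(n)/\langle \sum_{i=1}^n [x_i,[x_i,x_j]] : 1 \leq j \leq n\rangle$ by the Lie ideal generated by the indicated elements. It inherits an $\mathbb{N}$-grading $\mathfrak{ym}(n) = \bigoplus_{j\geq 1}\mathfrak{ym}(n)_j$ with each $x_i$ in degree $1$. The Lie ideal $\mathfrak{tym}(n)$ is $\mathfrak{tym}(n) = \bigoplus_{j \geq 2}\mathfrak{ym}(n)_j = [\mathfrak{ym}(n),\mathfrak{ym}(n)]$, and $\mathcal{U}$ denotes the universal enveloping algebra. *)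

theory Defs
  imports
    "HOL-Algebra.Algebraic_Closure_Type"
begin

section \<open>Algebras over a field\<close>

text \<open>
  The ground field is a type \<open>'k\<close> of class \<^class>\<open>field\<close>, used as a ring record through
  \<^const>\<open>ring_of_type_algebra\<close>. A \<open>'k\<close>-algebra, not necessarily associative or unital, is a
  \<^typ>\<open>('k, 'a) module\<close> record whose field \<^const>\<open>monoid.mult\<close> is the product. For a Lie algebra
  \<open>x \<otimes>\<^bsub>L\<^esub> y\<close> is the bracket \<open>[x, y]\<close>, and the field \<^const>\<open>one\<close> is a
  dummy which no notion concerning Lie algebras depends on.
\<close>

locale nonassoc_algebra = module "ring_of_type_algebra :: 'k::field ring" A
  for A :: "('k::field, 'a) module" (structure) +
  assumes mult_closed: "\<lbrakk>x \<in> carrier A; y \<in> carrier A\<rbrakk> \<Longrightarrow> x \<otimes> y \<in> carrier A"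
    and mult_add_left: "\<lbrakk>x \<in> carrier A; y \<in> carrier A; z \<in> carrier A\<rbrakk>
      \<Longrightarrow> (x \<oplus> y) \<otimes> z = x \<otimes> z \<oplus> y \<otimes> z"
    and mult_add_right: "\<lbrakk>x \<in> carrier A; y \<in> carrier A; z \<in> carrier A\<rbrakk>
      \<Longrightarrow> z \<otimes> (x \<oplus> y) = z \<otimes> x \<oplus> z \<otimes> y"
    and mult_smult_left: "\<lbrakk>x \<in> carrier A; y \<in> carrier A\<rbrakk> \<Longrightarrow> (c \<odot> x) \<otimes> y = c \<odot> (x \<otimes> y)"
    and mult_smult_right: "\<lbrakk>x \<in> carrier A; y \<in> carrier A\<rbrakk> \<Longrightarrow> x \<otimes> (c \<odot> y) = c \<odot> (x \<otimes> y)"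

locale lie_algebra = nonassoc_algebra L for L :: "('k::field, 'a) module" (structure) +
  assumes bracket_self: "x \<in> carrier L \<Longrightarrow> x \<otimes> x = \<zero>"
    and jacobi: "\<lbrakk>x \<in> carrier L; y \<in> carrier L; z \<in> carrier L\<rbrakk>
      \<Longrightarrow> x \<otimes> (y \<otimes> z) \<oplus> y \<otimes> (z \<otimes> x) \<oplus> z \<otimes> (x \<otimes> y) = \<zero>"

locale assoc_algebra = nonassoc_algebra A + ring A
  for A :: "('k::field, 'a) module" (structure)

definition lin_span :: "('k::field, 'a) module \<Rightarrow> 'a set \<Rightarrow> 'a set"
  where "lin_span A S = \<Inter>{H. submodule H ring_of_type_algebra A \<and> S \<subseteq> H}"

text \<open>Two-sided ideals. For a Lie algebra these are the Lie ideals.\<close>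

definition alg_ideal :: "'a set \<Rightarrow> ('k::field, 'a) module \<Rightarrow> bool"
  where "alg_ideal I A \<longleftrightarrow> submodule I ring_of_type_algebra A \<and>
    (\<forall>a\<in>carrier A. \<forall>x\<in>I. a \<otimes>\<^bsub>A\<^esub> x \<in> I \<and> x \<otimes>\<^bsub>A\<^esub> a \<in> I)"

definition gen_ideal :: "('k::field, 'a) module \<Rightarrow> 'a set \<Rightarrow> 'a set"
  where "gen_ideal A S = \<Inter>{I. alg_ideal I A \<and> S \<subseteq> I}"

text \<open>The quotient by an ideal: the operations of \<^term>\<open>A Quot I\<close> together with the induced
  scalar multiplication.\<close>

definition alg_quot :: "('k::field, 'a) module \<Rightarrow> 'a set \<Rightarrow> ('k, 'a set) module"
  where "alg_quot A I =
    \<lparr>carrier = a_rcosets\<^bsub>A\<^esub> I, monoid.mult = rcoset_mult A I, one = I +>\<^bsub>A\<^esub> \<one>\<^bsub>A\<^esub>,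
     zero = I, add = set_add A, module.smult = (\<lambda>c C. \<Union>x\<in>C. I +>\<^bsub>A\<^esub> (c \<odot>\<^bsub>A\<^esub> x))\<rparr>"

definition lie_hom :: "('k::field, 'a) module \<Rightarrow> ('k, 'b) module \<Rightarrow> ('a \<Rightarrow> 'b) set"
  where "lie_hom L M = {h \<in> carrier L \<rightarrow> carrier M.
    (\<forall>x\<in>carrier L. \<forall>y\<in>carrier L. h (x \<oplus>\<^bsub>L\<^esub> y) = h x \<oplus>\<^bsub>M\<^esub> h y \<and> h (x \<otimes>\<^bsub>L\<^esub> y) = h x \<otimes>\<^bsub>M\<^esub> h y) \<and>
    (\<forall>c. \<forall>x\<in>carrier L. h (c \<odot>\<^bsub>L\<^esub> x) = c \<odot>\<^bsub>M\<^esub> h x)}"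

definition lie_iso :: "('k::field, 'a) module \<Rightarrow> ('k, 'b) module \<Rightarrow> ('a \<Rightarrow> 'b) set"
  where "lie_iso L M = {h \<in> lie_hom L M. bij_betw h (carrier L) (carrier M)}"

definition assoc_iso :: "('k::field, 'a) module \<Rightarrow> ('k, 'b) module \<Rightarrow> ('a \<Rightarrow> 'b) set"
  where "assoc_iso A B = {h \<in> ring_iso A B. \<forall>c. \<forall>x\<in>carrier A. h (c \<odot>\<^bsub>A\<^esub> x) = c \<odot>\<^bsub>B\<^esub> h x}"


section \<open>Free associative algebras\<close>

definition monomial :: "'w \<Rightarrow> 'w \<Rightarrow> 'k::field"
  where "monomial w = (\<lambda>v. if v = w then 1 else 0)"

text \<open>Noncommutative polynomials in the variables \<open>S\<close>: finitely supported functions on the words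
  over \<open>S\<close>. The splittings of a word \<open>w\<close> into two factors are \<open>(take i w, drop i w)\<close> for
  \<open>i \<le> length w\<close>, so the product below is the convolution product.\<close>

definition free_assoc :: "'x set \<Rightarrow> ('k::field, 'x list \<Rightarrow> 'k) module"
  where "free_assoc S =
    \<lparr>carrier = {f. finite {w. f w \<noteq> 0} \<and> {w. f w \<noteq> 0} \<subseteq> lists S},
     monoid.mult = (\<lambda>f g w. \<Sum>i\<le>length w. f (take i w) * g (drop i w)),
     one = monomial [],
     zero = (\<lambda>w. 0),
     add = (\<lambda>f g w. f w + g w),
     module.smult = (\<lambda>c f w. c * f w)\<rparr>"

text \<open>\<open>A\<close> is free on some subset \<open>S\<close> of \<open>A\<close>. Since \<open>x \<mapsto> monomial [x]\<close> is injective, this is the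
  same as being isomorphic to a free algebra on some set of variables.\<close>

definition is_free_assoc_algebra :: "('k::field, 'a) module \<Rightarrow> bool"
  where "is_free_assoc_algebra A \<longleftrightarrow> assoc_algebra A \<and>
    (\<exists>S \<subseteq> carrier A. \<exists>\<phi> \<in> assoc_iso (free_assoc S) A. \<forall>x\<in>S. \<phi> (monomial [x]) = x)"


section \<open>Free Lie algebras\<close>

datatype 'x magma = Gen 'x | Prod "'x magma" "'x magma"

primrec magma_deg :: "'x magma \<Rightarrow> nat"
  where
    "magma_deg (Gen x) = 1"
  | "magma_deg (Prod u v) = magma_deg u + magma_deg v"

text \<open>The free nonassociative algebra without unit on \<open>S\<close>. The free Lie algebra on \<open>S\<close> is its
  quotient by the ideal generated by all \<open>[x, x]\<close> and all Jacobi sums.\<close>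

definition free_nonassoc :: "'x set \<Rightarrow> ('k::field, 'x magma \<Rightarrow> 'k) module"
  where "free_nonassoc S =
    \<lparr>carrier = {f. finite {w. f w \<noteq> 0} \<and> (\<forall>w. f w \<noteq> 0 \<longrightarrow> set_magma w \<subseteq> S)},
     monoid.mult = (\<lambda>f g w. case w of Gen x \<Rightarrow> 0 | Prod u v \<Rightarrow> f u * g v),
     one = (\<lambda>w. 0),
     zero = (\<lambda>w. 0),
     add = (\<lambda>f g w. f w + g w),
     module.smult = (\<lambda>c f w. c * f w)\<rparr>"

definition lie_relators :: "('k::field, 'a) module \<Rightarrow> 'a set"
  where "lie_relators A =
    {x \<otimes>\<^bsub>A\<^esub> x | x. x \<in> carrier A} \<union>
    {x \<otimes>\<^bsub>A\<^esub> (y \<otimes>\<^bsub>A\<^esub> z) \<oplus>\<^bsub>A\<^esub> y \<otimes>\<^bsub>A\<^esub> (z \<otimes>\<^bsub>A\<^esub> x) \<oplus>\<^bsub>A\<^esub> z \<otimes>\<^bsub>A\<^esub> (x \<otimes>\<^bsub>A\<^esub> y) | x y z.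
      x \<in> carrier A \<and> y \<in> carrier A \<and> z \<in> carrier A}"

definition free_lie_ideal :: "'x set \<Rightarrow> ('x magma \<Rightarrow> 'k::field) set"
  where "free_lie_ideal S = gen_ideal (free_nonassoc S) (lie_relators (free_nonassoc S))"

definition free_lie :: "'x set \<Rightarrow> ('k::field, ('x magma \<Rightarrow> 'k) set) module"
  where "free_lie S = alg_quot (free_nonassoc S) (free_lie_ideal S)"

definition free_lie_gen :: "'x set \<Rightarrow> 'x \<Rightarrow> ('x magma \<Rightarrow> 'k::field) set"
  where "free_lie_gen S x = free_lie_ideal S +>\<^bsub>free_nonassoc S\<^esub> monomial (Gen x)"

text \<open>The component of degree \<open>j\<close> for the grading with all generators in degree 1.\<close>

definition free_lie_component :: "'x set \<Rightarrow> nat \<Rightarrow> ('x magma \<Rightarrow> 'k::field) set set"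
  where "free_lie_component S j = {free_lie_ideal S +>\<^bsub>free_nonassoc S\<^esub> f | f.
    f \<in> carrier (free_nonassoc S) \<and> (\<forall>w. f w \<noteq> 0 \<longrightarrow> magma_deg w = j)}"

definition is_free_lie_algebra :: "('k::field, 'a) module \<Rightarrow> bool"
  where "is_free_lie_algebra L \<longleftrightarrow> lie_algebra L \<and>
    (\<exists>S \<subseteq> carrier L. \<exists>\<phi> \<in> lie_iso (free_lie S) L. \<forall>x\<in>S. \<phi> (free_lie_gen S x) = x)"


section \<open>Universal enveloping algebras\<close>

text \<open>The first two families of relators turn the free algebra on the set \<open>carrier L\<close> into the
  tensor algebra of the vector space \<open>L\<close>; the third one is \<open>x \<otimes> y - y \<otimes> x - [x, y]\<close>.\<close>

definition uea_relators :: "('k::field, 'a) module \<Rightarrow> ('a list \<Rightarrow> 'k) set"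
  where "uea_relators L = (let T = free_assoc (carrier L); \<iota> = (\<lambda>x. monomial [x]) in
    {\<iota> (x \<oplus>\<^bsub>L\<^esub> y) \<ominus>\<^bsub>T\<^esub> (\<iota> x \<oplus>\<^bsub>T\<^esub> \<iota> y) | x y. x \<in> carrier L \<and> y \<in> carrier L} \<union>
    {\<iota> (c \<odot>\<^bsub>L\<^esub> x) \<ominus>\<^bsub>T\<^esub> c \<odot>\<^bsub>T\<^esub> \<iota> x | c x. x \<in> carrier L} \<union>
    {(\<iota> x \<otimes>\<^bsub>T\<^esub> \<iota> y \<ominus>\<^bsub>T\<^esub> \<iota> y \<otimes>\<^bsub>T\<^esub> \<iota> x) \<ominus>\<^bsub>T\<^esub> \<iota> (x \<otimes>\<^bsub>L\<^esub> y) | x y. x \<in> carrier L \<and> y \<in> carrier L})"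

definition uea :: "('k::field, 'a) module \<Rightarrow> ('k, ('a list \<Rightarrow> 'k) set) module"
  where "uea L = alg_quot (free_assoc (carrier L)) (gen_ideal (free_assoc (carrier L)) (uea_relators L))"


section \<open>Yang-Mills algebras\<close>

definition ym_relator :: "nat \<Rightarrow> nat \<Rightarrow> (nat magma \<Rightarrow> 'k::field) set"
  where "ym_relator n j = (let F = free_lie {1..n}; x = free_lie_gen {1..n} in
    \<Oplus>\<^bsub>F\<^esub>i\<in>{1..n}. x i \<otimes>\<^bsub>F\<^esub> (x i \<otimes>\<^bsub>F\<^esub> x j))"

definition ym_ideal :: "nat \<Rightarrow> (nat magma \<Rightarrow> 'k::field) set set"
  where "ym_ideal n = gen_ideal (free_lie {1..n}) {ym_relator n j | j. j \<in> {1..n}}"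

definition ym :: "nat \<Rightarrow> ('k::field, (nat magma \<Rightarrow> 'k) set set) module"
  where "ym n = alg_quot (free_lie {1..n}) (ym_ideal n)"

definition ym_component :: "nat \<Rightarrow> nat \<Rightarrow> (nat magma \<Rightarrow> 'k::field) set set set"
  where "ym_component n j = (\<lambda>x. ym_ideal n +>\<^bsub>free_lie {1..n}\<^esub> x) ` free_lie_component {1..n} j"

text \<open>The sum of the components of degree at least 2, as a Lie subalgebra of \<^term>\<open>ym n\<close>.\<close>

definition tym :: "nat \<Rightarrow> ('k::field, (nat magma \<Rightarrow> 'k) set set) module"
  where "tym n = (ym n)\<lparr>carrier := lin_span (ym n) (\<Union>j\<in>{2..}. ym_component n j)\<rparr>"

definition TYM :: "nat \<Rightarrow> ('k::field, ((nat magma \<Rightarrow> 'k) set set list \<Rightarrow> 'k) set) module"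
  where "TYM n = uea (tym n)"

end

theory Submission
  imports Defs "HOL-Library.Product_Plus"
begin


text \<open>
  The theorem rests on Lazard elimination: if a Lie algebra \<open>L\<close> is free on \<open>B\<close> and
  \<open>x \<in> B\<close>, then the kernel of the character of \<open>L\<close> that sends \<open>x\<close> to 1 and
  \<open>B - {x}\<close> to 0 is free on the elements \<open>ad(x)\<^sup>k b\<close>, \<open>b \<in> B - {x}\<close>
  (\<open>lazard_elimination\<close>). A Lie algebra with relations can be treated in the same way, and it may
  happen that the relations disappear on the way. This is the case for the Yang-Mills algebra.

  Eliminate \<open>t = x\<^sub>1\<close>. On the kernel, the relation with index \<open>j \<ge> 2\<close> expresses
  \<open>ad(t)\<^sup>2 x\<^sub>j\<close> by the other elements, so that the elements \<open>x\<^sub>j\<close> and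
  \<open>y\<^sub>j = [t, x\<^sub>j]\<close> generate it; the relation with index 1 becomes
  \<open>\<Sum>\<^sub>j [x\<^sub>j, y\<^sub>j] = 0\<close> with the sum over \<open>j \<ge> 2\<close>, like the relation of a surface group. Eliminate \<open>s = x\<^sub>2\<close> next. Now
  that relation reads \<open>ad(s) y\<^sub>2 = - \<Sum>\<^sub>i [x\<^sub>i, y\<^sub>i]\<close> with the sum over
  \<open>i \<ge> 3\<close>. It removes the generators \<open>ad(s)\<^sup>k y\<^sub>2\<close>, \<open>k > 0\<close>, and no relation is
  left: the common kernel of the first two coordinate characters is free on \<open>y\<^sub>2\<close>,
  \<open>ad(s)\<^sup>k x\<^sub>i\<close> and \<open>ad(s)\<^sup>k y\<^sub>i\<close>, \<open>i \<ge> 3\<close> (\<open>ym_kernel_2_free\<close>).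
  From there on, \<open>x\<^sub>3, \<dots>, x\<^sub>n\<close> are eliminated one by one from a free Lie algebra
  (\<open>ym_kernel_free\<close>). The common kernel of all \<open>n\<close> coordinate characters is the sum of the
  components of degree at least 2 (\<open>ym_component_span\<close>).

  That a candidate set is free is always shown in the same way: it generates, and there is a
  homomorphism to a free Lie algebra that sends its elements to the free generators
  (\<open>free_onI\<close>). That homomorphism is obtained from the universal property of the bigger algebra, by
  mapping it to an extension of the free Lie algebra \<open>F\<close> by a derivation: one element \<open>x\<close>
  is added to \<open>F\<close>, with \<open>[x, u] = D u\<close> for \<open>u \<in> F\<close>, where \<open>D\<close> is the derivation of \<open>F\<close> that imitates
  \<open>ad(x)\<close>.

  The enveloping algebra of a Lie algebra that is free on \<open>S\<close> has the universal property of the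
  free associative algebra on \<open>S\<close> (\<open>uea_of_free_lie_algebra\<close>).
\<close>

section \<open>Nonassociative algebras, homomorphisms and subalgebras\<close>

lemma ring_of_type_algebra_simps [simp]:
  "carrier ring_of_type_algebra = UNIV" "monoid.mult ring_of_type_algebra = (*)"
  "one ring_of_type_algebra = 1" "add ring_of_type_algebra = (+)" "zero ring_of_type_algebra = 0"
  by (simp_all add: ring_of_type_algebra_def)

lemma a_inv_ring_of_type_algebra [simp]: "\<ominus>\<^bsub>ring_of_type_algebra\<^esub> c = - (c :: 'k::field)"
proof -
  interpret R: cring "ring_of_type_algebra :: 'k ring" by (rule cring_from_type_algebra)
  show ?thesis by (rule R.minus_equality) auto
qed

context nonassoc_algebra
begin

lemma scale_closed [simp, intro]: "x \<in> carrier A \<Longrightarrow> c \<odot> x \<in> carrier A"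
  by simp

lemma add_scale: "x \<in> carrier A \<Longrightarrow> (c + d) \<odot> x = c \<odot> x \<oplus> d \<odot> x"
  using smult_l_distr[of c d x] by simp

lemma scale_add: "x \<in> carrier A \<Longrightarrow> y \<in> carrier A \<Longrightarrow> c \<odot> (x \<oplus> y) = c \<odot> x \<oplus> c \<odot> y"
  using smult_r_distr[of c x y] by simp

lemma scale_scale: "x \<in> carrier A \<Longrightarrow> c \<odot> (d \<odot> x) = (c * d) \<odot> x"
  using smult_assoc1[of c d x] by simp

lemma scale_one [simp]: "x \<in> carrier A \<Longrightarrow> 1 \<odot> x = x"
  using smult_one[of x] by simp

lemma scale_0_left [simp]: "x \<in> carrier A \<Longrightarrow> 0 \<odot> x = \<zero>"
  using smult_l_null[of x] by simp

lemma scale_0_right [simp]: "c \<odot> \<zero> = \<zero>"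
  using smult_r_null[of c] by simp

lemma scale_minus_one: "x \<in> carrier A \<Longrightarrow> (- 1) \<odot> x = \<ominus> x"
  using smult_l_minus[of 1 x] by simp

lemma uminus_zero [simp]: "\<ominus> \<zero> = \<zero>"
  by (rule minus_equality) auto

lemma diff_eq_zero_iff [simp]: "x \<in> carrier A \<Longrightarrow> y \<in> carrier A \<Longrightarrow> x \<ominus> y = \<zero> \<longleftrightarrow> x = y"
  by (metis a_inv_closed a_minus_def minus_equality minus_minus r_neg)

declare mult_closed [simp, intro]

lemma mult_zero_left [simp]: "x \<in> carrier A \<Longrightarrow> \<zero> \<otimes> x = \<zero>"
  using mult_smult_left[of \<zero> x 0] by simp

lemma mult_zero_right [simp]: "x \<in> carrier A \<Longrightarrow> x \<otimes> \<zero> = \<zero>"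
  using mult_smult_right[of x \<zero> 0] by simp

lemma mult_minus_right: "x \<in> carrier A \<Longrightarrow> y \<in> carrier A \<Longrightarrow> x \<otimes> (\<ominus> y) = \<ominus> (x \<otimes> y)"
  using mult_smult_right[of x y "-1"] by (simp add: scale_minus_one)

end

lemma nonassoc_algebraI:
  fixes A :: "('k::field, 'a) module" (structure)
  assumes "abelian_group A"
    and "\<And>c x. x \<in> carrier A \<Longrightarrow> c \<odot> x \<in> carrier A"
    and "\<And>c d x. x \<in> carrier A \<Longrightarrow> (c + d) \<odot> x = c \<odot> x \<oplus> d \<odot> x"
    and "\<And>c x y. x \<in> carrier A \<Longrightarrow> y \<in> carrier A \<Longrightarrow> c \<odot> (x \<oplus> y) = c \<odot> x \<oplus> c \<odot> y"
    and "\<And>c d x. x \<in> carrier A \<Longrightarrow> (c * d) \<odot> x = c \<odot> (d \<odot> x)"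
    and "\<And>x. x \<in> carrier A \<Longrightarrow> 1 \<odot> x = x"
    and "\<And>x y. x \<in> carrier A \<Longrightarrow> y \<in> carrier A \<Longrightarrow> x \<otimes> y \<in> carrier A"
    and "\<And>x y z. x \<in> carrier A \<Longrightarrow> y \<in> carrier A \<Longrightarrow> z \<in> carrier A
      \<Longrightarrow> (x \<oplus> y) \<otimes> z = x \<otimes> z \<oplus> y \<otimes> z"
    and "\<And>x y z. x \<in> carrier A \<Longrightarrow> y \<in> carrier A \<Longrightarrow> z \<in> carrier A
      \<Longrightarrow> z \<otimes> (x \<oplus> y) = z \<otimes> x \<oplus> z \<otimes> y"
    and "\<And>c x y. x \<in> carrier A \<Longrightarrow> y \<in> carrier A \<Longrightarrow> (c \<odot> x) \<otimes> y = c \<odot> (x \<otimes> y)"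
    and "\<And>c x y. x \<in> carrier A \<Longrightarrow> y \<in> carrier A \<Longrightarrow> x \<otimes> (c \<odot> y) = c \<odot> (x \<otimes> y)"
  shows "nonassoc_algebra A"
  by (intro nonassoc_algebra.intro nonassoc_algebra_axioms.intro moduleI cring_from_type_algebra)
     (use assms in \<open>simp_all\<close>)

text \<open>
  The definition of \<^const>\<open>lie_hom\<close> mentions the linear structure and the product only. It therefore
  serves below for the homomorphisms of arbitrary nonassociative algebras.
\<close>

lemma lie_homI:
  assumes "\<And>x. x \<in> carrier A \<Longrightarrow> h x \<in> carrier B"
    and "\<And>x y. x \<in> carrier A \<Longrightarrow> y \<in> carrier A \<Longrightarrow> h (x \<oplus>\<^bsub>A\<^esub> y) = h x \<oplus>\<^bsub>B\<^esub> h y"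
    and "\<And>x y. x \<in> carrier A \<Longrightarrow> y \<in> carrier A \<Longrightarrow> h (x \<otimes>\<^bsub>A\<^esub> y) = h x \<otimes>\<^bsub>B\<^esub> h y"
    and "\<And>c x. x \<in> carrier A \<Longrightarrow> h (c \<odot>\<^bsub>A\<^esub> x) = c \<odot>\<^bsub>B\<^esub> h x"
  shows "h \<in> lie_hom A B"
  using assms by (auto simp: lie_hom_def)

lemma lie_homD:
  assumes "h \<in> lie_hom A B"
  shows "\<And>x. x \<in> carrier A \<Longrightarrow> h x \<in> carrier B"
    and "\<And>x y. x \<in> carrier A \<Longrightarrow> y \<in> carrier A \<Longrightarrow> h (x \<oplus>\<^bsub>A\<^esub> y) = h x \<oplus>\<^bsub>B\<^esub> h y"
    and "\<And>x y. x \<in> carrier A \<Longrightarrow> y \<in> carrier A \<Longrightarrow> h (x \<otimes>\<^bsub>A\<^esub> y) = h x \<otimes>\<^bsub>B\<^esub> h y"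
    and "\<And>c x. x \<in> carrier A \<Longrightarrow> h (c \<odot>\<^bsub>A\<^esub> x) = c \<odot>\<^bsub>B\<^esub> h x"
  using assms by (auto simp: lie_hom_def)

lemma lie_hom_comp: "g \<in> lie_hom A B \<Longrightarrow> h \<in> lie_hom B C \<Longrightarrow> h \<circ> g \<in> lie_hom A C"
  by (rule lie_homI) (simp_all add: lie_homD)

lemma lie_hom_zero:
  assumes "nonassoc_algebra A" "nonassoc_algebra B" "h \<in> lie_hom A B"
  shows "h \<zero>\<^bsub>A\<^esub> = \<zero>\<^bsub>B\<^esub>"
proof -
  interpret A: nonassoc_algebra A by fact
  interpret B: nonassoc_algebra B by fact
  have "h (0 \<odot>\<^bsub>A\<^esub> \<zero>\<^bsub>A\<^esub>) = 0 \<odot>\<^bsub>B\<^esub> h \<zero>\<^bsub>A\<^esub>" by (rule lie_homD(4)[OF assms(3)]) simp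
  then show ?thesis using lie_homD(1)[OF assms(3)] by simp
qed

lemma lie_hom_uminus:
  assumes "nonassoc_algebra A" "nonassoc_algebra B" "h \<in> lie_hom A B" "x \<in> carrier A"
  shows "h (\<ominus>\<^bsub>A\<^esub> x) = \<ominus>\<^bsub>B\<^esub> h x"
proof -
  interpret A: nonassoc_algebra A by fact
  interpret B: nonassoc_algebra B by fact
  show ?thesis using lie_homD(4)[OF assms(3,4), of "-1"] assms(4) lie_homD(1)[OF assms(3)]
    by (simp add: A.scale_minus_one B.scale_minus_one)
qed

lemma lie_hom_minus:
  assumes "nonassoc_algebra A" "nonassoc_algebra B" "h \<in> lie_hom A B" "x \<in> carrier A" "y \<in> carrier A"
  shows "h (x \<ominus>\<^bsub>A\<^esub> y) = h x \<ominus>\<^bsub>B\<^esub> h y"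
proof -
  interpret A: nonassoc_algebra A by fact
  show ?thesis using assms by (simp add: a_minus_def lie_homD lie_hom_uminus)
qed

lemma lie_hom_finsum:
  assumes "nonassoc_algebra A" "nonassoc_algebra B" "h \<in> lie_hom A B" "f \<in> I \<rightarrow> carrier A" "finite I"
  shows "h (finsum A f I) = finsum B (\<lambda>i. h (f i)) I"
  using assms(5,4)
proof (induction I)
  interpret A: nonassoc_algebra A by fact
  interpret B: nonassoc_algebra B by fact
  note [simp] = lie_homD[OF assms(3)]
  case empty
  show ?case by (simp add: lie_hom_zero[OF assms(1-3)])
next
  interpret A: nonassoc_algebra A by fact
  interpret B: nonassoc_algebra B by fact
  note [simp] = lie_homD[OF assms(3)]
  case (insert i I)
  then have "f i \<in> carrier A" "f \<in> I \<rightarrow> carrier A" by auto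
  moreover from this have "(\<lambda>i. h (f i)) \<in> I \<rightarrow> carrier B" by (auto simp: Pi_iff)
  ultimately show ?case using insert by simp
qed

lemma submodule_iff:
  assumes "nonassoc_algebra A"
  shows "submodule H ring_of_type_algebra A \<longleftrightarrow> H \<subseteq> carrier A \<and> \<zero>\<^bsub>A\<^esub> \<in> H \<and>
    (\<forall>x\<in>H. \<forall>y\<in>H. x \<oplus>\<^bsub>A\<^esub> y \<in> H) \<and> (\<forall>c. \<forall>x\<in>H. c \<odot>\<^bsub>A\<^esub> x \<in> H)" (is "_ \<longleftrightarrow> ?R")
proof
  interpret nonassoc_algebra A by fact
  assume H: "submodule H ring_of_type_algebra A"
  note * = submoduleE[OF H]
  have "\<zero>\<^bsub>A\<^esub> \<in> H" using *(2,4,1) scale_0_left by (metis UNIV_I ex_in_conv ring_of_type_algebra_simps(1) subsetD)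
  then show ?R using * by auto
next
  interpret nonassoc_algebra A by fact
  assume R: ?R
  show "submodule H ring_of_type_algebra A"
  proof (rule submoduleI)
    fix a assume "a \<in> H" then show "\<ominus>\<^bsub>A\<^esub> a \<in> H"
      using R by (metis scale_minus_one subsetD)
  qed (use R in auto)
qed

definition subalg :: "'a set \<Rightarrow> ('k::field, 'a) module \<Rightarrow> bool"
  where "subalg H A \<longleftrightarrow> H \<subseteq> carrier A \<and> \<zero>\<^bsub>A\<^esub> \<in> H \<and>
    (\<forall>x\<in>H. \<forall>y\<in>H. x \<oplus>\<^bsub>A\<^esub> y \<in> H) \<and> (\<forall>c. \<forall>x\<in>H. c \<odot>\<^bsub>A\<^esub> x \<in> H) \<and>
    (\<forall>x\<in>H. \<forall>y\<in>H. x \<otimes>\<^bsub>A\<^esub> y \<in> H)"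

definition generates :: "('k::field, 'a) module \<Rightarrow> 'a set \<Rightarrow> bool"
  where "generates A S \<longleftrightarrow> S \<subseteq> carrier A \<and> (\<forall>H. subalg H A \<longrightarrow> S \<subseteq> H \<longrightarrow> carrier A \<subseteq> H)"

lemma alg_ideal_iff:
  assumes "nonassoc_algebra A"
  shows "alg_ideal H A \<longleftrightarrow> H \<subseteq> carrier A \<and> \<zero>\<^bsub>A\<^esub> \<in> H \<and>
    (\<forall>x\<in>H. \<forall>y\<in>H. x \<oplus>\<^bsub>A\<^esub> y \<in> H) \<and> (\<forall>c. \<forall>x\<in>H. c \<odot>\<^bsub>A\<^esub> x \<in> H) \<and>
    (\<forall>x\<in>carrier A. \<forall>y\<in>H. x \<otimes>\<^bsub>A\<^esub> y \<in> H \<and> y \<otimes>\<^bsub>A\<^esub> x \<in> H)"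
  by (auto simp: alg_ideal_def submodule_iff[OF assms])

lemma subalg_carrier: "nonassoc_algebra A \<Longrightarrow> subalg (carrier A) A"
proof -
  assume "nonassoc_algebra A"
  then interpret nonassoc_algebra A .
  show ?thesis by (auto simp: subalg_def)
qed

lemma lie_algebra_subalg:
  assumes "lie_algebra L" "subalg H L"
  shows "lie_algebra (L\<lparr>carrier := H\<rparr>)"
proof -
  interpret lie_algebra L by fact
  have sub: "submodule H ring_of_type_algebra L"
    using assms(2) by (simp add: submodule_iff[OF nonassoc_algebra_axioms] subalg_def)
  interpret M: module ring_of_type_algebra "L\<lparr>carrier := H\<rparr>"
    by (rule submodule.submodule_is_module[OF sub module_axioms])
  have "H \<subseteq> carrier L" using assms(2) by (simp add: subalg_def)
  then have [simp]: "x \<in> H \<Longrightarrow> x \<in> carrier L" for x by auto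
  show ?thesis
    by unfold_locales
      (use assms(2) in \<open>simp_all add: subalg_def mult_add_left mult_add_right mult_smult_left
        mult_smult_right bracket_self jacobi\<close>)
qed

lemma subalg_equalizer:
  assumes "nonassoc_algebra A" "nonassoc_algebra B" "g \<in> lie_hom A B" "h \<in> lie_hom A B"
  shows "subalg {x \<in> carrier A. g x = h x} A"
proof -
  interpret A: nonassoc_algebra A by fact
  show ?thesis using assms by (auto simp: subalg_def lie_homD lie_hom_zero)
qed

lemma lie_hom_eqI:
  assumes "nonassoc_algebra A" "nonassoc_algebra B" "g \<in> lie_hom A B" "h \<in> lie_hom A B"
    and "generates A S" "\<And>x. x \<in> S \<Longrightarrow> g x = h x" "x \<in> carrier A"
  shows "g x = h x"
  using subalg_equalizer[OF assms(1-4)] assms(5-7) unfolding generates_def by blast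

lemma subalg_vimage:
  assumes "nonassoc_algebra A" "nonassoc_algebra B" "h \<in> lie_hom A B" "subalg H B"
  shows "subalg {x \<in> carrier A. h x \<in> H} A"
proof -
  interpret A: nonassoc_algebra A by fact
  show ?thesis using assms by (auto simp: subalg_def lie_homD lie_hom_zero)
qed

lemma alg_ideal_kernel:
  assumes "nonassoc_algebra A" "nonassoc_algebra B" "h \<in> lie_hom A B"
  shows "alg_ideal {x \<in> carrier A. h x = \<zero>\<^bsub>B\<^esub>} A"
proof -
  interpret A: nonassoc_algebra A by fact
  interpret B: nonassoc_algebra B by fact
  show ?thesis using assms by (auto simp: alg_ideal_iff lie_homD lie_hom_zero)
qed

text \<open>
  Every law of a nonassociative algebra is an identity and hence passes to surjective images. For a
  quotient this leaves only the compatibility of the projection with the operations to be checked.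
\<close>

lemma nonassoc_algebra_image:
  assumes "nonassoc_algebra A" "h \<in> lie_hom A B" "h ` carrier A = carrier B" "h \<zero>\<^bsub>A\<^esub> = \<zero>\<^bsub>B\<^esub>"
  shows "nonassoc_algebra B"
proof -
  interpret A: nonassoc_algebra A by fact
  note h = lie_homD(2-4)[OF assms(2), symmetric]
  have ab: "abelian_group B"
  proof (rule abelian_groupI, unfold assms(3)[symmetric])
    fix x assume "x \<in> h ` carrier A"
    then obtain u where u: "u \<in> carrier A" "x = h u" by auto
    have "h (\<ominus>\<^bsub>A\<^esub> u) \<oplus>\<^bsub>B\<^esub> x = \<zero>\<^bsub>B\<^esub>" using u by (simp add: h A.l_neg assms(4))
    then show "\<exists>y\<in>h ` carrier A. y \<oplus>\<^bsub>B\<^esub> x = \<zero>\<^bsub>B\<^esub>" using u(1) by blast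
  qed (auto simp: h A.a_assoc A.a_comm A.a_lcomm assms(4)[symmetric])
  show ?thesis
    by (rule nonassoc_algebraI[OF ab], unfold assms(3)[symmetric])
       (auto simp: h A.add_scale A.scale_add A.scale_scale A.mult_add_left A.mult_add_right
          A.mult_smult_left A.mult_smult_right)
qed

section \<open>Quotients\<close>

lemma alg_ideal_gen_ideal:
  assumes "nonassoc_algebra A" "S \<subseteq> carrier A"
  shows "alg_ideal (gen_ideal A S) A"
proof -
  interpret nonassoc_algebra A by fact
  have "alg_ideal (carrier A) A" by (auto simp: alg_ideal_iff assms)
  then have "gen_ideal A S \<subseteq> carrier A" using assms(2) unfolding gen_ideal_def by blast
  then show ?thesis unfolding alg_ideal_iff[OF assms(1)] gen_ideal_def
    by (auto simp: alg_ideal_iff[OF assms(1)])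
qed

lemma gen_ideal_superset: "S \<subseteq> gen_ideal A S"
  by (auto simp: gen_ideal_def)

lemma gen_ideal_least: "alg_ideal I A \<Longrightarrow> S \<subseteq> I \<Longrightarrow> gen_ideal A S \<subseteq> I"
  by (auto simp: gen_ideal_def)

locale algebra_with_ideal = nonassoc_algebra A for A :: "('k::field, 'a) module" (structure) +
  fixes I assumes ideal: "alg_ideal I A"
begin

abbreviation proj :: "'a \<Rightarrow> 'a set" where "proj x \<equiv> I +>\<^bsub>A\<^esub> x"

lemmas ideal' = ideal[unfolded alg_ideal_iff[OF nonassoc_algebra_axioms]]

sublocale abelian_subgroup I A
proof (rule abelian_subgroupI3)
  have "submodule I ring_of_type_algebra A" using ideal by (simp add: alg_ideal_def)
  then show "additive_subgroup I A"
    by (simp add: additive_subgroup_def submodule_def)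
  show "abelian_group A" by unfold_locales
qed

lemma proj_eq_iff: "x \<in> carrier A \<Longrightarrow> y \<in> carrier A \<Longrightarrow> proj x = proj y \<longleftrightarrow> x \<ominus> y \<in> I"
  by (metis a_minus_def a_rcos_module a_rcos_self a_repr_independence' is_abelian_group is_abelian_subgroup)

lemma proj_carrier: "proj ` carrier A = carrier (alg_quot A I)"
  by (auto simp: alg_quot_def A_RCOSETS_def' )

lemma mem_proj: "x \<in> carrier A \<Longrightarrow> u \<in> proj x \<Longrightarrow> \<exists>i\<in>I. u = i \<oplus> x"
  by (auto simp: a_r_coset_def')

lemma proj_mult: assumes "x \<in> carrier A" "y \<in> carrier A" 
  shows "rcoset_mult A I (proj x) (proj y) = proj (x \<otimes> y)"
proof -
  have "proj (a \<otimes> b) = proj (x \<otimes> y)" if "a \<in> proj x" "b \<in> proj y" for a b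
  proof -
    from that assms obtain i j where ij: "i \<in> I" "j \<in> I" "a = i \<oplus> x" "b = j \<oplus> y"
      using mem_proj by meson
    then have c: "i \<in> carrier A" "j \<in> carrier A" by auto
    have "a \<otimes> b \<ominus> x \<otimes> y = i \<otimes> (j \<oplus> y) \<oplus> x \<otimes> j"
      using assms c by (simp add: ij mult_add_left mult_add_right a_minus_def a_ac r_neg)
    also have "\<dots> \<in> I" using ideal' ij c assms by auto
    finally show ?thesis using assms c ij by (subst proj_eq_iff) auto
  qed
  moreover have "x \<in> proj x" "y \<in> proj y" using assms a_rcos_self by auto
  ultimately show ?thesis unfolding rcoset_mult_def by blast
qed

lemma proj_smult: assumes "x \<in> carrier A" 
  shows "(\<Union>u\<in>proj x. proj (c \<odot> u)) = proj (c \<odot> x)"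
proof -
  have "proj (c \<odot> a) = proj (c \<odot> x)" if "a \<in> proj x" for a
  proof -
    from that assms obtain i where ij: "i \<in> I" "a = i \<oplus> x" 
      using mem_proj by meson
    then have c: "i \<in> carrier A" by auto
    have "c \<odot> a \<ominus> c \<odot> x = c \<odot> i"
      using assms c by (simp add: ij scale_add a_minus_def a_ac r_neg)
    also have "\<dots> \<in> I" using ideal' ij c assms by auto
    finally show ?thesis using assms c ij by (subst proj_eq_iff) auto
  qed
  moreover have "x \<in> proj x" using assms a_rcos_self by auto
  ultimately show ?thesis by blast
qed

lemma proj_hom: "proj \<in> lie_hom A (alg_quot A I)"
  by (rule lie_homI)
     (auto simp: alg_quot_def A_RCOSETS_def' a_rcos_sum proj_mult proj_smult)

lemma zero_quot: "proj \<zero> = \<zero>\<^bsub>alg_quot A I\<^esub>" 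
  using a_subset by (simp add: alg_quot_def)

lemma nonassoc_quot: "nonassoc_algebra (alg_quot A I)"
  by (rule nonassoc_algebra_image[OF nonassoc_algebra_axioms proj_hom proj_carrier zero_quot])

lemma proj_zero_iff: "x \<in> carrier A \<Longrightarrow> proj x = \<zero>\<^bsub>alg_quot A I\<^esub> \<longleftrightarrow> x \<in> I"
  by (simp add: zero_quot[symmetric] proj_eq_iff a_minus_def uminus_zero del: a_coset_add_zero)

lemma quot_universal:
  assumes "nonassoc_algebra B" "h \<in> lie_hom A B" "\<And>x. x \<in> I \<Longrightarrow> h x = \<zero>\<^bsub>B\<^esub>"
  obtains g where "g \<in> lie_hom (alg_quot A I) B" "\<And>x. x \<in> carrier A \<Longrightarrow> g (proj x) = h x"
proof -
  interpret B: nonassoc_algebra B by fact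
  define g where "g C = h (SOME x. x \<in> carrier A \<and> proj x = C)" for C
  have g: "g (proj x) = h x" if "x \<in> carrier A" for x
  proof -
    let ?y = "SOME y. y \<in> carrier A \<and> proj y = proj x"
    have y: "?y \<in> carrier A \<and> proj ?y = proj x" by (rule someI) (use that in auto)
    then have "h (?y \<ominus> x) = \<zero>\<^bsub>B\<^esub>" using that using proj_eq_iff by (intro assms(3)) blast
    then have "h ?y = h x" using y that assms(2) lie_homD(1)[OF assms(2)]
      by (simp add: lie_hom_minus[OF nonassoc_algebra_axioms assms(1,2)] B.diff_eq_zero_iff)
    then show ?thesis by (simp add: g_def)
  qed
  note p = lie_homD(2-4)[OF proj_hom, symmetric]
  have "g \<in> lie_hom (alg_quot A I) B"
    by (rule lie_homI, unfold proj_carrier[symmetric])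
       (auto simp: p g lie_homD[OF assms(2)])
  then show ?thesis using g by (rule that)
qed

lemma generates_quot: "generates A S \<Longrightarrow> generates (alg_quot A I) (proj ` S)"
  unfolding generates_def
proof (safe, goal_cases)
  case (1 x) then show ?case using lie_homD(1)[OF proj_hom] by auto
next
  case (2 H x)
  have *: "subalg {x \<in> carrier A. proj x \<in> H} A"
    by (rule subalg_vimage[OF nonassoc_algebra_axioms nonassoc_quot proj_hom 2(3)])
  have "S \<subseteq> {x \<in> carrier A. proj x \<in> H}" using 2 by auto
  with 2(2) * have "carrier A \<subseteq> {x \<in> carrier A. proj x \<in> H}" by blast
  then show ?case using 2(5) by (auto simp: proj_carrier[symmetric])
qed

end


lemma gen_ideal_kills:
  assumes "nonassoc_algebra A" "nonassoc_algebra B" "h \<in> lie_hom A B" "S \<subseteq> carrier A"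
    and "\<And>x. x \<in> S \<Longrightarrow> h x = \<zero>\<^bsub>B\<^esub>" "x \<in> gen_ideal A S"
  shows "h x = \<zero>\<^bsub>B\<^esub>"
  using gen_ideal_least[OF alg_ideal_kernel[OF assms(1-3)], of S] assms(4-6) by blast

lemma generates_subset: "generates A S \<Longrightarrow> S \<subseteq> carrier A"
  by (simp add: generates_def)

lemma generatesD: "generates A S \<Longrightarrow> subalg H A \<Longrightarrow> S \<subseteq> H \<Longrightarrow> carrier A \<subseteq> H"
  by (simp add: generates_def)

section \<open>Finitely supported functions\<close>

definition finsupp :: "'w set \<Rightarrow> ('w \<Rightarrow> 'k::field) set"
  where "finsupp W = {f. finite {w. f w \<noteq> 0} \<and> {w. f w \<noteq> 0} \<subseteq> W}"

lemma finsupp_zero: "(\<lambda>w. 0) \<in> finsupp W"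
  by (simp add: finsupp_def)

lemma finsupp_add: "f \<in> finsupp W \<Longrightarrow> g \<in> finsupp W \<Longrightarrow> (\<lambda>w. f w + g w) \<in> finsupp W"
proof -
  have "{w. f w + g w \<noteq> 0} \<subseteq> {w. f w \<noteq> 0} \<union> {w. g w \<noteq> 0}" by auto
  then show "f \<in> finsupp W \<Longrightarrow> g \<in> finsupp W \<Longrightarrow> ?thesis"
    unfolding finsupp_def by (auto dest: finite_subset)
qed

lemma finsupp_scale: "f \<in> finsupp W \<Longrightarrow> (\<lambda>w. c * f w) \<in> finsupp W"
  unfolding finsupp_def by (auto intro: finite_subset[of _ "{w. f w \<noteq> 0}"])

lemma finsupp_monomial: "w \<in> W \<Longrightarrow> monomial w \<in> finsupp W"
  by (auto simp: finsupp_def monomial_def)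

text \<open>
  Properties that are closed under linear combinations need to be checked on monomials only. Bilinear
  identities in free algebras are reduced to monomials by one such induction for each argument.
\<close>

lemma finsupp_induct [consumes 1, case_names zero add scale monomial]:
  assumes f: "f \<in> finsupp W"
    and zero: "P (\<lambda>w. 0)"
    and add: "\<And>f g. f \<in> finsupp W \<Longrightarrow> g \<in> finsupp W \<Longrightarrow> P f \<Longrightarrow> P g \<Longrightarrow> P (\<lambda>w. f w + g w)"
    and scale: "\<And>c f. f \<in> finsupp W \<Longrightarrow> P f \<Longrightarrow> P (\<lambda>w. c * f w)"
    and monom: "\<And>w. w \<in> W \<Longrightarrow> P (monomial w)"
  shows "P f"
proof -
  have "finite F \<Longrightarrow> F \<subseteq> W \<Longrightarrow> {w. f w \<noteq> 0} \<subseteq> F \<Longrightarrow> P f" for F and f :: "'a \<Rightarrow> 'b"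
  proof (induction F arbitrary: f rule: finite_induct)
    case empty
    then have "f = (\<lambda>w. 0)" by auto
    with zero show ?case by simp
  next
    case (insert w F)
    have m: "(\<lambda>v. f w * monomial w v) \<in> finsupp W"
      using insert by (intro finsupp_scale finsupp_monomial) auto
    have f0: "f(w := 0) \<in> finsupp W"
      using insert by (auto simp: finsupp_def intro: finite_subset[of _ F])
    have "f = (\<lambda>v. (f(w := 0)) v + f w * monomial w v)"
      by (auto simp: monomial_def)
    moreover have "P (f(w := 0))" using insert by (intro insert.IH) auto
    moreover have "P (\<lambda>v. f w * monomial w v)"
      using insert by (intro scale monom finsupp_monomial) auto
    ultimately show ?case using add[OF f0 m] by simp
  qed
  then show ?thesis using f unfolding finsupp_def by blast
qed

definition linear_extension :: "('k::field, 'a) module \<Rightarrow> ('w \<Rightarrow> 'a) \<Rightarrow> ('w \<Rightarrow> 'k) \<Rightarrow> 'a"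
  where "linear_extension A e f = (\<Oplus>\<^bsub>A\<^esub>w\<in>{w. f w \<noteq> 0}. f w \<odot>\<^bsub>A\<^esub> e w)"

context nonassoc_algebra
begin

lemma linear_extension_superset:
  assumes "e \<in> W \<rightarrow> carrier A" "finite F" "F \<subseteq> W" "{w. f w \<noteq> 0} \<subseteq> F"
  shows "linear_extension A e f = (\<Oplus>w\<in>F. f w \<odot> e w)"
  unfolding linear_extension_def
proof (rule add.finprod_mono_neutral_cong_left)
  show "f w \<odot> e w = \<zero>" if "w \<in> F - {w. f w \<noteq> 0}" for w
    using that assms by (auto simp: Pi_iff subset_iff)
  show "(\<lambda>w. f w \<odot> e w) \<in> F \<rightarrow> carrier A"
    using assms by (auto simp: Pi_iff subset_iff)
qed (use assms in auto)

lemma linear_extension_closed: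
  "e \<in> W \<rightarrow> carrier A \<Longrightarrow> f \<in> finsupp W \<Longrightarrow> linear_extension A e f \<in> carrier A"
  unfolding linear_extension_def by (rule finsum_closed) (auto simp: finsupp_def)

lemma linear_extension_add:
  assumes "e \<in> W \<rightarrow> carrier A" "f \<in> finsupp W" "g \<in> finsupp W"
  shows "linear_extension A e (\<lambda>w. f w + g w) = linear_extension A e f \<oplus> linear_extension A e g"
proof -
  define F where "F = {w. f w \<noteq> 0} \<union> {w. g w \<noteq> 0}"
  have F: "finite F" "F \<subseteq> W" using assms by (auto simp: F_def finsupp_def)
  then have *: "w \<in> F \<Longrightarrow> e w \<in> carrier A" for w using assms(1) by auto
  have "linear_extension A e (\<lambda>w. f w + g w) = (\<Oplus>w\<in>F. (f w + g w) \<odot> e w)"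
    by (rule linear_extension_superset[OF assms(1) F]) (auto simp: F_def)
  also have "\<dots> = (\<Oplus>w\<in>F. f w \<odot> e w \<oplus> g w \<odot> e w)"
    by (rule finsum_cong') (auto simp: * add_scale)
  also have "\<dots> = (\<Oplus>w\<in>F. f w \<odot> e w) \<oplus> (\<Oplus>w\<in>F. g w \<odot> e w)"
    by (rule finsum_addf) (auto simp: *)
  finally show ?thesis
    using linear_extension_superset[OF assms(1) F, of f] linear_extension_superset[OF assms(1) F, of g]
    by (simp add: F_def)
qed

lemma linear_extension_scale:
  assumes "e \<in> W \<rightarrow> carrier A" "f \<in> finsupp W"
  shows "linear_extension A e (\<lambda>w. c * f w) = c \<odot> linear_extension A e f"
proof -
  define F where "F = {w. f w \<noteq> 0}"
  have F: "finite F" "F \<subseteq> W" using assms by (auto simp: F_def finsupp_def)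
  then have *: "w \<in> F \<Longrightarrow> e w \<in> carrier A" for w using assms(1) by auto
  have "linear_extension A e (\<lambda>w. c * f w) = (\<Oplus>w\<in>F. (c * f w) \<odot> e w)"
    by (rule linear_extension_superset[OF assms(1) F]) (auto simp: F_def)
  also have "\<dots> = (\<Oplus>w\<in>F. c \<odot> (f w \<odot> e w))"
    by (rule finsum_cong') (auto simp: * scale_scale)
  also have "\<dots> = c \<odot> (\<Oplus>w\<in>F. f w \<odot> e w)"
    by (rule finsum_smult_ldistr[symmetric]) (auto simp: * F)
  finally show ?thesis
    by (simp add: F_def linear_extension_def)
qed

lemma linear_extension_monomial:
  assumes "e \<in> W \<rightarrow> carrier A" "w \<in> W"
  shows "linear_extension A e (monomial w) = e w"
proof -
  have "e w \<in> carrier A" using assms by auto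
  moreover have "linear_extension A e (monomial w) = (\<Oplus>v\<in>{w}. monomial w v \<odot> e v)"
    using assms by (intro linear_extension_superset) (auto simp: monomial_def)
  ultimately show ?thesis by (simp add: monomial_def)
qed

end

text \<open>
  The common part of the universal properties of the free nonassociative and of the free associative
  algebra: both have a multiplicative basis, and multiplicativity on the basis is enough by
  bilinearity.
\<close>

lemma linear_extension_hom:
  fixes A :: "('k::field, 'a) module" and F :: "('k, 'w \<Rightarrow> 'k) module"
  assumes F: "nonassoc_algebra F" and A: "nonassoc_algebra A" and carrier: "carrier F = finsupp W"
    and F_add: "\<And>f g. f \<oplus>\<^bsub>F\<^esub> g = (\<lambda>w. f w + g w)"
    and F_scale: "\<And>c f. c \<odot>\<^bsub>F\<^esub> f = (\<lambda>w. c * f w)" and F_zero: "\<zero>\<^bsub>F\<^esub> = (\<lambda>w. 0)"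
    and e: "e \<in> W \<rightarrow> carrier A"
    and mult: "\<And>u v. u \<in> W \<Longrightarrow> v \<in> W \<Longrightarrow> linear_extension A e (monomial u \<otimes>\<^bsub>F\<^esub> monomial v) = e u \<otimes>\<^bsub>A\<^esub> e v"
  shows "linear_extension A e \<in> lie_hom F A"
proof -
  interpret A: nonassoc_algebra A by fact
  interpret F: nonassoc_algebra F by fact
  define h where "h = (linear_extension A e :: _ \<Rightarrow> 'a)"
  have h_closed: "h f \<in> carrier A" if "f \<in> carrier F" for f
    unfolding h_def using that by (intro A.linear_extension_closed[OF e]) (simp add: carrier)
  have h_add: "h (f \<oplus>\<^bsub>F\<^esub> g) = h f \<oplus>\<^bsub>A\<^esub> h g" if "f \<in> carrier F" "g \<in> carrier F" for f g
    unfolding h_def F_add using that by (intro A.linear_extension_add[OF e]) (simp_all add: carrier)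
  have h_scale: "h (c \<odot>\<^bsub>F\<^esub> f) = c \<odot>\<^bsub>A\<^esub> h f" if "f \<in> carrier F" for c f
    unfolding h_def F_scale using that by (intro A.linear_extension_scale[OF e]) (simp add: carrier)
  have h_monom: "h (monomial w) = e w" if "w \<in> W" for w
    unfolding h_def by (rule A.linear_extension_monomial[OF e that])
  have h_zero: "h \<zero>\<^bsub>F\<^esub> = \<zero>\<^bsub>A\<^esub>" using h_scale[of "\<zero>\<^bsub>F\<^esub>" 0] h_closed[of "\<zero>\<^bsub>F\<^esub>"] by simp
  have monom: "monomial w \<in> carrier F" if "w \<in> W" for w
    unfolding carrier using that by (rule finsupp_monomial)
  note [simp] = h_closed h_add h_scale h_zero monom
  have carrier': "f \<in> carrier F" if "f \<in> finsupp W" for f using that by (simp only: carrier)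
  have mult1: "h (monomial u \<otimes>\<^bsub>F\<^esub> g) = h (monomial u) \<otimes>\<^bsub>A\<^esub> h g"
    if u: "u \<in> W" and "g \<in> finsupp W" for u g
    using that(2)
  proof (induction g rule: finsupp_induct)
    case zero
    show ?case unfolding F_zero[symmetric] using u by simp
  next
    case (add f g)
    then show ?case unfolding F_add[symmetric] using u carrier'[OF add(1)] carrier'[OF add(2)]
      by (simp add: F.mult_add_right A.mult_add_right)
  next
    case (scale c f)
    then show ?case unfolding F_scale[symmetric] using u carrier'[OF scale(1)]
      by (simp add: F.mult_smult_right A.mult_smult_right)
  next
    case (monomial v)
    then show ?case using u mult[of u v] h_monom[of u] h_monom[of v] by (simp add: h_def)
  qed
  have mult2: "h (f \<otimes>\<^bsub>F\<^esub> g) = h f \<otimes>\<^bsub>A\<^esub> h g"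
    if "f \<in> finsupp W" and "g \<in> finsupp W" for f g
    using that(1)
  proof (induction f rule: finsupp_induct)
    case zero
    show ?case unfolding F_zero[symmetric] using carrier'[OF that(2)] by simp
  next
    case (add f f')
    then show ?case unfolding F_add[symmetric]
      using carrier'[OF that(2)] carrier'[OF add(1)] carrier'[OF add(2)]
      by (simp add: F.mult_add_left A.mult_add_left)
  next
    case (scale c f)
    then show ?case unfolding F_scale[symmetric] using carrier'[OF that(2)] carrier'[OF scale(1)]
      by (simp add: F.mult_smult_left A.mult_smult_left)
  next
    case (monomial v)
    then show ?case using that(2) by (rule mult1)
  qed
  have "h \<in> lie_hom F A"
  proof (rule lie_homI)
    show "h (f \<otimes>\<^bsub>F\<^esub> g) = h f \<otimes>\<^bsub>A\<^esub> h g" if "f \<in> carrier F" "g \<in> carrier F" for f g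
      using that unfolding carrier by (rule mult2)
  qed (rule h_closed h_add h_scale; assumption)+
  then show ?thesis by (simp add: h_def)
qed

section \<open>The free nonassociative algebra\<close>

lemma carrier_free_nonassoc: "carrier (free_nonassoc S) = finsupp {w. set_magma w \<subseteq> S}"
  by (auto simp: free_nonassoc_def finsupp_def)

lemma free_nonassoc_simps:
  "f \<otimes>\<^bsub>free_nonassoc S\<^esub> g = (\<lambda>w. case w of Gen x \<Rightarrow> 0 | Prod u v \<Rightarrow> f u * g v)"
  "f \<oplus>\<^bsub>free_nonassoc S\<^esub> g = (\<lambda>w. f w + g w)"
  "c \<odot>\<^bsub>free_nonassoc S\<^esub> f = (\<lambda>w. c * f w)"
  "\<zero>\<^bsub>free_nonassoc S\<^esub> = (\<lambda>w. 0)"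
  by (simp_all add: free_nonassoc_def)

lemma free_nonassoc_algebra: "nonassoc_algebra (free_nonassoc S :: ('k::field, 'x magma \<Rightarrow> 'k) module)"
proof (rule nonassoc_algebraI, rule abelian_groupI, goal_cases)
  case (6 f)
  then show ?case
    by (intro bexI[of _ "\<lambda>w. - 1 * f w"]) (simp_all only: carrier_free_nonassoc free_nonassoc_simps finsupp_scale, simp)
next
  case (12 f g)
  have "{w. (case w of Gen x \<Rightarrow> 0 | Prod u v \<Rightarrow> f u * g v) \<noteq> 0}
     \<subseteq> (\<lambda>(u,v). Prod u v) ` ({w. f w \<noteq> 0} \<times> {w. g w \<noteq> 0})" (is "?L \<subseteq> ?R")
  proof
    fix w assume "w \<in> ?L"
    then show "w \<in> ?R" by (cases w) auto
  qed
  moreover have "finite ?R" using 12 by (auto simp: carrier_free_nonassoc finsupp_def)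
  ultimately have "finite ?L" by (rule finite_subset)
  moreover have "?L \<subseteq> {w. set_magma w \<subseteq> S}"
  proof
    fix w assume "w \<in> ?L"
    then show "w \<in> {w. set_magma w \<subseteq> S}"
      using 12 by (cases w) (auto simp: carrier_free_nonassoc finsupp_def)
  qed
  ultimately show ?case
    by (simp add: carrier_free_nonassoc finsupp_def free_nonassoc_simps)
qed (auto simp: carrier_free_nonassoc free_nonassoc_simps finsupp_add finsupp_scale finsupp_zero
      algebra_simps fun_eq_iff split: magma.splits)

lemma monomial_Prod: "monomial (Prod u v) = monomial u \<otimes>\<^bsub>free_nonassoc S\<^esub> monomial v"
  by (auto simp: monomial_def free_nonassoc_simps fun_eq_iff split: magma.splits)

primrec magma_eval :: "('k, 'a) module \<Rightarrow> ('x \<Rightarrow> 'a) \<Rightarrow> 'x magma \<Rightarrow> 'a"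
  where
    "magma_eval A \<phi> (Gen x) = \<phi> x"
  | "magma_eval A \<phi> (Prod u v) = magma_eval A \<phi> u \<otimes>\<^bsub>A\<^esub> magma_eval A \<phi> v"

lemma free_nonassoc_universal:
  fixes A :: "('k::field, 'a) module" and \<phi> :: "'x \<Rightarrow> 'a"
  assumes "nonassoc_algebra A" "\<phi> \<in> S \<rightarrow> carrier A"
  obtains h where "h \<in> lie_hom (free_nonassoc S) A" "\<And>x. x \<in> S \<Longrightarrow> h (monomial (Gen x)) = \<phi> x"
proof (rule that)
  interpret A: nonassoc_algebra A by fact
  let ?W = "{w. set_magma w \<subseteq> S}"
  let ?e = "magma_eval A \<phi>"
  have e: "?e \<in> ?W \<rightarrow> carrier A"
  proof
    fix w :: "'x magma" assume "w \<in> ?W"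
    then show "?e w \<in> carrier A" using assms(2) by (induction w) auto
  qed
  show "linear_extension A ?e \<in> lie_hom (free_nonassoc S) A"
  proof (rule linear_extension_hom[OF free_nonassoc_algebra assms(1) carrier_free_nonassoc
      free_nonassoc_simps(2-4) e])
    show "linear_extension A ?e (monomial u \<otimes>\<^bsub>free_nonassoc S\<^esub> monomial v) = ?e u \<otimes>\<^bsub>A\<^esub> ?e v"
      if "u \<in> ?W" "v \<in> ?W" for u v
      using that A.linear_extension_monomial[OF e, of "Prod u v"] by (simp add: monomial_Prod[symmetric])
  qed
  show "linear_extension A ?e (monomial (Gen x)) = \<phi> x" if "x \<in> S" for x
    using A.linear_extension_monomial[OF e, of "Gen x"] that by simp
qed

lemma generates_free_nonassoc:
  "generates (free_nonassoc S :: ('k::field, 'x magma \<Rightarrow> 'k) module) ((\<lambda>x. monomial (Gen x)) ` S)"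
  unfolding generates_def
proof (intro conjI allI impI subsetI)
  let ?F = "free_nonassoc S :: ('k, 'x magma \<Rightarrow> 'k) module"
  fix f :: "'x magma \<Rightarrow> 'k" assume "f \<in> (\<lambda>x. monomial (Gen x)) ` S"
  then show "f \<in> carrier ?F" by (auto simp: carrier_free_nonassoc intro!: finsupp_monomial)
next
  let ?F = "free_nonassoc S :: ('k, 'x magma \<Rightarrow> 'k) module"
  fix H and f :: "'x magma \<Rightarrow> 'k" assume H: "subalg H ?F" "(\<lambda>x. monomial (Gen x)) ` S \<subseteq> H" and f: "f \<in> carrier ?F"
  have monom: "set_magma w \<subseteq> S \<Longrightarrow> monomial w \<in> H" for w
  proof (induction w)
    case (Prod u v)
    then have "monomial u \<in> H" "monomial v \<in> H" by auto
    then show ?case unfolding monomial_Prod[of u v S] using H(1) unfolding subalg_def by blast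
  qed (use H in auto)
  show "f \<in> H"
    using f unfolding carrier_free_nonassoc
    by (induction f rule: finsupp_induct)
       (use H(1) monom in \<open>auto simp: subalg_def free_nonassoc_simps(2-4)\<close>)
qed

section \<open>The free Lie algebra\<close>

lemma lie_relators_subset: "nonassoc_algebra A \<Longrightarrow> lie_relators A \<subseteq> carrier A"
proof -
  assume "nonassoc_algebra A"
  then interpret nonassoc_algebra A .
  show ?thesis by (auto simp: lie_relators_def)
qed

lemma alg_ideal_free_lie: "alg_ideal (free_lie_ideal S) (free_nonassoc S)"
  unfolding free_lie_ideal_def
  by (intro alg_ideal_gen_ideal free_nonassoc_algebra lie_relators_subset)

lemma free_lie_with_ideal:
  fixes S :: "'x set"
  shows "algebra_with_ideal (free_nonassoc S :: ('k::field, _) module) (free_lie_ideal S)"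
  by (rule algebra_with_ideal.intro[OF free_nonassoc_algebra algebra_with_ideal_axioms.intro[OF alg_ideal_free_lie]])

lemma free_lie_nonassoc: "nonassoc_algebra (free_lie S)"
  unfolding free_lie_def by (rule algebra_with_ideal.nonassoc_quot[OF free_lie_with_ideal])

abbreviation free_lie_proj :: "'x set \<Rightarrow> ('x magma \<Rightarrow> 'k::field) \<Rightarrow> ('x magma \<Rightarrow> 'k) set"
  where "free_lie_proj S f \<equiv> free_lie_ideal S +>\<^bsub>free_nonassoc S\<^esub> f"

lemma free_lie_proj_hom: "free_lie_proj S \<in> lie_hom (free_nonassoc S) (free_lie S)"
  unfolding free_lie_def by (rule algebra_with_ideal.proj_hom[OF free_lie_with_ideal])

lemma free_lie_proj_surj: "free_lie_proj S ` carrier (free_nonassoc S) = carrier (free_lie S)"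
  unfolding free_lie_def by (rule algebra_with_ideal.proj_carrier[OF free_lie_with_ideal])

lemma free_lie_proj_zero_iff:
  "f \<in> carrier (free_nonassoc S) \<Longrightarrow> free_lie_proj S f = \<zero>\<^bsub>free_lie S\<^esub> \<longleftrightarrow> f \<in> free_lie_ideal S"
  unfolding free_lie_def by (rule algebra_with_ideal.proj_zero_iff[OF free_lie_with_ideal])

lemma free_lie_algebra:
  fixes S :: "'x set"
  shows "lie_algebra (free_lie S :: ('k::field, _) module)"
proof -
  let ?N = "free_nonassoc S :: ('k, _) module"
  let ?F = "free_lie S :: ('k, _) module"
  let ?p = "free_lie_proj S :: _ \<Rightarrow> ('x magma \<Rightarrow> 'k) set"
  interpret N: nonassoc_algebra ?N by (rule free_nonassoc_algebra)
  have zero: "?p f = \<zero>\<^bsub>?F\<^esub>" if "f \<in> lie_relators ?N" for f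
  proof -
    have "f \<in> free_lie_ideal S"
      unfolding free_lie_ideal_def by (rule subsetD[OF gen_ideal_superset that])
    then show ?thesis
      using free_lie_proj_zero_iff[of f S] subsetD[OF lie_relators_subset[OF free_nonassoc_algebra] that] by simp
  qed
  have bij: "\<exists>f\<in>carrier ?N. x = ?p f" if "x \<in> carrier ?F" for x
    using that free_lie_proj_surj by blast
  note h = lie_homD(2-4)[OF free_lie_proj_hom, symmetric]
  show ?thesis
  proof (intro lie_algebra.intro free_lie_nonassoc lie_algebra_axioms.intro)
    fix x y z
    assume "x \<in> carrier ?F"
    then obtain f where f: "f \<in> carrier ?N" "x = ?p f" using bij by blast
    have "f \<otimes>\<^bsub>?N\<^esub> f \<in> lie_relators ?N" using f by (auto simp: lie_relators_def)
    then show "x \<otimes>\<^bsub>?F\<^esub> x = \<zero>\<^bsub>?F\<^esub>" using zero f by (simp add: h)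
    assume "y \<in> carrier ?F" "z \<in> carrier ?F"
    then obtain g k where g: "g \<in> carrier ?N" "y = ?p g" and k: "k \<in> carrier ?N" "z = ?p k"
      using bij by blast
    have "f \<otimes>\<^bsub>?N\<^esub> (g \<otimes>\<^bsub>?N\<^esub> k) \<oplus>\<^bsub>?N\<^esub> g \<otimes>\<^bsub>?N\<^esub> (k \<otimes>\<^bsub>?N\<^esub> f) \<oplus>\<^bsub>?N\<^esub> k \<otimes>\<^bsub>?N\<^esub> (f \<otimes>\<^bsub>?N\<^esub> g)
        \<in> lie_relators ?N" using f g k by (auto simp: lie_relators_def)
    from zero[OF this]
    show "x \<otimes>\<^bsub>?F\<^esub> (y \<otimes>\<^bsub>?F\<^esub> z) \<oplus>\<^bsub>?F\<^esub> y \<otimes>\<^bsub>?F\<^esub> (z \<otimes>\<^bsub>?F\<^esub> x) \<oplus>\<^bsub>?F\<^esub> z \<otimes>\<^bsub>?F\<^esub> (x \<otimes>\<^bsub>?F\<^esub> y) = \<zero>\<^bsub>?F\<^esub>"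
      using f g k by (simp add: h)
  qed
qed

lemma lie_nonassoc: "lie_algebra L \<Longrightarrow> nonassoc_algebra L"
  by (rule lie_algebra.axioms)

lemma generates_free_lie: "generates (free_lie S) (free_lie_gen S ` S)"
  using algebra_with_ideal.generates_quot[OF free_lie_with_ideal generates_free_nonassoc]
  by (simp add: free_lie_def free_lie_gen_def[abs_def] image_image)

lemma free_lie_gen_closed: "x \<in> S \<Longrightarrow> free_lie_gen S x \<in> carrier (free_lie S)"
  by (rule subsetD[OF generates_subset[OF generates_free_lie] imageI])

lemma free_lie_universal:
  fixes S :: "'x set" and L :: "('k::field, 'a) module"
  assumes "lie_algebra L" "\<phi> \<in> S \<rightarrow> carrier L"
  obtains h where "h \<in> lie_hom (free_lie S) L" "\<And>x. x \<in> S \<Longrightarrow> h (free_lie_gen S x) = \<phi> x"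
proof -
  interpret L: lie_algebra L by fact
  interpret N: nonassoc_algebra "free_nonassoc S :: ('k, _) module" by (rule free_nonassoc_algebra)
  obtain g where g: "g \<in> lie_hom (free_nonassoc S) L" "\<And>x. x \<in> S \<Longrightarrow> g (monomial (Gen x)) = \<phi> x"
    using free_nonassoc_universal[OF L.nonassoc_algebra_axioms assms(2)] by blast
  note [simp] = lie_homD[OF g(1)]
  have "g f = \<zero>\<^bsub>L\<^esub>" if "f \<in> free_lie_ideal S" for f
    using free_nonassoc_algebra L.nonassoc_algebra_axioms g(1)
      lie_relators_subset[OF free_nonassoc_algebra] _ that[unfolded free_lie_ideal_def]
    by (rule gen_ideal_kills) (auto simp: lie_relators_def L.bracket_self L.jacobi)
  then obtain h where "h \<in> lie_hom (free_lie S) L"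
    "\<And>f. f \<in> carrier (free_nonassoc S) \<Longrightarrow> h (free_lie_proj S f) = g f"
    using algebra_with_ideal.quot_universal[OF free_lie_with_ideal L.nonassoc_algebra_axioms g(1)] unfolding free_lie_def by blast
  moreover have "(monomial (Gen x) :: _ \<Rightarrow> 'k) \<in> carrier (free_nonassoc S)" if "x \<in> S" for x
    by (rule subsetD[OF generates_subset[OF generates_free_nonassoc] imageI]) (rule that)
  ultimately show ?thesis using g(2) by (intro that[of h]) (auto simp: free_lie_gen_def)
qed

section \<open>Free Lie bases\<close>

definition free_on :: "('k::field, 'a) module \<Rightarrow> 'a set \<Rightarrow> bool"
  where "free_on L S \<longleftrightarrow> lie_algebra L \<and> S \<subseteq> carrier L \<and>
    (\<exists>\<phi> \<in> lie_iso (free_lie S) L. \<forall>x\<in>S. \<phi> (free_lie_gen S x) = x)"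

lemma is_free_lie_algebra_iff: "is_free_lie_algebra L \<longleftrightarrow> (\<exists>S. free_on L S)"
  unfolding is_free_lie_algebra_def free_on_def by metis

lemma lie_iso_inverse:
  assumes "nonassoc_algebra A" "h \<in> lie_iso A B"
  shows "the_inv_into (carrier A) h \<in> lie_hom B A"
    "\<And>x. x \<in> carrier A \<Longrightarrow> the_inv_into (carrier A) h (h x) = x"
proof -
  interpret A: nonassoc_algebra A by fact
  have h: "h \<in> lie_hom A B" "inj_on h (carrier A)" "h ` carrier A = carrier B"
    using assms(2) by (auto simp: lie_iso_def bij_betw_def)
  show *: "\<And>x. x \<in> carrier A \<Longrightarrow> the_inv_into (carrier A) h (h x) = x"
    using the_inv_into_f_f[OF h(2)] .
  show "the_inv_into (carrier A) h \<in> lie_hom B A"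
    by (rule lie_homI, unfold h(3)[symmetric]) (auto simp: * lie_homD(2-4)[OF h(1), symmetric])
qed

lemma free_on_generates:
  assumes "free_on L S"
  shows "generates L S"
proof -
  interpret L: lie_algebra L using assms by (simp add: free_on_def)
  obtain h where h: "h \<in> lie_hom (free_lie S) L" "h ` carrier (free_lie S) = carrier L"
    "\<And>x. x \<in> S \<Longrightarrow> h (free_lie_gen S x) = x"
    using assms by (auto simp: free_on_def lie_iso_def bij_betw_def)
  show ?thesis unfolding generates_def
  proof (intro conjI allI impI)
    fix H assume H: "subalg H L" "S \<subseteq> H"
    have "subalg {x \<in> carrier (free_lie S). h x \<in> H} (free_lie S)"
      by (rule subalg_vimage[OF free_lie_nonassoc L.nonassoc_algebra_axioms h(1) H(1)])
    moreover have "free_lie_gen S ` S \<subseteq> {x \<in> carrier (free_lie S). h x \<in> H}"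
      using H(2) h(3) by (auto simp: free_lie_gen_closed)
    ultimately have "carrier (free_lie S) \<subseteq> {x \<in> carrier (free_lie S). h x \<in> H}"
      by (rule generatesD[OF generates_free_lie])
    then show "carrier L \<subseteq> H" unfolding h(2)[symmetric] by auto
  qed (use assms in \<open>simp add: free_on_def\<close>)
qed

lemma free_on_universal:
  assumes "free_on L S" "lie_algebra M" "\<phi> \<in> S \<rightarrow> carrier M"
  obtains h where "h \<in> lie_hom L M" "\<And>x. x \<in> S \<Longrightarrow> h x = \<phi> x"
proof -
  obtain h where h: "h \<in> lie_iso (free_lie S) L" "\<And>x. x \<in> S \<Longrightarrow> h (free_lie_gen S x) = x"
    using assms by (auto simp: free_on_def)
  obtain g where g: "g \<in> lie_hom (free_lie S) M" "\<And>x. x \<in> S \<Longrightarrow> g (free_lie_gen S x) = \<phi> x"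
    using free_lie_universal[OF assms(2,3)] by blast
  note i = lie_iso_inverse[OF free_lie_nonassoc h(1)]
  show ?thesis
  proof (rule that)
    show "g \<circ> the_inv_into (carrier (free_lie S)) h \<in> lie_hom L M"
      by (rule lie_hom_comp[OF i(1) g(1)])
    show "(g \<circ> the_inv_into (carrier (free_lie S)) h) x = \<phi> x" if "x \<in> S" for x
      using i(2)[OF free_lie_gen_closed[OF that]] h(2)[OF that] g(2)[OF that] by simp
  qed
qed

text \<open>
  The map from the free Lie algebra on \<open>b ` J\<close> to \<open>L\<close> is onto because \<open>b ` J\<close>
  generates, and \<open>\<psi>\<close> followed by the map of free Lie algebras induced by \<open>b\<close> is an inverse
  of it, because both composites fix generators. The index set is kept apart from \<open>L\<close> because
  elimination produces generators that are naturally labelled by pairs.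
\<close>

lemma free_onI:
  fixes L :: "('k::field, 'a) module"
  assumes "lie_algebra L" "b \<in> J \<rightarrow> carrier L" "generates L (b ` J)"
    and "\<psi> \<in> lie_hom L (free_lie J)" "\<And>x. x \<in> J \<Longrightarrow> \<psi> (b x) = free_lie_gen J x"
  shows "free_on L (b ` J)"
proof -
  interpret L: lie_algebra L by fact
  note L = L.nonassoc_algebra_axioms
  let ?S = "b ` J"
  have S: "?S \<subseteq> carrier L" using assms(2) by auto
  obtain h where h: "h \<in> lie_hom (free_lie ?S) L" "\<And>x. x \<in> ?S \<Longrightarrow> h (free_lie_gen ?S x) = x"
    using free_lie_universal[OF assms(1), of "\<lambda>x. x" ?S] S by auto
  obtain g where g: "g \<in> lie_hom (free_lie J :: ('k, _) module) (free_lie ?S)"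
      "\<And>x. x \<in> J \<Longrightarrow> g (free_lie_gen J x) = free_lie_gen ?S (b x)"
    using free_lie_universal[OF free_lie_algebra[of ?S], of "\<lambda>x. free_lie_gen ?S (b x)" J]
    by (auto simp: free_lie_gen_closed)
  define k where "k = g \<circ> \<psi>"
  have k: "k \<in> lie_hom L (free_lie ?S)" "\<And>x. x \<in> ?S \<Longrightarrow> k x = free_lie_gen ?S x"
    unfolding k_def using lie_hom_comp[OF assms(4) g(1)] assms(5) g(2) by auto
  have kh: "k (h x) = x" if "x \<in> carrier (free_lie ?S)" for x
  proof -
    have "(k \<circ> h) x = (\<lambda>x. x) x"
      using free_lie_nonassoc free_lie_nonassoc lie_hom_comp[OF h(1) k(1)] _ generates_free_lie _ that
      by (rule lie_hom_eqI) (auto simp: h k lie_hom_def)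
    then show ?thesis by simp
  qed
  have hk: "h (k x) = x" if "x \<in> carrier L" for x
  proof -
    have "(h \<circ> k) x = (\<lambda>x. x) x"
      using L L lie_hom_comp[OF k(1) h(1)] _ assms(3) _ that
      by (rule lie_hom_eqI) (auto simp: h k lie_hom_def)
    then show ?thesis by simp
  qed
  have "bij_betw h (carrier (free_lie ?S)) (carrier L)"
    by (rule bij_betw_byWitness[of _ k]) (use kh hk lie_homD(1)[OF h(1)] lie_homD(1)[OF k(1)] in auto)
  then show ?thesis using assms(1) S h unfolding free_on_def lie_iso_def by blast
qed


section \<open>The free associative algebra\<close>

lemma carrier_free_assoc: "carrier (free_assoc S) = finsupp (lists S)"
  by (auto simp: free_assoc_def finsupp_def)

lemma free_assoc_simps:
  "f \<otimes>\<^bsub>free_assoc S\<^esub> g = (\<lambda>w. \<Sum>i\<le>length w. f (take i w) * g (drop i w))"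
  "f \<oplus>\<^bsub>free_assoc S\<^esub> g = (\<lambda>w. f w + g w)"
  "c \<odot>\<^bsub>free_assoc S\<^esub> f = (\<lambda>w. c * f w)"
  "\<zero>\<^bsub>free_assoc S\<^esub> = (\<lambda>w. 0)"
  "\<one>\<^bsub>free_assoc S\<^esub> = monomial []"
  by (simp_all add: free_assoc_def)

lemma free_assoc_mult_closed:
  assumes "f \<in> carrier (free_assoc S)" "g \<in> carrier (free_assoc S)"
  shows "f \<otimes>\<^bsub>free_assoc S\<^esub> g \<in> carrier (free_assoc S)"
proof -
  let ?L = "{w. (\<Sum>i\<le>length w. f (take i w) * g (drop i w)) \<noteq> 0}"
  let ?R = "(\<lambda>(u, v). u @ v) ` ({w. f w \<noteq> 0} \<times> {w. g w \<noteq> 0})"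
  have sub: "?L \<subseteq> ?R"
  proof
    fix w assume "w \<in> ?L"
    then obtain i where "f (take i w) * g (drop i w) \<noteq> 0" by (auto elim: sum.not_neutral_contains_not_neutral)
    then show "w \<in> ?R" by (intro image_eqI[of _ _ "(take i w, drop i w)"]) auto
  qed
  moreover have "finite ?R" using assms by (auto simp: carrier_free_assoc finsupp_def)
  moreover have "?R \<subseteq> lists S"
    using assms unfolding carrier_free_assoc finsupp_def by (auto dest!: subsetD)
  ultimately show ?thesis
    by (auto simp: carrier_free_assoc finsupp_def free_assoc_simps intro: finite_subset)
qed

lemma monomial_in_free_assoc: "x \<in> S \<Longrightarrow> monomial [x] \<in> carrier (free_assoc S)"
  unfolding carrier_free_assoc by (rule finsupp_monomial) simp

lemma monomial_append: "(monomial (u @ v) :: _ \<Rightarrow> 'k::field) = monomial u \<otimes>\<^bsub>free_assoc S\<^esub> monomial v"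
proof
  fix w
  have "(\<Sum>i\<le>length w. (monomial u (take i w) :: 'k) * monomial v (drop i w))
      = (\<Sum>i\<le>length w. if i = length u then monomial (u @ v) w else 0)"
  proof (rule sum.cong)
    fix i assume "i \<in> {..length w}"
    then have iff: "take i w = u \<and> drop i w = v \<longleftrightarrow> i = length u \<and> w = u @ v"
      by (metis append_eq_conv_conj append_take_drop_id atMost_iff length_take min_absorb2)
    have "(monomial u (take i w) :: 'k) * monomial v (drop i w) = (if take i w = u \<and> drop i w = v then 1 else 0)"
      by (simp add: monomial_def)
    also have "\<dots> = (if i = length u then monomial (u @ v) w else 0)"
      unfolding iff by (simp add: monomial_def)
    finally show "(monomial u (take i w) :: 'k) * monomial v (drop i w)
        = (if i = length u then monomial (u @ v) w else 0)" .
  qed simp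
  also have "\<dots> = monomial (u @ v) w"
    by (simp add: monomial_def sum.delta)
  finally show "(monomial (u @ v) w :: 'k) = (monomial u \<otimes>\<^bsub>free_assoc S\<^esub> monomial v) w"
    by (simp add: free_assoc_simps)
qed

text \<open>
  Both sides are sums over the ways of cutting a word into three pieces, at positions \<open>j \<le> i\<close> on
  the left and at \<open>j\<close> and \<open>j + k\<close> on the right.
\<close>

lemma free_assoc_mult_assoc:
  "f \<otimes>\<^bsub>free_assoc S\<^esub> g \<otimes>\<^bsub>free_assoc S\<^esub> h = f \<otimes>\<^bsub>free_assoc S\<^esub> (g \<otimes>\<^bsub>free_assoc S\<^esub> h)"
proof
  fix w
  have "(f \<otimes>\<^bsub>free_assoc S\<^esub> g \<otimes>\<^bsub>free_assoc S\<^esub> h) w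
      = (\<Sum>(i, j)\<in>Sigma {..length w} (\<lambda>i. {..i}). f (take j w) * g (drop j (take i w)) * h (drop i w))"
    by (simp add: free_assoc_simps sum_distrib_right sum.Sigma min_absorb2)
  also have "\<dots> = (\<Sum>(j, k)\<in>Sigma {..length w} (\<lambda>j. {..length w - j}).
      f (take j w) * g (take k (drop j w)) * h (drop k (drop j w)))"
    by (rule sum.reindex_bij_witness[where i = "\<lambda>(j, k). (j + k, j)" and j = "\<lambda>(i, j). (j, i - j)"])
       (auto simp: drop_take)
  also have "\<dots> = (f \<otimes>\<^bsub>free_assoc S\<^esub> (g \<otimes>\<^bsub>free_assoc S\<^esub> h)) w"
    by (simp add: free_assoc_simps sum_distrib_left sum.Sigma mult.assoc)
  finally show "(f \<otimes>\<^bsub>free_assoc S\<^esub> g \<otimes>\<^bsub>free_assoc S\<^esub> h) w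
      = (f \<otimes>\<^bsub>free_assoc S\<^esub> (g \<otimes>\<^bsub>free_assoc S\<^esub> h)) w" .
qed

lemma free_assoc_one_left: "monomial [] \<otimes>\<^bsub>free_assoc S\<^esub> f = f"
proof
  fix w
  have "(\<Sum>i\<le>length w. monomial [] (take i w) * f (drop i w)) = (\<Sum>i\<le>length w. if i = 0 then f w else 0)"
    by (rule sum.cong) (auto simp: monomial_def)
  then show "(monomial [] \<otimes>\<^bsub>free_assoc S\<^esub> f) w = f w" by (simp add: free_assoc_simps)
qed

lemma free_assoc_one_right: "f \<otimes>\<^bsub>free_assoc S\<^esub> monomial [] = f"
proof
  fix w
  have "(\<Sum>i\<le>length w. f (take i w) * monomial [] (drop i w))
      = (\<Sum>i\<le>length w. if i = length w then f w else 0)"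
    by (rule sum.cong) (auto simp: monomial_def)
  then show "(f \<otimes>\<^bsub>free_assoc S\<^esub> monomial []) w = f w" by (simp add: free_assoc_simps)
qed

lemma free_assoc_nonassoc: "nonassoc_algebra (free_assoc S :: ('k::field, 'x list \<Rightarrow> 'k) module)"
proof (rule nonassoc_algebraI, rule abelian_groupI, goal_cases)
  case (6 f)
  then show ?case
    by (intro bexI[of _ "\<lambda>w. - 1 * f w"]) (simp_all only: carrier_free_assoc free_assoc_simps finsupp_scale, simp)
qed (auto simp: carrier_free_assoc[symmetric] free_assoc_mult_closed,
    auto simp: carrier_free_assoc free_assoc_simps finsupp_add finsupp_scale finsupp_zero
      algebra_simps fun_eq_iff sum.distrib sum_distrib_left)

lemma assoc_algebraI:
  assumes "nonassoc_algebra A" "\<one>\<^bsub>A\<^esub> \<in> carrier A"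
    and "\<And>x y z. x \<in> carrier A \<Longrightarrow> y \<in> carrier A \<Longrightarrow> z \<in> carrier A
      \<Longrightarrow> x \<otimes>\<^bsub>A\<^esub> y \<otimes>\<^bsub>A\<^esub> z = x \<otimes>\<^bsub>A\<^esub> (y \<otimes>\<^bsub>A\<^esub> z)"
    and "\<And>x. x \<in> carrier A \<Longrightarrow> \<one>\<^bsub>A\<^esub> \<otimes>\<^bsub>A\<^esub> x = x" "\<And>x. x \<in> carrier A \<Longrightarrow> x \<otimes>\<^bsub>A\<^esub> \<one>\<^bsub>A\<^esub> = x"
  shows "assoc_algebra A"
proof -
  interpret nonassoc_algebra A by fact
  show ?thesis
    by unfold_locales (simp_all add: assms mult_add_left mult_add_right)
qed

lemma free_assoc_algebra: "assoc_algebra (free_assoc S)"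
  by (rule assoc_algebraI[OF free_assoc_nonassoc])
     (auto simp: free_assoc_mult_assoc free_assoc_one_left free_assoc_one_right free_assoc_simps(5)
        carrier_free_assoc intro!: finsupp_monomial)

lemma assoc_nonassoc: "assoc_algebra A \<Longrightarrow> nonassoc_algebra A"
  by (rule assoc_algebra.axioms)

definition unital_hom :: "('k::field, 'a) module \<Rightarrow> ('k, 'b) module \<Rightarrow> ('a \<Rightarrow> 'b) set"
  where "unital_hom A B = {h \<in> lie_hom A B. h \<one>\<^bsub>A\<^esub> = \<one>\<^bsub>B\<^esub>}"

definition generates_unital :: "('k::field, 'a) module \<Rightarrow> 'a set \<Rightarrow> bool"
  where "generates_unital A S \<longleftrightarrow> S \<subseteq> carrier A \<and>
    (\<forall>H. subalg H A \<longrightarrow> \<one>\<^bsub>A\<^esub> \<in> H \<longrightarrow> S \<subseteq> H \<longrightarrow> carrier A \<subseteq> H)"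

lemma generates_unitalD:
  "generates_unital A S \<Longrightarrow> subalg H A \<Longrightarrow> \<one>\<^bsub>A\<^esub> \<in> H \<Longrightarrow> S \<subseteq> H \<Longrightarrow> carrier A \<subseteq> H"
  by (simp add: generates_unital_def)

lemma unital_hom_comp: "g \<in> unital_hom A B \<Longrightarrow> h \<in> unital_hom B C \<Longrightarrow> h \<circ> g \<in> unital_hom A C"
  by (auto simp: unital_hom_def intro: lie_hom_comp)

lemma unital_hom_eqI:
  assumes "assoc_algebra A" "assoc_algebra B" "g \<in> unital_hom A B" "h \<in> unital_hom A B"
    and "generates_unital A S" "\<And>x. x \<in> S \<Longrightarrow> g x = h x" "x \<in> carrier A"
  shows "g x = h x"
proof -
  interpret A: assoc_algebra A by fact
  have "subalg {x \<in> carrier A. g x = h x} A"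
    using assms(1-4) by (intro subalg_equalizer assoc_nonassoc) (auto simp: unital_hom_def)
  moreover have "\<one>\<^bsub>A\<^esub> \<in> {x \<in> carrier A. g x = h x}"
    using assms(3,4) by (auto simp: unital_hom_def)
  moreover have "S \<subseteq> {x \<in> carrier A. g x = h x}"
    using assms(5,6) by (auto simp: generates_unital_def)
  ultimately show ?thesis using assms(5,7) unfolding generates_unital_def by blast
qed

lemma free_assoc_universal:
  fixes A :: "('k::field, 'a) module" and \<phi> :: "'x \<Rightarrow> 'a"
  assumes "assoc_algebra A" "\<phi> \<in> S \<rightarrow> carrier A"
  obtains h where "h \<in> unital_hom (free_assoc S) A" "\<And>x. x \<in> S \<Longrightarrow> h (monomial [x]) = \<phi> x"
proof (rule that)
  interpret A: assoc_algebra A by fact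
  let ?e = "\<lambda>w. foldr (\<lambda>x a. \<phi> x \<otimes>\<^bsub>A\<^esub> a) w \<one>\<^bsub>A\<^esub>"
  have closed: "?e w \<in> carrier A" if "w \<in> lists S" for w
    using that assms(2) by (induction w) auto
  then have e: "?e \<in> lists S \<rightarrow> carrier A" by blast
  have append: "?e (u @ v) = ?e u \<otimes>\<^bsub>A\<^esub> ?e v" if "u \<in> lists S" "v \<in> lists S" for u v
    using that(1)
  proof (induction u)
    case (Cons x u)
    then show ?case using assms(2) closed[OF Cons(2)] closed[OF that(2)]
      by (simp add: A.m_assoc Pi_iff)
  qed (use closed[OF that(2)] in simp)
  have "linear_extension A ?e \<in> lie_hom (free_assoc S) A"
  proof (rule linear_extension_hom[OF free_assoc_nonassoc A.nonassoc_algebra_axioms carrier_free_assoc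
      free_assoc_simps(2-4) e])
    show "linear_extension A ?e (monomial u \<otimes>\<^bsub>free_assoc S\<^esub> monomial v) = ?e u \<otimes>\<^bsub>A\<^esub> ?e v"
      if "u \<in> lists S" "v \<in> lists S" for u v
      using that A.linear_extension_monomial[OF e, of "u @ v"] append[OF that]
      by (simp only: monomial_append[symmetric] append_in_lists_conv)
  qed
  moreover have "linear_extension A ?e \<one>\<^bsub>free_assoc S\<^esub> = \<one>\<^bsub>A\<^esub>"
    using A.linear_extension_monomial[OF e, of "[]"] by (simp add: free_assoc_simps(5))
  ultimately show "linear_extension A ?e \<in> unital_hom (free_assoc S) A"
    by (simp add: unital_hom_def)
  show "linear_extension A ?e (monomial [x]) = \<phi> x" if "x \<in> S" for x
  proof -
    have "\<phi> x \<in> carrier A" using that assms(2) by auto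
    then show ?thesis using A.linear_extension_monomial[OF e, of "[x]"] that by simp
  qed
qed

lemma generates_free_assoc:
  "generates_unital (free_assoc S :: ('k::field, 'x list \<Rightarrow> 'k) module) ((\<lambda>x. monomial [x]) ` S)"
  unfolding generates_unital_def
proof (intro conjI allI impI subsetI)
  let ?F = "free_assoc S :: ('k, 'x list \<Rightarrow> 'k) module"
  fix f :: "'x list \<Rightarrow> 'k" assume "f \<in> (\<lambda>x. monomial [x]) ` S"
  then show "f \<in> carrier ?F" by (auto simp: carrier_free_assoc intro!: finsupp_monomial)
next
  let ?F = "free_assoc S :: ('k, 'x list \<Rightarrow> 'k) module"
  fix H and f :: "'x list \<Rightarrow> 'k"
  assume H: "subalg H ?F" "\<one>\<^bsub>?F\<^esub> \<in> H" "(\<lambda>x. monomial [x]) ` S \<subseteq> H" and f: "f \<in> carrier ?F"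
  have monom: "w \<in> lists S \<Longrightarrow> monomial w \<in> H" for w
  proof (induction w)
    case (Cons x w)
    then have "monomial [x] \<in> H" "monomial w \<in> H" using H(3) by auto
    then have "monomial [x] \<otimes>\<^bsub>?F\<^esub> monomial w \<in> H" using H(1) unfolding subalg_def by blast
    then show ?case by (simp add: monomial_append[symmetric])
  qed (use H(2) in \<open>simp add: free_assoc_simps\<close>)
  show "f \<in> H"
    using f unfolding carrier_free_assoc
    by (induction f rule: finsupp_induct)
       (use H(1) monom in \<open>auto simp: subalg_def free_assoc_simps(2-4)\<close>)
qed

text \<open>
  The associative counterpart of \<open>free_onI\<close>, with the same proof.
\<close>

lemma is_free_assoc_algebraI:
  fixes A :: "('k::field, 'a) module"
  assumes "assoc_algebra A" "b \<in> J \<rightarrow> carrier A" "generates_unital A (b ` J)"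
    and "\<psi> \<in> unital_hom A (free_assoc J)" "\<And>x. x \<in> J \<Longrightarrow> \<psi> (b x) = monomial [x]"
  shows "is_free_assoc_algebra A"
proof -
  let ?S = "b ` J"
  have S: "?S \<subseteq> carrier A" using assms(2) by auto
  obtain h where h: "h \<in> unital_hom (free_assoc ?S) A" "\<And>x. x \<in> ?S \<Longrightarrow> h (monomial [x]) = x"
    using free_assoc_universal[OF assms(1), of "\<lambda>x. x" ?S] S by auto
  have gen: "monomial [x] \<in> carrier (free_assoc T)" if "x \<in> T" for x T
    by (rule monomial_in_free_assoc) (rule that)
  obtain g where g: "g \<in> unital_hom (free_assoc J :: ('k, _) module) (free_assoc ?S)"
      "\<And>x. x \<in> J \<Longrightarrow> g (monomial [x]) = monomial [b x]"
    using free_assoc_universal[OF free_assoc_algebra[of ?S], of "\<lambda>x. monomial [b x]" J]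
    by (auto simp: gen)
  define k where "k = g \<circ> \<psi>"
  have k: "k \<in> unital_hom A (free_assoc ?S)" "\<And>x. x \<in> ?S \<Longrightarrow> k x = monomial [x]"
    unfolding k_def using unital_hom_comp[OF assms(4) g(1)] assms(5) g(2) by auto
  have kh: "k (h x) = x" if "x \<in> carrier (free_assoc ?S)" for x
  proof -
    have "(k \<circ> h) x = (\<lambda>x. x) x"
      using free_assoc_algebra free_assoc_algebra unital_hom_comp[OF h(1) k(1)] _ generates_free_assoc _ that
      by (rule unital_hom_eqI) (auto simp: h k lie_hom_def unital_hom_def)
    then show ?thesis by simp
  qed
  have hk: "h (k x) = x" if "x \<in> carrier A" for x
  proof -
    have "(h \<circ> k) x = (\<lambda>x. x) x"
      using assms(1) assms(1) unital_hom_comp[OF k(1) h(1)] _ assms(3) _ that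
      by (rule unital_hom_eqI) (auto simp: h k lie_hom_def unital_hom_def)
    then show ?thesis by simp
  qed
  have hl: "h \<in> lie_hom (free_assoc ?S) A" "k \<in> lie_hom A (free_assoc ?S)"
    using h k by (auto simp: unital_hom_def)
  have "bij_betw h (carrier (free_assoc ?S)) (carrier A)"
    by (rule bij_betw_byWitness[of _ k]) (use kh hk lie_homD(1)[OF hl(1)] lie_homD(1)[OF hl(2)] in auto)
  then have "h \<in> assoc_iso (free_assoc ?S) A"
    using h by (auto simp: assoc_iso_def ring_iso_def ring_hom_def unital_hom_def lie_homD)
  then show ?thesis using assms(1) S h(2) unfolding is_free_assoc_algebra_def by blast
qed

section \<open>Universal enveloping algebras\<close>

text \<open>
  Homomorphisms of Lie algebras from \<open>L\<close> to this algebra correspond to unital homomorphisms of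
  associative algebras from \<^term>\<open>uea L\<close> to \<open>A\<close>.
\<close>

definition commutator_algebra :: "('k::field, 'a) module \<Rightarrow> ('k, 'a) module"
  where "commutator_algebra A = A\<lparr>monoid.mult := \<lambda>x y. x \<otimes>\<^bsub>A\<^esub> y \<ominus>\<^bsub>A\<^esub> y \<otimes>\<^bsub>A\<^esub> x\<rparr>"

lemma commutator_algebra_simps [simp]:
  "carrier (commutator_algebra A) = carrier A"
  "x \<otimes>\<^bsub>commutator_algebra A\<^esub> y = x \<otimes>\<^bsub>A\<^esub> y \<ominus>\<^bsub>A\<^esub> y \<otimes>\<^bsub>A\<^esub> x"
  "x \<oplus>\<^bsub>commutator_algebra A\<^esub> y = x \<oplus>\<^bsub>A\<^esub> y"
  "c \<odot>\<^bsub>commutator_algebra A\<^esub> x = c \<odot>\<^bsub>A\<^esub> x"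
  "\<zero>\<^bsub>commutator_algebra A\<^esub> = \<zero>\<^bsub>A\<^esub>"
  by (simp_all add: commutator_algebra_def)

lemma commutator_algebra_lie:
  assumes "assoc_algebra A"
  shows "lie_algebra (commutator_algebra A)"
proof -
  interpret A: assoc_algebra A by fact
  have ab: "abelian_group (commutator_algebra A)"
  proof (rule abelian_groupI)
    fix x assume "x \<in> carrier (commutator_algebra A)"
    then show "\<exists>y\<in>carrier (commutator_algebra A). y \<oplus>\<^bsub>commutator_algebra A\<^esub> x = \<zero>\<^bsub>commutator_algebra A\<^esub>"
      by (auto intro!: bexI[of _ "\<ominus>\<^bsub>A\<^esub> x"] simp: A.l_neg)
  qed (auto simp: A.a_assoc A.a_comm A.a_lcomm)
  have diff: "c \<odot>\<^bsub>A\<^esub> (x \<ominus>\<^bsub>A\<^esub> y) = c \<odot>\<^bsub>A\<^esub> x \<ominus>\<^bsub>A\<^esub> c \<odot>\<^bsub>A\<^esub> y" if "x \<in> carrier A" "y \<in> carrier A" for c x y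
    using that A.smult_r_minus by (simp add: a_minus_def A.scale_add)
  have "nonassoc_algebra (commutator_algebra A)"
  proof (rule nonassoc_algebraI[OF ab], goal_cases)
    case (7 x y z) then show ?case by simp algebra
  next
    case (8 x y z) then show ?case by simp algebra
  qed (auto simp: A.add_scale A.scale_add A.scale_scale A.mult_smult_left A.mult_smult_right diff)
  then show ?thesis
  proof (intro lie_algebra.intro lie_algebra_axioms.intro, goal_cases)
    case (2 x) then show ?case by simp
  next
    case (3 x y z) then show ?case by simp algebra
  qed
qed

lemma (in algebra_with_ideal) assoc_quot:
  assumes "assoc_algebra A"
  shows "assoc_algebra (alg_quot A I)"
proof -
  interpret A: assoc_algebra A by fact
  note p = lie_homD(2-4)[OF proj_hom, symmetric]
  have one: "\<one>\<^bsub>alg_quot A I\<^esub> = proj \<one>\<^bsub>A\<^esub>" by (simp add: alg_quot_def)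
  show ?thesis
    by (rule assoc_algebraI[OF nonassoc_quot], unfold proj_carrier[symmetric])
       (auto simp: one p A.m_assoc)
qed

lemma uea_relators_subset:
  fixes L :: "('k::field, 'a) module"
  assumes "nonassoc_algebra L" 
  shows "uea_relators L \<subseteq> carrier (free_assoc (carrier L))"
proof -
  interpret L: nonassoc_algebra L by fact
  interpret T: assoc_algebra "free_assoc (carrier L) :: ('k, _) module" by (rule free_assoc_algebra)
  have "(monomial [x] :: _ \<Rightarrow> 'k) \<in> carrier (free_assoc (carrier L))" if "x \<in> carrier L" for x
    by (rule monomial_in_free_assoc) (rule that)
  then show ?thesis unfolding uea_relators_def Let_def by auto
qed

lemma uea_with_ideal:
  assumes "nonassoc_algebra L" 
  shows "algebra_with_ideal (free_assoc (carrier L)) (gen_ideal (free_assoc (carrier L)) (uea_relators L))"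
  by (intro algebra_with_ideal.intro algebra_with_ideal_axioms.intro free_assoc_nonassoc
      alg_ideal_gen_ideal uea_relators_subset assms)

lemma uea_assoc_algebra: "nonassoc_algebra L \<Longrightarrow> assoc_algebra (uea L)"
  unfolding uea_def by (rule algebra_with_ideal.assoc_quot[OF uea_with_ideal free_assoc_algebra])

definition uea_proj :: "('k::field, 'a) module \<Rightarrow> ('a list \<Rightarrow> 'k) \<Rightarrow> ('a list \<Rightarrow> 'k) set"
  where "uea_proj L f = gen_ideal (free_assoc (carrier L)) (uea_relators L) +>\<^bsub>free_assoc (carrier L)\<^esub> f"

lemma uea_proj_hom: "nonassoc_algebra L \<Longrightarrow> uea_proj L \<in> unital_hom (free_assoc (carrier L)) (uea L)"
  using algebra_with_ideal.proj_hom[OF uea_with_ideal, of L]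
  by (simp add: unital_hom_def uea_def alg_quot_def uea_proj_def[abs_def])

lemma uea_proj_surj: "nonassoc_algebra L \<Longrightarrow> uea_proj L ` carrier (free_assoc (carrier L)) = carrier (uea L)"
  using algebra_with_ideal.proj_carrier[OF uea_with_ideal, of L]
  by (simp add: uea_def uea_proj_def[abs_def])

lemma uea_proj_relator:
  assumes "nonassoc_algebra L" "r \<in> uea_relators L"
  shows "uea_proj L r = \<zero>\<^bsub>uea L\<^esub>"
proof -
  have "r \<in> gen_ideal (free_assoc (carrier L)) (uea_relators L)"
    by (rule subsetD[OF gen_ideal_superset assms(2)])
  moreover have "r \<in> carrier (free_assoc (carrier L))"
    by (rule subsetD[OF uea_relators_subset assms(2)]) (rule assms)
  ultimately show ?thesis
    using algebra_with_ideal.proj_zero_iff[OF uea_with_ideal[OF assms(1)]] by (simp add: uea_proj_def uea_def)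
qed

abbreviation uea_incl :: "('k::field, 'a) module \<Rightarrow> 'a \<Rightarrow> ('a list \<Rightarrow> 'k) set"
  where "uea_incl L x \<equiv> uea_proj L (monomial [x])"

lemma uea_incl_hom:
  fixes L :: "('k::field, 'a) module"
  assumes "nonassoc_algebra L"
  shows "uea_incl L \<in> lie_hom L (commutator_algebra (uea L))"
proof -
  let ?T = "free_assoc (carrier L) :: ('k, _) module"
  interpret L: nonassoc_algebra L by fact
  interpret U: assoc_algebra "uea L" by (rule uea_assoc_algebra[OF assms])
  interpret T: assoc_algebra ?T by (rule free_assoc_algebra)
  have m: "(monomial [x] :: _ \<Rightarrow> 'k) \<in> carrier ?T" if "x \<in> carrier L" for x
    by (rule monomial_in_free_assoc) (rule that)
  have hom: "uea_proj L \<in> lie_hom ?T (uea L)" using uea_proj_hom[OF assms] by (simp add: unital_hom_def)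
  note [simp] = m lie_homD[OF hom] lie_hom_minus[OF T.nonassoc_algebra_axioms U.nonassoc_algebra_axioms hom]
  show ?thesis
  proof (rule lie_homI)
    fix x y assume xy: "x \<in> carrier L" "y \<in> carrier L"
    have "monomial [x \<oplus>\<^bsub>L\<^esub> y] \<ominus>\<^bsub>?T\<^esub> (monomial [x] \<oplus>\<^bsub>?T\<^esub> monomial [y]) \<in> uea_relators L"
      using xy by (auto simp: uea_relators_def Let_def)
    from uea_proj_relator[OF assms this]
    show "uea_incl L (x \<oplus>\<^bsub>L\<^esub> y) = uea_incl L x \<oplus>\<^bsub>commutator_algebra (uea L)\<^esub> uea_incl L y"
      using xy by simp
    have "monomial [x] \<otimes>\<^bsub>?T\<^esub> monomial [y] \<ominus>\<^bsub>?T\<^esub> monomial [y] \<otimes>\<^bsub>?T\<^esub> monomial [x]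
        \<ominus>\<^bsub>?T\<^esub> monomial [x \<otimes>\<^bsub>L\<^esub> y] \<in> uea_relators L"
      using xy by (auto simp: uea_relators_def Let_def)
    from uea_proj_relator[OF assms this]
    show "uea_incl L (x \<otimes>\<^bsub>L\<^esub> y) = uea_incl L x \<otimes>\<^bsub>commutator_algebra (uea L)\<^esub> uea_incl L y"
      using xy by simp
  next
    fix c x assume x: "x \<in> carrier L"
    have "monomial [c \<odot>\<^bsub>L\<^esub> x] \<ominus>\<^bsub>?T\<^esub> c \<odot>\<^bsub>?T\<^esub> monomial [x] \<in> uea_relators L"
      using x by (auto simp: uea_relators_def Let_def)
    from uea_proj_relator[OF assms this]
    show "uea_incl L (c \<odot>\<^bsub>L\<^esub> x) = c \<odot>\<^bsub>commutator_algebra (uea L)\<^esub> uea_incl L x"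
      using x by simp
  qed simp
qed

lemma uea_universal:
  fixes L :: "('k::field, 'a) module"
  assumes "nonassoc_algebra L" "assoc_algebra B" "f \<in> lie_hom L (commutator_algebra B)"
  obtains h where "h \<in> unital_hom (uea L) B" "\<And>x. x \<in> carrier L \<Longrightarrow> h (uea_incl L x) = f x"
proof -
  let ?T = "free_assoc (carrier L) :: ('k, _) module"
  interpret L: nonassoc_algebra L by fact
  interpret B: assoc_algebra B by fact
  interpret T: assoc_algebra ?T by (rule free_assoc_algebra)
  have m: "(monomial [x] :: _ \<Rightarrow> 'k) \<in> carrier ?T" if "x \<in> carrier L" for x
    by (rule monomial_in_free_assoc) (rule that)
  note f = lie_homD[OF assms(3), simplified]
  obtain g where g: "g \<in> unital_hom ?T B" "\<And>x. x \<in> carrier L \<Longrightarrow> g (monomial [x]) = f x"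
    using free_assoc_universal[OF assms(2), of f "carrier L"] f(1) by auto
  have hom: "g \<in> lie_hom ?T B" using g(1) by (simp add: unital_hom_def)
  note [simp] = m f g(2) lie_homD[OF hom] lie_hom_minus[OF T.nonassoc_algebra_axioms B.nonassoc_algebra_axioms hom]
  have "g r = \<zero>\<^bsub>B\<^esub>" if "r \<in> gen_ideal ?T (uea_relators L)" for r
    using T.nonassoc_algebra_axioms B.nonassoc_algebra_axioms hom uea_relators_subset[OF assms(1)] _ that
    by (rule gen_ideal_kills) (auto simp: uea_relators_def Let_def)
  then obtain h where h: "h \<in> lie_hom (uea L) B" "\<And>t. t \<in> carrier ?T \<Longrightarrow> h (uea_proj L t) = g t"
    using algebra_with_ideal.quot_universal[OF uea_with_ideal[OF assms(1)] B.nonassoc_algebra_axioms hom]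
    unfolding uea_def uea_proj_def by blast
  have "uea_proj L \<one>\<^bsub>?T\<^esub> = \<one>\<^bsub>uea L\<^esub>" using uea_proj_hom[OF assms(1)] by (simp add: unital_hom_def)
  then have "h \<one>\<^bsub>uea L\<^esub> = \<one>\<^bsub>B\<^esub>" using h(2)[of "\<one>\<^bsub>?T\<^esub>"] g(1) by (simp add: unital_hom_def)
  then show ?thesis using h by (intro that[of h]) (auto simp: unital_hom_def)
qed

text \<open>
  A map from \<open>S\<close> to an associative algebra \<open>A\<close> extends to a Lie homomorphism
  from \<open>L\<close> to the commutator algebra of \<open>A\<close> and then to \<^term>\<open>uea L\<close>. For
  \<open>A = free_assoc S\<close> this gives the homomorphism required by
  \<open>is_free_assoc_algebraI\<close>.
\<close>

lemma uea_of_free_lie_algebra: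
  fixes L :: "('k::field, 'a) module"
  assumes "free_on L S"
  shows "is_free_assoc_algebra (uea L)"
proof -
  interpret L: lie_algebra L using assms by (simp add: free_on_def)
  note L = L.nonassoc_algebra_axioms
  note U = uea_assoc_algebra[OF L]
  have S: "S \<subseteq> carrier L" using assms by (simp add: free_on_def)
  have inc: "uea_incl L x \<in> carrier (uea L)" if "x \<in> carrier L" for x
    using lie_homD(1)[OF uea_incl_hom[OF L] that] by simp
  have incl: "uea_incl L \<in> S \<rightarrow> carrier (uea L)" using inc S by auto
  have m: "(monomial [x] :: _ \<Rightarrow> 'k) \<in> carrier (free_assoc T)" if "x \<in> T" for x :: 'a and T
    by (rule monomial_in_free_assoc) (rule that)
  have com: "nonassoc_algebra (commutator_algebra (uea L))"
    by (rule lie_nonassoc[OF commutator_algebra_lie[OF U]])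
  have hom: "uea_proj L \<in> lie_hom (free_assoc (carrier L)) (uea L)"
    using uea_proj_hom[OF L] by (simp add: unital_hom_def)
  have gen: "generates_unital (uea L) (uea_incl L ` S)"
    unfolding generates_unital_def
  proof (intro conjI allI impI)
    show "uea_incl L ` S \<subseteq> carrier (uea L)" using inc S by auto
    fix H assume H: "subalg H (uea L)" "\<one>\<^bsub>uea L\<^esub> \<in> H" "uea_incl L ` S \<subseteq> H"
    interpret U: assoc_algebra "uea L" by (rule U)
    have "x \<ominus>\<^bsub>uea L\<^esub> y \<in> H" if "x \<in> H" "y \<in> H" for x y
    proof -
      have "(- 1) \<odot>\<^bsub>uea L\<^esub> y \<in> H" "y \<in> carrier (uea L)" using H(1) that unfolding subalg_def by auto
      then have "\<ominus>\<^bsub>uea L\<^esub> y \<in> H" by (simp add: U.scale_minus_one)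
      then show ?thesis using H(1) that unfolding subalg_def a_minus_def by auto
    qed
    then have "subalg H (commutator_algebra (uea L))" using H(1) by (simp add: subalg_def)
    then have "subalg {x \<in> carrier L. uea_incl L x \<in> H} L"
      by (rule subalg_vimage[OF L com uea_incl_hom[OF L]])
    moreover have "S \<subseteq> {x \<in> carrier L. uea_incl L x \<in> H}" using S H(3) by auto
    ultimately have *: "carrier L \<subseteq> {x \<in> carrier L. uea_incl L x \<in> H}"
      by (rule generatesD[OF free_on_generates[OF assms]])
    let ?K = "{t \<in> carrier (free_assoc (carrier L)). uea_proj L t \<in> H}"
    have "subalg ?K (free_assoc (carrier L))"
      by (rule subalg_vimage[OF free_assoc_nonassoc assoc_nonassoc[OF U] hom H(1)])
    moreover have "\<one>\<^bsub>free_assoc (carrier L)\<^esub> \<in> ?K"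
      using H(2) uea_proj_hom[OF L] assoc_algebra.axioms(2)[OF free_assoc_algebra] 
      by (auto simp: unital_hom_def ring_def monoid.one_closed)
    moreover have "(\<lambda>x. monomial [x]) ` carrier L \<subseteq> ?K" using * m by auto
    ultimately have "carrier (free_assoc (carrier L)) \<subseteq> ?K"
      by (rule generates_unitalD[OF generates_free_assoc])
    then show "carrier (uea L) \<subseteq> H" unfolding uea_proj_surj[OF L, symmetric] by auto
  qed
  have "(\<lambda>x. monomial [x]) \<in> S \<rightarrow> carrier (commutator_algebra (free_assoc S :: ('k, _) module))"
    using m by simp
  then obtain g :: "'a \<Rightarrow> 'a list \<Rightarrow> 'k" where g: "g \<in> lie_hom L (commutator_algebra (free_assoc S))"
      "\<And>x. x \<in> S \<Longrightarrow> g x = monomial [x]"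
    by (rule free_on_universal[OF assms commutator_algebra_lie[OF free_assoc_algebra]]) (rule that)
  obtain h where h: "h \<in> unital_hom (uea L) (free_assoc S)" "\<And>x. x \<in> carrier L \<Longrightarrow> h (uea_incl L x) = g x"
    by (rule uea_universal[OF L free_assoc_algebra g(1)]) (rule that)
  show ?thesis
  proof (rule is_free_assoc_algebraI[OF U incl gen h(1)])
    show "h (uea_incl L x) = monomial [x]" if "x \<in> S" for x
      using h(2)[OF subsetD[OF S that]] g(2)[OF that] by simp
  qed
qed


section \<open>Lie algebras on types\<close>

text \<open>
  The identities that have to be verified in extensions of free Lie algebras have many summands. On a
  type of class \<^class>\<open>ab_group_add\<close> they are within reach of simplification, without side
  conditions about membership in a carrier. The function \<open>type_algebra\<close> below leads back to records.
\<close>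

locale type_lie =
  fixes sc :: "'k::field \<Rightarrow> 'b::ab_group_add \<Rightarrow> 'b" and br :: "'b \<Rightarrow> 'b \<Rightarrow> 'b"
  assumes sc_add: "sc c (x + y) = sc c x + sc c y"
    and add_sc: "sc (c + d) x = sc c x + sc d x"
    and sc_sc: "sc c (sc d x) = sc (c * d) x"
    and sc_one [simp]: "sc 1 x = x"
    and br_add_left: "br (x + y) z = br x z + br y z"
    and br_add_right: "br z (x + y) = br z x + br z y"
    and br_sc_left: "br (sc c x) y = sc c (br x y)"
    and br_sc_right: "br x (sc c y) = sc c (br x y)"
    and br_self [simp]: "br x x = 0"
    and br_jacobi: "br x (br y z) + br y (br z x) + br z (br x y) = 0"
begin

lemma sc_zero_right [simp]: "sc c 0 = 0" using sc_add[of c 0 0] by simp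
lemma sc_zero_left [simp]: "sc 0 x = 0" using add_sc[of 0 0 x] by simp
lemma sc_minus_right: "sc c (- x) = - sc c x"
  using sc_add[of c x "- x"] by (simp add: eq_neg_iff_add_eq_0 add.commute)
lemma sc_diff: "sc c (x - y) = sc c x - sc c y"
  using sc_add[of c x "- y"] by (simp add: sc_minus_right)
lemma br_zero_left [simp]: "br 0 x = 0" using br_add_left[of 0 0 x] by simp
lemma br_zero_right [simp]: "br x 0 = 0" using br_add_right[of x 0 0] by simp
lemma br_minus_left: "br (- x) y = - br x y"
  using br_add_left[of x "- x" y] by (simp add: eq_neg_iff_add_eq_0 add.commute)
lemma br_minus_right: "br x (- y) = - br x y"
  using br_add_right[of x y "- y"] by (simp add: eq_neg_iff_add_eq_0 add.commute)
lemma br_diff_right: "br z (x - y) = br z x - br z y"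
  using br_add_right[of z x "- y"] by (simp add: br_minus_right)
lemma br_sum_right: "br x (\<Sum>i\<in>I. f i) = (\<Sum>i\<in>I. br x (f i))"
  by (induction I rule: infinite_finite_induct) (simp_all add: br_add_right)

lemma br_skew: "br y x = - br x y"
proof -
  have "br (x + y) (x + y) = 0" by simp
  then have "br x y + br y x = 0" unfolding br_add_left br_add_right by (simp add: add.commute)
  then show ?thesis by (simp add: eq_neg_iff_add_eq_0 add.commute)
qed

lemma br_leibniz: "br x (br y z) = br (br x y) z + br y (br x z)"
proof -
  have "br x (br y z) = - (br y (br z x) + br z (br x y))"
    using br_jacobi[of x y z] by (metis add.assoc eq_neg_iff_add_eq_0)
  also have "\<dots> = br (br x y) z + br y (br x z)"
    using br_skew[of "br x y" z] br_skew[of z x] by (simp add: br_minus_right)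
  finally show ?thesis .
qed

end

definition type_algebra :: "('k::field \<Rightarrow> 'b::ab_group_add \<Rightarrow> 'b) \<Rightarrow> ('b \<Rightarrow> 'b \<Rightarrow> 'b) \<Rightarrow> ('k, 'b) module"
  where "type_algebra sc br =
    \<lparr>carrier = UNIV, monoid.mult = br, one = 0, zero = 0, add = (+), module.smult = sc\<rparr>"

lemma type_algebra_simps [simp]:
  "carrier (type_algebra sc br) = UNIV" "x \<otimes>\<^bsub>type_algebra sc br\<^esub> y = br x y"
  "x \<oplus>\<^bsub>type_algebra sc br\<^esub> y = x + y" "\<zero>\<^bsub>type_algebra sc br\<^esub> = 0"
  "c \<odot>\<^bsub>type_algebra sc br\<^esub> x = sc c x"
  by (simp_all add: type_algebra_def)

lemma (in type_lie) lie_algebra: "lie_algebra (type_algebra sc br)"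
proof (intro lie_algebra.intro lie_algebra_axioms.intro nonassoc_algebraI abelian_groupI, goal_cases)
  case (6 x) then show ?case by (auto intro!: exI[of _ "- x"])
qed (simp_all add: sc_add add_sc sc_sc br_add_left br_add_right br_sc_left br_sc_right br_jacobi[unfolded add.assoc] algebra_simps)

locale type_derivation = type_lie +
  fixes D :: "'b::ab_group_add \<Rightarrow> 'b"
  assumes D_add: "D (x + y) = D x + D y"
    and D_sc: "D (sc c x) = sc c (D x)"
    and D_br: "D (br x y) = br (D x) y + br x (D y)"
begin

lemma D_zero [simp]: "D 0 = 0" using D_add[of 0 0] by simp
lemma D_minus: "D (- x) = - D x"
  using D_add[of x "- x"] by (simp add: eq_neg_iff_add_eq_0 add.commute)
lemma D_diff: "D (x - y) = D x - D y"
  using D_add[of x "- y"] by (simp add: D_minus)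
lemma D_sum: "D (\<Sum>i\<in>I. f i) = (\<Sum>i\<in>I. D (f i))"
  by (induction I rule: infinite_finite_induct) (simp_all add: D_add)

text \<open>
  The semidirect product of the Lie algebra with a line that acts by \<open>D\<close>: the pair \<open>(u, a)\<close> stands
  for \<open>u + a d\<close> with \<open>[d, u] = D u\<close>.
\<close>

definition ext_sc :: "'a \<Rightarrow> 'b \<times> 'a \<Rightarrow> 'b \<times> 'a"
  where "ext_sc c p = (sc c (fst p), c * snd p)"

definition ext_br :: "'b \<times> 'a \<Rightarrow> 'b \<times> 'a \<Rightarrow> 'b \<times> 'a"
  where "ext_br p q = (br (fst p) (fst q) + sc (snd p) (D (fst q)) - sc (snd q) (D (fst p)), 0)"

lemma type_lie_ext: "type_lie ext_sc ext_br"
proof (unfold_locales, goal_cases)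
  case (10 x y z)
  obtain u a v b w c where x: "x = (u, a)" and y: "y = (v, b)" and z: "z = (w, c)"
    by (cases x, cases y, cases z)
  have 1: "br u (br v w) + br v (br w u) + br w (br u v) = 0" by (rule br_jacobi)
  have skew: "br (D w) u = - br u (D w)" "br (D u) v = - br v (D u)" "br (D v) w = - br w (D v)"
    by (rule br_skew)+
  show ?case
    using 1 unfolding x y z ext_br_def
    by (simp add: zero_prod_def D_add D_diff D_sc D_br br_add_right br_diff_right br_sc_right sc_add sc_diff
        sc_sc skew sc_minus_right algebra_simps)
qed (auto simp: ext_sc_def ext_br_def prod_eq_iff sc_add add_sc sc_sc sc_diff br_add_left br_add_right br_sc_left
      br_sc_right D_add D_sc algebra_simps)

text \<open>
  The elements with second component 0 form a subalgebra, on which the first component is a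
  homomorphism. It is enough to know that the generators of \<open>M\<close> are mapped into it.
\<close>

lemma fst_ext_hom:
  fixes M :: "('a, 'c) module"
  assumes "nonassoc_algebra M" "generates M S" "h \<in> lie_hom M (type_algebra ext_sc ext_br)"
    and "\<And>x. x \<in> S \<Longrightarrow> snd (h x) = 0"
  shows "(\<lambda>x. fst (h x)) \<in> lie_hom M (type_algebra sc br)"
proof -
  interpret E: type_lie ext_sc ext_br by (rule type_lie_ext)
  note h = lie_homD[OF assms(3), simplified]
  have "subalg {p. snd p = 0} (type_algebra ext_sc ext_br)"
    by (auto simp: subalg_def ext_sc_def ext_br_def)
  from subalg_vimage[OF assms(1) lie_nonassoc[OF E.lie_algebra] assms(3) this]
  have "carrier M \<subseteq> {x \<in> carrier M. h x \<in> {p. snd p = 0}}"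
    using assms(4) generates_subset[OF assms(2)] by (intro generatesD[OF assms(2)]) auto
  then have 0: "snd (h x) = 0" if "x \<in> carrier M" for x using that by auto
  show ?thesis
    by (rule lie_homI) (simp_all add: h ext_sc_def ext_br_def 0)
qed

end

section \<open>The free Lie algebra as a type\<close>

text \<open>
  The free Lie algebra on all elements of a type. Free Lie algebras on a subset \<open>J\<close> of a type are
  reached from it by sending the superfluous generators to 0, see \<open>free_on_from_flie\<close>.
\<close>

typedef (overloaded) ('x, 'k::field) flie = "carrier (free_lie UNIV :: ('k, ('x magma \<Rightarrow> 'k) set) module)"
proof -
  interpret nonassoc_algebra "free_lie UNIV :: ('k, ('x magma \<Rightarrow> 'k) set) module"
    by (rule free_lie_nonassoc)
  show ?thesis by (rule exI, rule zero_closed)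
qed

setup_lifting type_definition_flie

instantiation flie :: (type, field) ab_group_add
begin

lift_definition zero_flie :: "('a, 'b) flie" is "\<zero>\<^bsub>free_lie UNIV\<^esub>"
  by (rule abelian_monoid.zero_closed) (rule abelian_group.axioms(1)[OF module.axioms(2)[OF nonassoc_algebra.axioms(1)[OF free_lie_nonassoc]]])

lift_definition plus_flie :: "('a, 'b) flie \<Rightarrow> ('a, 'b) flie \<Rightarrow> ('a, 'b) flie"
  is "\<lambda>x y. x \<oplus>\<^bsub>free_lie UNIV\<^esub> y"
  by (rule abelian_monoid.a_closed) (rule abelian_group.axioms(1)[OF module.axioms(2)[OF nonassoc_algebra.axioms(1)[OF free_lie_nonassoc]]])

lift_definition uminus_flie :: "('a, 'b) flie \<Rightarrow> ('a, 'b) flie"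
  is "\<lambda>x. \<ominus>\<^bsub>free_lie UNIV\<^esub> x"
  by (rule abelian_group.a_inv_closed) (rule module.axioms(2)[OF nonassoc_algebra.axioms(1)[OF free_lie_nonassoc]])

definition minus_flie :: "('a, 'b) flie \<Rightarrow> ('a, 'b) flie \<Rightarrow> ('a, 'b) flie"
  where "minus_flie x y = x + - y"

instance
proof
  interpret nonassoc_algebra "free_lie UNIV :: ('b, ('a magma \<Rightarrow> 'b) set) module"
    by (rule free_lie_nonassoc)
  fix x y z :: "('a, 'b) flie"
  show "x + y + z = x + (y + z)" by transfer (rule a_assoc)
  show "x + y = y + x" by transfer (rule a_comm)
  show "0 + x = x" by transfer (rule l_zero)
  show "- x + x = 0" by transfer (rule l_neg)
  show "x - y = x + - y" by (rule minus_flie_def)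
qed

end

lift_definition fl_scale :: "'k::field \<Rightarrow> ('x, 'k) flie \<Rightarrow> ('x, 'k) flie"
  is "\<lambda>c x. c \<odot>\<^bsub>free_lie UNIV\<^esub> x"
  by (rule nonassoc_algebra.scale_closed[OF free_lie_nonassoc])

lift_definition fl_bracket :: "('x, 'k::field) flie \<Rightarrow> ('x, 'k) flie \<Rightarrow> ('x, 'k) flie"
  is "\<lambda>x y. x \<otimes>\<^bsub>free_lie UNIV\<^esub> y"
  by (rule nonassoc_algebra.mult_closed[OF free_lie_nonassoc])

lift_definition fl_gen :: "'x \<Rightarrow> ('x, 'k::field) flie" is "free_lie_gen UNIV"
  by (rule free_lie_gen_closed) simp

interpretation flie: type_lie "fl_scale :: 'b::field \<Rightarrow> ('a, 'b) flie \<Rightarrow> _" fl_bracket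
proof
  interpret lie_algebra "free_lie UNIV :: ('b, ('a magma \<Rightarrow> 'b) set) module"
    by (rule free_lie_algebra)
  fix c d :: 'b and x y z :: "('a, 'b) flie"
  show "fl_scale c (x + y) = fl_scale c x + fl_scale c y" by transfer (rule scale_add)
  show "fl_scale (c + d) x = fl_scale c x + fl_scale d x" by transfer (rule add_scale)
  show "fl_scale c (fl_scale d x) = fl_scale (c * d) x" by transfer (rule scale_scale)
  show "fl_scale 1 x = x" by transfer (rule scale_one)
  show "fl_bracket (x + y) z = fl_bracket x z + fl_bracket y z" by transfer (rule mult_add_left)
  show "fl_bracket z (x + y) = fl_bracket z x + fl_bracket z y" by transfer (rule mult_add_right)
  show "fl_bracket (fl_scale c x) y = fl_scale c (fl_bracket x y)" by transfer (rule mult_smult_left)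
  show "fl_bracket x (fl_scale c y) = fl_scale c (fl_bracket x y)" by transfer (rule mult_smult_right)
  show "fl_bracket x x = 0" by transfer (rule bracket_self)
  show "fl_bracket x (fl_bracket y z) + fl_bracket y (fl_bracket z x) + fl_bracket z (fl_bracket x y) = 0"
    by transfer (rule jacobi)
qed

abbreviation fl_algebra :: "('k::field, ('x, 'k) flie) module"
  where "fl_algebra \<equiv> type_algebra fl_scale fl_bracket"

lemma free_on_fl_algebra: "free_on (fl_algebra :: ('k::field, ('x, 'k) flie) module) (range fl_gen)"
proof (rule free_onI)
  let ?F = "free_lie UNIV :: ('k, ('x magma \<Rightarrow> 'k) set) module"
  let ?A = "fl_algebra :: ('k, ('x, 'k) flie) module"
  show "lie_algebra ?A" by (rule flie.lie_algebra)
  show "fl_gen \<in> UNIV \<rightarrow> carrier ?A" by simp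
  show "Rep_flie \<in> lie_hom ?A ?F"
    by (rule lie_homI) (auto simp: Rep_flie plus_flie.rep_eq fl_bracket.rep_eq fl_scale.rep_eq)
  show "Rep_flie (fl_gen x) = free_lie_gen UNIV x" for x :: 'x by (rule fl_gen.rep_eq)
  have hom: "Abs_flie \<in> lie_hom ?F ?A"
  proof (rule lie_homI)
    fix c and x y assume x: "x \<in> carrier ?F"
    then show "Abs_flie (c \<odot>\<^bsub>?F\<^esub> x) = c \<odot>\<^bsub>?A\<^esub> Abs_flie x"
      by (simp add: fl_scale.abs_eq eq_onp_def)
    assume y: "y \<in> carrier ?F"
    show "Abs_flie (x \<oplus>\<^bsub>?F\<^esub> y) = Abs_flie x \<oplus>\<^bsub>?A\<^esub> Abs_flie y"
      using x y by (simp add: plus_flie.abs_eq eq_onp_def)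
    show "Abs_flie (x \<otimes>\<^bsub>?F\<^esub> y) = Abs_flie x \<otimes>\<^bsub>?A\<^esub> Abs_flie y"
      using x y by (simp add: fl_bracket.abs_eq eq_onp_def)
  qed simp
  show "generates ?A (range fl_gen)"
    unfolding generates_def
  proof (intro conjI allI impI)
    fix H assume H: "subalg H ?A" "range fl_gen \<subseteq> H"
    have "carrier ?F \<subseteq> {x \<in> carrier ?F. Abs_flie x \<in> H}"
    proof (rule generatesD[OF generates_free_lie])
      show "subalg {x \<in> carrier ?F. Abs_flie x \<in> H} ?F"
        by (rule subalg_vimage[OF free_lie_nonassoc lie_nonassoc[OF flie.lie_algebra] hom H(1)])
      show "free_lie_gen UNIV ` UNIV \<subseteq> {x \<in> carrier ?F. Abs_flie x \<in> H}"
        using H(2) by (auto simp: free_lie_gen_closed fl_gen.abs_eq[symmetric])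
    qed
    then show "carrier ?A \<subseteq> H"
      using Abs_flie_cases by (metis (no_types, lifting) mem_Collect_eq subset_iff)
  qed simp
qed

lemma flie_universal:
  fixes f :: "'x \<Rightarrow> 'a"
  assumes "lie_algebra (L :: ('k::field, 'a) module)" "\<And>x. f x \<in> carrier L"
  obtains h where "h \<in> lie_hom (fl_algebra :: ('k, ('x, 'k) flie) module) L" "\<And>x. h (fl_gen x) = f x"
proof -
  obtain g where g: "g \<in> lie_hom (free_lie UNIV :: ('k, ('x magma \<Rightarrow> 'k) set) module) L"
      "\<And>x. x \<in> UNIV \<Longrightarrow> g (free_lie_gen UNIV x) = f x"
    by (rule free_lie_universal[OF assms(1), of f UNIV]) (use assms(2) in auto)
  have "Rep_flie \<in> lie_hom (fl_algebra :: ('k, ('x, 'k) flie) module) (free_lie UNIV)"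
    by (rule lie_homI) (auto simp: Rep_flie plus_flie.rep_eq fl_bracket.rep_eq fl_scale.rep_eq)
  from lie_hom_comp[OF this g(1)] show ?thesis
    by (rule that) (simp add: g(2) fl_gen.rep_eq)
qed

lemma flie_induct [case_names gen add scale bracket]:
  fixes x :: "('x, 'k::field) flie"
  assumes "\<And>a. P (fl_gen a)" "\<And>x y. P x \<Longrightarrow> P y \<Longrightarrow> P (x + y)"
    "\<And>c x. P x \<Longrightarrow> P (fl_scale c x)" "\<And>x y. P x \<Longrightarrow> P y \<Longrightarrow> P (fl_bracket x y)"
  shows "P x"
proof -
  have "P 0" using assms(3)[OF assms(1), of 0 undefined] by simp
  then have "subalg {x. P x} (fl_algebra :: ('k, ('x, 'k) flie) module)"
    using assms by (simp add: subalg_def)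
  then have "carrier (fl_algebra :: ('k, ('x, 'k) flie) module) \<subseteq> {x. P x}"
    by (rule generatesD[OF free_on_generates[OF free_on_fl_algebra]]) (use assms(1) in auto)
  then show ?thesis by auto
qed

text \<open>
  A derivation \<open>D\<close> of \<open>F\<close> is the same as a homomorphism
  \<open>x \<mapsto> x + \<epsilon> D x\<close> from \<open>F\<close> to \<open>F \<oplus> \<epsilon> F\<close>, where
  \<open>\<epsilon>\<^sup>2 = 0\<close>. Hence its values on the free generators can be prescribed. In the proof, pairs
  stand for the elements of \<open>F \<oplus> \<epsilon> F\<close>.
\<close>

lemma flie_derivation:
  fixes f :: "'x \<Rightarrow> ('x, 'k::field) flie"
  obtains D where "type_derivation fl_scale fl_bracket D" "\<And>x. D (fl_gen x) = f x"
proof -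
  define sc :: "'k \<Rightarrow> ('x, 'k) flie \<times> ('x, 'k) flie \<Rightarrow> _"
    where "sc c p = (fl_scale c (fst p), fl_scale c (snd p))" for c p
  define br :: "('x, 'k) flie \<times> ('x, 'k) flie \<Rightarrow> _ \<Rightarrow> ('x, 'k) flie \<times> ('x, 'k) flie"
    where "br p q = (fl_bracket (fst p) (fst q), fl_bracket (fst p) (snd q) + fl_bracket (snd p) (fst q))" for p q
  interpret B: type_lie sc br
  proof (unfold_locales, goal_cases)
    case (9 x) then show ?case
      using flie.br_skew[of "snd x" "fst x"] by (simp add: br_def zero_prod_def)
  next
    case (10 x y z)
    have "fl_bracket (fst x) (fl_bracket (fst y) (snd z)) + fl_bracket (fst y) (fl_bracket (snd z) (fst x))
      + fl_bracket (snd z) (fl_bracket (fst x) (fst y)) = 0"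
      "fl_bracket (fst x) (fl_bracket (snd y) (fst z)) + fl_bracket (snd y) (fl_bracket (fst z) (fst x))
      + fl_bracket (fst z) (fl_bracket (fst x) (snd y)) = 0"
      "fl_bracket (snd x) (fl_bracket (fst y) (fst z)) + fl_bracket (fst y) (fl_bracket (fst z) (snd x))
      + fl_bracket (fst z) (fl_bracket (snd x) (fst y)) = 0" by (rule flie.br_jacobi)+
    from arg_cong2[OF arg_cong2[OF this(1,2), of "(+)"] this(3), of "(+)"]
    have "snd (br x (br y z) + br y (br z x) + br z (br x y)) = 0"
      by (simp add: br_def flie.br_add_right algebra_simps)
    moreover have "fst (br x (br y z) + br y (br z x) + br z (br x y)) = 0"
      by (simp add: br_def flie.br_jacobi)
    ultimately show ?case by (simp add: prod_eq_iff)
  qed (auto simp: sc_def br_def prod_eq_iff flie.sc_add flie.add_sc flie.sc_sc flie.br_add_left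
      flie.br_add_right flie.br_sc_left flie.br_sc_right algebra_simps)
  obtain h where h: "h \<in> lie_hom fl_algebra (type_algebra sc br)" "\<And>x. h (fl_gen x) = (fl_gen x, f x)"
    by (rule flie_universal[OF B.lie_algebra, of "\<lambda>x. (fl_gen x, f x)"]) (use that in auto)
  note hs = lie_homD[OF h(1), simplified]
  have 1: "fst (h x) = x" for x
    by (induction x rule: flie_induct) (simp_all add: h(2) hs sc_def br_def)
  show ?thesis
  proof (rule that)
    show "type_derivation fl_scale fl_bracket (\<lambda>x. snd (h x))"
      by unfold_locales (simp_all add: hs sc_def br_def 1 add.commute)
    show "snd (h (fl_gen x)) = f x" for x by (simp add: h(2))
  qed
qed

section \<open>Lazard elimination\<close>

context lie_algebra
begin

lemma skew: "x \<in> carrier L \<Longrightarrow> y \<in> carrier L \<Longrightarrow> y \<otimes> x = \<ominus> (x \<otimes> y)"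
proof -
  assume xy: "x \<in> carrier L" "y \<in> carrier L"
  have "x \<otimes> y \<oplus> y \<otimes> x = x \<otimes> (x \<oplus> y) \<oplus> y \<otimes> (x \<oplus> y)"
    using xy by (simp add: mult_add_right bracket_self)
  also have "\<dots> = (x \<oplus> y) \<otimes> (x \<oplus> y)" using xy by (intro mult_add_left[symmetric]) auto
  also have "\<dots> = \<zero>" using xy by (intro bracket_self) auto
  finally have "x \<otimes> y \<oplus> y \<otimes> x = \<zero>" .
  then show ?thesis using xy by (metis a_comm minus_equality mult_closed)
qed

lemma leibniz:
  assumes "x \<in> carrier L" "y \<in> carrier L" "z \<in> carrier L"
  shows "x \<otimes> (y \<otimes> z) = (x \<otimes> y) \<otimes> z \<oplus> y \<otimes> (x \<otimes> z)"
proof -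
  have 1: "x \<otimes> (y \<otimes> z) = \<ominus> (y \<otimes> (z \<otimes> x) \<oplus> z \<otimes> (x \<otimes> y))"
    using jacobi[OF assms] assms minus_equality[of "x \<otimes> (y \<otimes> z)" "y \<otimes> (z \<otimes> x) \<oplus> z \<otimes> (x \<otimes> y)"]
    by (simp add: a_assoc)
  have "z \<otimes> x = \<ominus> (x \<otimes> z)" "z \<otimes> (x \<otimes> y) = \<ominus> ((x \<otimes> y) \<otimes> z)"
    by (rule skew; use assms in simp)+
  then show ?thesis unfolding 1 using assms by (simp add: mult_minus_right minus_add a_comm)
qed

end

definition lie_span :: "('k::field, 'a) module \<Rightarrow> 'a set \<Rightarrow> 'a set"
  where "lie_span L S = \<Inter>{H. subalg H L \<and> S \<subseteq> H}"

lemma lie_span_superset: "S \<subseteq> lie_span L S"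
  by (auto simp: lie_span_def)

lemma lie_span_least: "subalg H L \<Longrightarrow> S \<subseteq> H \<Longrightarrow> lie_span L S \<subseteq> H"
  by (auto simp: lie_span_def)

lemma subalg_lie_span:
  assumes "nonassoc_algebra L" "S \<subseteq> carrier L"
  shows "subalg (lie_span L S) L"
  using subalg_carrier[OF assms(1)] assms(2) lie_span_least[OF subalg_carrier[OF assms(1)] assms(2)]
  unfolding subalg_def[of "lie_span L S"]
  by (auto simp: lie_span_def subalg_def)

lemma generates_lie_span:
  assumes "subalg M L" "S \<subseteq> M" "M \<subseteq> lie_span L S"
  shows "generates (L\<lparr>carrier := M\<rparr>) S"
  unfolding generates_def
proof (intro conjI allI impI)
  fix H assume H: "subalg H (L\<lparr>carrier := M\<rparr>)" "S \<subseteq> H"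
  then have "subalg H L" using assms(1) by (auto simp: subalg_def)
  then show "carrier (L\<lparr>carrier := M\<rparr>) \<subseteq> H" using assms(3) lie_span_least[OF _ H(2)] by fastforce
qed (use assms in auto)

text \<open>
  By the Jacobi identity, the elements \<open>u\<close> of a subalgebra \<open>H\<close> for which also
  \<open>[x, u] \<in> H\<close> form a subalgebra.
\<close>

lemma lie_span_ad_stable:
  assumes "lie_algebra L" "S \<subseteq> carrier L" "x \<in> carrier L"
    and "\<And>s. s \<in> S \<Longrightarrow> x \<otimes>\<^bsub>L\<^esub> s \<in> lie_span L S" "u \<in> lie_span L S"
  shows "x \<otimes>\<^bsub>L\<^esub> u \<in> lie_span L S"
proof -
  interpret lie_algebra L by fact
  let ?H = "lie_span L S"
  have sub: "subalg ?H L" by (rule subalg_lie_span) (use assms in \<open>auto intro: nonassoc_algebra_axioms\<close>)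
  then have [simp]: "u \<in> ?H \<Longrightarrow> u \<in> carrier L" for u by (auto simp: subalg_def)
  have "subalg {u \<in> ?H. x \<otimes>\<^bsub>L\<^esub> u \<in> ?H} L"
    using sub assms(3) by (auto simp: subalg_def mult_add_right mult_smult_right leibniz[OF assms(3)])
  moreover have "S \<subseteq> {u \<in> ?H. x \<otimes>\<^bsub>L\<^esub> u \<in> ?H}" using assms(4) lie_span_superset[of S L] by auto
  ultimately show ?thesis using lie_span_least assms(5) by blast
qed

lemma subalg_adjoin:
  assumes "lie_algebra L" "subalg H L" "x \<in> carrier L" "\<And>u. u \<in> H \<Longrightarrow> x \<otimes>\<^bsub>L\<^esub> u \<in> H"
  shows "subalg {u \<oplus>\<^bsub>L\<^esub> c \<odot>\<^bsub>L\<^esub> x | u c. u \<in> H} L" (is "subalg ?K L")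
proof -
  interpret lie_algebra L by fact
  have [simp]: "u \<in> H \<Longrightarrow> u \<in> carrier L" for u using assms(2) by (auto simp: subalg_def)
  note [simp] = assms(3)
  have H_add: "u \<oplus>\<^bsub>L\<^esub> v \<in> H" and H_mult: "u \<otimes>\<^bsub>L\<^esub> v \<in> H" if "u \<in> H" "v \<in> H" for u v
    using assms(2) that by (simp_all add: subalg_def)
  have H_sc: "c \<odot>\<^bsub>L\<^esub> u \<in> H" if "u \<in> H" for u c
    using assms(2) that by (simp add: subalg_def)
  have neg: "\<ominus>\<^bsub>L\<^esub> u \<in> H" if "u \<in> H" for u
  proof -
    have "(- 1) \<odot>\<^bsub>L\<^esub> u \<in> H" using that by (rule H_sc)
    then show ?thesis using that by (simp add: scale_minus_one)
  qed
  show ?thesis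
    unfolding subalg_def
  proof (intro conjI allI ballI)
    show "?K \<subseteq> carrier L" by auto
    have "\<zero>\<^bsub>L\<^esub> = \<zero>\<^bsub>L\<^esub> \<oplus>\<^bsub>L\<^esub> 0 \<odot>\<^bsub>L\<^esub> x" by simp
    then show "\<zero>\<^bsub>L\<^esub> \<in> ?K" using assms(2) unfolding subalg_def by blast
    fix p assume "p \<in> ?K"
    then obtain u a where p: "p = u \<oplus>\<^bsub>L\<^esub> a \<odot>\<^bsub>L\<^esub> x" "u \<in> H" by blast
    have "d \<odot>\<^bsub>L\<^esub> p = d \<odot>\<^bsub>L\<^esub> u \<oplus>\<^bsub>L\<^esub> (d * a) \<odot>\<^bsub>L\<^esub> x" for d using p by (simp add: scale_add scale_scale)
    then show "d \<odot>\<^bsub>L\<^esub> p \<in> ?K" for d using H_sc[OF p(2)] by blast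
    fix q assume "q \<in> ?K"
    then obtain v b where q: "q = v \<oplus>\<^bsub>L\<^esub> b \<odot>\<^bsub>L\<^esub> x" "v \<in> H" by blast
    have "p \<oplus>\<^bsub>L\<^esub> q = (u \<oplus>\<^bsub>L\<^esub> v) \<oplus>\<^bsub>L\<^esub> (a + b) \<odot>\<^bsub>L\<^esub> x"
      using p q by (simp add: add_scale a_ac)
    then show "p \<oplus>\<^bsub>L\<^esub> q \<in> ?K" using H_add[OF p(2) q(2)] by blast
    have "u \<otimes>\<^bsub>L\<^esub> x = \<ominus>\<^bsub>L\<^esub> (x \<otimes>\<^bsub>L\<^esub> u)" using p by (intro skew) simp_all
    then have ux: "u \<otimes>\<^bsub>L\<^esub> x \<in> H" using neg assms(4) p(2) by simp
    have "p \<otimes>\<^bsub>L\<^esub> q = (u \<otimes>\<^bsub>L\<^esub> v \<oplus>\<^bsub>L\<^esub> (b \<odot>\<^bsub>L\<^esub> (u \<otimes>\<^bsub>L\<^esub> x) \<oplus>\<^bsub>L\<^esub> a \<odot>\<^bsub>L\<^esub> (x \<otimes>\<^bsub>L\<^esub> v))) \<oplus>\<^bsub>L\<^esub> 0 \<odot>\<^bsub>L\<^esub> x"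
      using p q by (simp add: mult_add_left mult_add_right mult_smult_left mult_smult_right bracket_self a_ac)
    moreover have "u \<otimes>\<^bsub>L\<^esub> v \<oplus>\<^bsub>L\<^esub> (b \<odot>\<^bsub>L\<^esub> (u \<otimes>\<^bsub>L\<^esub> x) \<oplus>\<^bsub>L\<^esub> a \<odot>\<^bsub>L\<^esub> (x \<otimes>\<^bsub>L\<^esub> v)) \<in> H"
      by (intro H_add H_sc H_mult assms(4) ux p(2) q(2))
    ultimately show "p \<otimes>\<^bsub>L\<^esub> q \<in> ?K" by blast
  qed
qed

text \<open>
  The criterion \<open>free_onI\<close> for a target that is the free Lie algebra on a whole type: the generators
  outside of \<open>J\<close> are sent to 0.
\<close>

lemma free_on_from_flie:
  fixes M :: "('k::field, 'a) module" and b :: "'x \<Rightarrow> 'a"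
  assumes "lie_algebra M" "generates M (b ` J)"
    and "g \<in> lie_hom M fl_algebra" "\<And>j. j \<in> J \<Longrightarrow> g (b j) = fl_gen j"
  shows "free_on M (b ` J)"
proof -
  interpret F: lie_algebra "free_lie J :: ('k, ('x magma \<Rightarrow> 'k) set) module" by (rule free_lie_algebra)
  obtain h where h: "h \<in> lie_hom fl_algebra (free_lie J :: ('k, ('x magma \<Rightarrow> 'k) set) module)"
      "\<And>x. h (fl_gen x) = (if x \<in> J then free_lie_gen J x else \<zero>\<^bsub>free_lie J\<^esub>)"
    by (rule flie_universal[OF free_lie_algebra,
          of "\<lambda>x. if x \<in> J then free_lie_gen J x else \<zero>\<^bsub>free_lie J\<^esub>" J])
       (use that in \<open>auto simp: free_lie_gen_closed\<close>)
  show ?thesis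
  proof (rule free_onI[OF assms(1) _ assms(2)])
    show "b \<in> J \<rightarrow> carrier M" using generates_subset[OF assms(2)] by auto
    show "h \<circ> g \<in> lie_hom M (free_lie J)" by (rule lie_hom_comp[OF assms(3) h(1)])
    show "(h \<circ> g) (b j) = free_lie_gen J j" if "j \<in> J" for j
      using that by (simp add: assms(4) h(2))
  qed
qed

definition ad :: "('k::field, 'a) module \<Rightarrow> 'a \<Rightarrow> 'a \<Rightarrow> 'a"
  where "ad L x y = x \<otimes>\<^bsub>L\<^esub> y"

text \<open>
  The subalgebra \<open>H\<close> generated by the elements \<open>ad(x)\<^sup>k b\<close> is stable under
  \<open>ad(x)\<close>, so that \<open>H\<close> and \<open>x\<close> together span a subalgebra; it contains \<open>B\<close> and is therefore all
  of \<open>L\<close>. As \<open>M\<close> contains \<open>H\<close> but not \<open>x\<close>, it is equal to \<open>H\<close>. For freeness,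
  take the free Lie algebra on generators \<open>(k, b)\<close> and its derivation
  \<open>D (k, b) = (k + 1, b)\<close>. The semidirect product with \<open>D\<close> receives a homomorphism from
  \<open>L\<close> that sends \<open>x\<close> to the added element and \<open>b\<close> to \<open>(0, b)\<close>, and so it sends
  \<open>ad(x)\<^sup>k b\<close> to \<open>(k, b)\<close>.
\<close>

theorem lazard_elimination:
  fixes L :: "('k::field, 'a) module"
  assumes free: "free_on L B" and x: "x \<in> B" and M: "subalg M L" and "x \<notin> M"
    and ad: "\<And>k b. b \<in> B - {x} \<Longrightarrow> (ad L x ^^ k) b \<in> M"
  shows "free_on (L\<lparr>carrier := M\<rparr>) ((\<lambda>(k, b). (ad L x ^^ k) b) ` (UNIV \<times> (B - {x})))"
proof -
  interpret L: lie_algebra L using free by (simp add: free_on_def)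
  let ?J = "UNIV \<times> (B - {x}) :: (nat \<times> 'a) set"
  let ?b = "\<lambda>(k, b). (ad L x ^^ k) b"
  let ?S = "?b ` ?J"
  have B: "B \<subseteq> carrier L" using free by (simp add: free_on_def)
  have M_sub: "M \<subseteq> carrier L" using M by (simp add: subalg_def)
  have SM: "?S \<subseteq> M" using ad by auto
  have lieM: "lie_algebra (L\<lparr>carrier := M\<rparr>)" by (rule lie_algebra_subalg[OF L.lie_algebra_axioms M])
  have SL: "?S \<subseteq> carrier L" using SM M_sub by blast
  let ?H = "lie_span L ?S"
  have H: "subalg ?H L" by (rule subalg_lie_span[OF L.nonassoc_algebra_axioms SL])
  have HM: "?H \<subseteq> M" by (rule lie_span_least[OF M SM])
  have stable: "x \<otimes>\<^bsub>L\<^esub> u \<in> ?H" if "u \<in> ?H" for u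
    using L.lie_algebra_axioms SL subsetD[OF B x] _ that
  proof (rule lie_span_ad_stable)
    fix s assume "s \<in> ?S"
    then obtain k b where b: "b \<in> B - {x}" "s = (ad L x ^^ k) b" by auto
    then have "x \<otimes>\<^bsub>L\<^esub> s = ?b (Suc k, b)" by (simp add: ad_def)
    then have "x \<otimes>\<^bsub>L\<^esub> s \<in> ?S" using b(1) by blast
    then show "x \<otimes>\<^bsub>L\<^esub> s \<in> ?H" by (rule subsetD[OF lie_span_superset])
  qed
  let ?K = "{u \<oplus>\<^bsub>L\<^esub> c \<odot>\<^bsub>L\<^esub> x | u c. u \<in> ?H}"
  have K: "subalg ?K L" by (rule subalg_adjoin[OF L.lie_algebra_axioms H subsetD[OF B x] stable])
  have "b \<in> ?K" if "b \<in> B" for b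
  proof (cases "b = x")
    case True
    have "x = \<zero>\<^bsub>L\<^esub> \<oplus>\<^bsub>L\<^esub> 1 \<odot>\<^bsub>L\<^esub> x" using subsetD[OF B x] by simp
    moreover have "\<zero>\<^bsub>L\<^esub> \<in> ?H" using H by (simp add: subalg_def)
    ultimately show ?thesis using True by blast
  next
    case False
    then have "?b (0, b) \<in> ?S" using that by blast
    then have "?b (0, b) \<in> ?H" by (rule subsetD[OF lie_span_superset])
    then have "b \<in> ?H" by simp
    moreover have "b = b \<oplus>\<^bsub>L\<^esub> 0 \<odot>\<^bsub>L\<^esub> x" using subsetD[OF B x] subsetD[OF B that] by simp
    ultimately show ?thesis by blast
  qed
  then have all: "carrier L \<subseteq> ?K" using generatesD[OF free_on_generates[OF free] K] by blast
  have "M \<subseteq> ?H"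
  proof
    fix m assume m: "m \<in> M"
    then obtain u c where u: "m = u \<oplus>\<^bsub>L\<^esub> c \<odot>\<^bsub>L\<^esub> x" "u \<in> ?H" using all M_sub by blast
    have uM: "u \<in> M" and uL: "u \<in> carrier L" using u(2) HM M_sub by auto
    have "c = 0"
    proof (rule ccontr)
      assume c: "c \<noteq> 0"
      have "m \<oplus>\<^bsub>L\<^esub> (- 1) \<odot>\<^bsub>L\<^esub> u \<in> M" using M m uM unfolding subalg_def by blast
      moreover have "m \<oplus>\<^bsub>L\<^esub> (- 1) \<odot>\<^bsub>L\<^esub> u = c \<odot>\<^bsub>L\<^esub> x"
        unfolding u(1) using uL subsetD[OF B x] by (simp add: L.scale_minus_one L.a_ac L.r_neg L.r_neg2)
      ultimately have "c \<odot>\<^bsub>L\<^esub> x \<in> M" by simp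
      then have "inverse c \<odot>\<^bsub>L\<^esub> (c \<odot>\<^bsub>L\<^esub> x) \<in> M" using M unfolding subalg_def by blast
      then show False using c subsetD[OF B x] \<open>x \<notin> M\<close> by (simp add: L.scale_scale)
    qed
    then show "m \<in> ?H" using u uL subsetD[OF B x] by simp
  qed
  then have gen: "generates (L\<lparr>carrier := M\<rparr>) ?S" by (rule generates_lie_span[OF M SM])
  obtain D :: "(nat \<times> 'a, 'k) flie \<Rightarrow> _" where D: "type_derivation fl_scale fl_bracket D"
      "\<And>j. D (fl_gen j) = fl_gen (Suc (fst j), snd j)"
    by (rule flie_derivation) (rule that)
  interpret D: type_derivation fl_scale fl_bracket D by (rule D(1))
  interpret E: type_lie D.ext_sc D.ext_br by (rule D.type_lie_ext)
  let ?E = "type_algebra D.ext_sc D.ext_br"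
  obtain h where h: "h \<in> lie_hom L ?E"
      "\<And>b. b \<in> B \<Longrightarrow> h b = (if b = x then (0, 1) else (fl_gen (0, b), 0))"
    by (rule free_on_universal[OF free E.lie_algebra,
          of "\<lambda>b. if b = x then (0, 1) else (fl_gen (0, b), 0)"]) (use that in auto)
  have hb: "h ((ad L x ^^ k) b) = (fl_gen (k, b), 0)" if "b \<in> B - {x}" for k b
  proof (induction k)
    case 0 then show ?case using that by (simp add: h(2))
  next
    case (Suc k)
    have "(ad L x ^^ k) b \<in> carrier L" using ad[OF that, of k] M_sub by blast
    then have "h ((ad L x ^^ Suc k) b) = D.ext_br (h x) (h ((ad L x ^^ k) b))"
      using lie_homD(3)[OF h(1)] subsetD[OF B x] by (simp add: ad_def)
    then show ?case using x by (simp add: Suc h(2) D.ext_br_def D(2))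
  qed
  have hM: "h \<in> lie_hom (L\<lparr>carrier := M\<rparr>) ?E"
    using h(1) M_sub by (auto simp: lie_hom_def subset_iff)
  have hj: "h (?b j) = (fl_gen j, 0)" if "j \<in> ?J" for j
    using that hb[of "snd j" "fst j"] by (simp add: split_beta mem_Times_iff)
  have "(\<lambda>m. fst (h m)) \<in> lie_hom (L\<lparr>carrier := M\<rparr>) fl_algebra"
  proof (rule D.fst_ext_hom[OF lie_nonassoc[OF lieM] gen hM])
    fix s assume "s \<in> ?S"
    then obtain j where "j \<in> ?J" "s = ?b j" by (rule imageE)
    then show "snd (h s) = 0" using hj by simp
  qed
  then show ?thesis
    by (rule free_on_from_flie[OF lieM gen]) (simp only: hj fst_conv)
qed


section \<open>Two derivations of a free Lie algebra\<close>

text \<open>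
  The free generators of the common kernel of the first two coordinate characters. With
  \<open>t = x\<^sub>1\<close> and \<open>s = x\<^sub>2\<close>, the generator \<open>VY\<close> stands for \<open>[t, s]\<close>, the generator
  \<open>VX k i\<close> for \<open>ad(s)\<^sup>k x\<^sub>i\<close> and \<open>VZ k i\<close> for \<open>ad(s)\<^sup>k [t, x\<^sub>i]\<close>, where
  \<open>i \<ge> 3\<close>.
\<close>

datatype ym_var = VY | VX nat nat | VZ nat nat

lemma sum_antisymmetric_eq_0:
  fixes F :: "'i \<Rightarrow> 'i \<Rightarrow> 'b::ab_group_add"
  assumes "finite I" "\<And>i j. F j i = - F i j" "\<And>i. F i i = 0"
  shows "(\<Sum>i\<in>I. \<Sum>j\<in>I. F i j) = 0"
  using assms(1)
proof (induction I)
  case (insert a I)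
  have "(\<Sum>i\<in>I. F i a) = - (\<Sum>j\<in>I. F a j)"
    unfolding sum_negf[symmetric] by (rule sum.cong) (simp_all add: assms(2)[of a])
  then show ?case using insert by (simp add: sum.distrib assms(3))
qed simp

text \<open>
  The summand is antisymmetric in \<open>i\<close> and \<open>j\<close>: by the Jacobi identity \<open>ad(a\<^sub>i)\<close> and
  \<open>ad(a\<^sub>j)\<close> commute on \<open>c = [a\<^sub>j, a\<^sub>i]\<close>, because the correction term is a multiple of
  \<open>[c, c]\<close>. This is the dependence \<open>\<Sum>\<^sub>j [x\<^sub>j, r\<^sub>j] = 0\<close> between the Yang-Mills relators
  \<open>r\<^sub>j\<close>, and it is the reason why the two derivations below fit together.
\<close>

lemma (in type_lie) double_commutator_sum:
  assumes "finite I"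
  shows "(\<Sum>i\<in>I. \<Sum>j\<in>I. br (a i) (br (a j) (br (a j) (a i)))) = 0"
proof (rule sum_antisymmetric_eq_0[OF assms])
  fix i j
  have c: "br (a i) (a j) = - br (a j) (a i)" by (rule br_skew)
  have "br (a i) (br (a j) (br (a j) (a i)))
      = br (br (a i) (a j)) (br (a j) (a i)) + br (a j) (br (a i) (br (a j) (a i)))"
    by (rule br_leibniz)
  also have "\<dots> = - br (a j) (br (a i) (br (a i) (a j)))"
    unfolding c by (simp add: br_minus_left br_minus_right)
  finally show "br (a j) (br (a i) (br (a i) (a j))) = - br (a i) (br (a j) (br (a j) (a i)))"
    by simp
qed simp

text \<open>
  The derivations \<open>Ds\<close> and \<open>Dt\<close> imitate \<open>ad(s)\<close> and \<open>ad(t)\<close>. The values of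
  \<open>Ds\<close> on \<open>VX\<close> and \<open>VZ\<close> and of \<open>Dt\<close> on \<open>VX 0 i\<close> only restate the meaning of the
  generators. The three other values are the Yang-Mills relations: the one with index 1 gives
  \<open>[s, [t, s]]\<close>, the one with index 2 gives \<open>[t, [t, s]]\<close>, and the one with index
  \<open>i \<ge> 3\<close> gives \<open>[t, [t, x\<^sub>i]]\<close>. The values of \<open>Dt\<close> on the generators with
  \<open>k > 0\<close> are forced by \<open>[Dt, Ds] = ad VY\<close>, that is by \<open>[t, s] = VY\<close>. The only place where
  this identity might fail is the generator \<open>VY\<close>, where it amounts to \<open>double_commutator_sum\<close>.
\<close>

lemma ym_derivations:
  fixes I :: "nat set"
  assumes "finite I"
  obtains Ds Dt :: "(ym_var, 'k::field) flie \<Rightarrow> (ym_var, 'k) flie"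
  where "type_derivation fl_scale fl_bracket Ds" "type_derivation fl_scale fl_bracket Dt"
    "\<And>k i. Ds (fl_gen (VX k i)) = fl_gen (VX (Suc k) i)"
    "\<And>k i. Ds (fl_gen (VZ k i)) = fl_gen (VZ (Suc k) i)"
    "Ds (fl_gen VY) = - (\<Sum>i\<in>I. fl_bracket (fl_gen (VX 0 i)) (fl_gen (VZ 0 i)))"
    "\<And>i. Dt (fl_gen (VX 0 i)) = fl_gen (VZ 0 i)"
    "\<And>i. Dt (fl_gen (VZ 0 i)) = - fl_gen (VX 2 i)
      - (\<Sum>j\<in>I. fl_bracket (fl_gen (VX 0 j)) (fl_bracket (fl_gen (VX 0 j)) (fl_gen (VX 0 i))))"
    "Dt (fl_gen VY) = (\<Sum>i\<in>I. fl_bracket (fl_gen (VX 0 i)) (fl_gen (VX 1 i)))"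
    "\<And>u. Dt (Ds u) = fl_bracket (fl_gen VY) u + Ds (Dt u)"
proof -
  let ?br = "fl_bracket :: (ym_var, 'k) flie \<Rightarrow> _ \<Rightarrow> _"
  let ?g = "fl_gen :: ym_var \<Rightarrow> (ym_var, 'k) flie"
  define f where "f v = (case v of VX k i \<Rightarrow> ?g (VX (Suc k) i) | VZ k i \<Rightarrow> ?g (VZ (Suc k) i)
      | VY \<Rightarrow> - (\<Sum>i\<in>I. ?br (?g (VX 0 i)) (?g (VZ 0 i))))" for v
  obtain Ds where Ds: "type_derivation fl_scale fl_bracket Ds" "\<And>v. Ds (?g v) = f v"
    by (rule flie_derivation[of f]) (rule that)
  interpret Ds: type_derivation fl_scale fl_bracket Ds by (rule Ds(1))
  define gx where "gx i = rec_nat (?g (VZ 0 i)) (\<lambda>k r. ?br (?g VY) (?g (VX k i)) + Ds r)" for i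
  define gz where "gz i = rec_nat (- ?g (VX 2 i) - (\<Sum>j\<in>I. ?br (?g (VX 0 j)) (?br (?g (VX 0 j)) (?g (VX 0 i)))))
      (\<lambda>k r. ?br (?g VY) (?g (VZ k i)) + Ds r)" for i
  define g where "g v = (case v of VX k i \<Rightarrow> gx i k | VZ k i \<Rightarrow> gz i k
      | VY \<Rightarrow> (\<Sum>i\<in>I. ?br (?g (VX 0 i)) (?g (VX 1 i))))" for v
  obtain Dt where Dt: "type_derivation fl_scale fl_bracket Dt" "\<And>v. Dt (?g v) = g v"
    by (rule flie_derivation[of g]) (rule that)
  interpret Dt: type_derivation fl_scale fl_bracket Dt by (rule Dt(1))
  have s: "Ds (?g (VX k i)) = ?g (VX (Suc k) i)" "Ds (?g (VZ k i)) = ?g (VZ (Suc k) i)"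
    "Ds (?g VY) = - (\<Sum>i\<in>I. ?br (?g (VX 0 i)) (?g (VZ 0 i)))" for k i
    by (simp_all add: Ds(2) f_def)
  have t: "Dt (?g (VX 0 i)) = ?g (VZ 0 i)"
    "Dt (?g (VZ 0 i)) = - ?g (VX 2 i) - (\<Sum>j\<in>I. ?br (?g (VX 0 j)) (?br (?g (VX 0 j)) (?g (VX 0 i))))"
    "Dt (?g VY) = (\<Sum>i\<in>I. ?br (?g (VX 0 i)) (?g (VX 1 i)))"
    "Dt (?g (VX (Suc k) i)) = ?br (?g VY) (?g (VX k i)) + Ds (Dt (?g (VX k i)))"
    "Dt (?g (VZ (Suc k) i)) = ?br (?g VY) (?g (VZ k i)) + Ds (Dt (?g (VZ k i)))" for k i
    by (simp_all add: Dt(2) g_def gx_def gz_def)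
  have "Dt (Ds u) = ?br (?g VY) u + Ds (Dt u)" for u
  proof (induction u rule: flie_induct)
    case (gen v)
    show ?case
    proof (cases v)
      case VY
      have "Dt (Ds (?g VY)) = (\<Sum>i\<in>I. ?br (?g (VX 0 i)) (?g (VX 2 i)))
          + (\<Sum>i\<in>I. \<Sum>j\<in>I. ?br (?g (VX 0 i)) (?br (?g (VX 0 j)) (?br (?g (VX 0 j)) (?g (VX 0 i)))))"
        by (simp add: s t Dt.D_minus Dt.D_sum Dt.D_br flie.br_diff_right flie.br_minus_right
            flie.br_sum_right sum_subtractf sum_negf)
      also have "\<dots> = (\<Sum>i\<in>I. ?br (?g (VX 0 i)) (?g (VX 2 i)))"
        by (simp add: flie.double_commutator_sum[OF assms])
      also have "\<dots> = ?br (?g VY) (?g VY) + Ds (Dt (?g VY))"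
        by (simp add: s t Ds.D_sum Ds.D_br numeral_2_eq_2)
      finally show ?thesis using VY by simp
    qed (simp_all add: s t)
  next
    case (add u v)
    then show ?case by (simp add: Ds.D_add Dt.D_add flie.br_add_right algebra_simps)
  next
    case (scale c u)
    then show ?case by (simp add: Ds.D_sc Dt.D_sc flie.br_sc_right flie.sc_add)
  next
    case (bracket u v)
    then show ?case
      using flie.br_leibniz[of "?g VY" u v]
      by (simp add: Ds.D_br Dt.D_br Ds.D_add Dt.D_add flie.br_add_left flie.br_add_right algebra_simps)
  qed
  with Ds(1) Dt(1) s t(1-3) show ?thesis by (rule that)
qed

text \<open>
  The Lie algebra extended by an element \<open>d\<close> that acts as \<open>D\<close> can be extended once more by an
  element \<open>e\<close> that acts as \<open>E\<close> and satisfies \<open>[e, d] = y\<close>, provided that the commutator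
  of \<open>E\<close> and \<open>D\<close> is the inner derivation of \<open>y\<close>.
\<close>

lemma (in type_derivation) extension_of_derivation:
  assumes "type_derivation sc br E" and "\<And>u. E (D u) = br y u + D (E u)"
  shows "type_derivation ext_sc ext_br (\<lambda>p. (E (fst p) + sc (snd p) y, 0))"
proof -
  interpret E: type_derivation sc br E by fact
  interpret T: type_lie ext_sc ext_br by (rule type_lie_ext)
  show ?thesis
  proof (unfold_locales, goal_cases)
    case (3 p q)
    obtain u a v b where p: "p = (u, a)" "q = (v, b)" by (cases p, cases q)
    have "br u y = - br y u" by (rule br_skew)
    then show ?case unfolding p
      by (simp add: ext_br_def E.D_add E.D_diff E.D_sc E.D_br assms(2) D_add D_sc sc_add sc_diff sc_sc
          br_add_left br_add_right br_sc_left br_sc_right sc_minus_right mult.commute algebra_simps)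
  qed (auto simp: ext_sc_def E.D_add E.D_sc add_sc sc_add sc_sc algebra_simps)
qed

section \<open>The Yang-Mills algebra\<close>

lemma (in algebra_with_ideal) lie_quot:
  assumes "lie_algebra A"
  shows "lie_algebra (alg_quot A I)"
proof -
  interpret A: lie_algebra A by fact
  note p = lie_homD(2-4)[OF proj_hom, symmetric]
  show ?thesis
    by (intro lie_algebra.intro nonassoc_quot lie_algebra_axioms.intro, unfold proj_carrier[symmetric])
       (auto simp: p A.bracket_self A.jacobi zero_quot[symmetric] simp del: a_coset_add_zero)
qed

lemma finsum_in_subalg:
  assumes "nonassoc_algebra A" "subalg H A" "finite I" "\<And>i. i \<in> I \<Longrightarrow> f i \<in> H"
  shows "finsum A f I \<in> H"
  using assms(3,4)
proof (induction I)
  interpret A: nonassoc_algebra A by fact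
  {
    case empty
    then show ?case using assms(2) by (simp add: subalg_def)
  next
    case (insert i I)
    then have "f i \<in> carrier A" "f \<in> I \<rightarrow> carrier A" using assms(2) by (auto simp: subalg_def)
    then show ?case using insert assms(2) by (simp add: subalg_def)
  }
qed

text \<open>
  Relations are used in this form: if all summands but one lie in a subalgebra, then so does that one.
\<close>

lemma summand_in_subalg:
  assumes "nonassoc_algebra A" "subalg H A" "finite I" "f \<in> I \<rightarrow> carrier A" "finsum A f I = \<zero>\<^bsub>A\<^esub>"
    and "a \<in> I" "\<And>i. i \<in> I - {a} \<Longrightarrow> f i \<in> H"
  shows "f a \<in> H"
proof -
  interpret A: nonassoc_algebra A by fact
  let ?r = "finsum A f (I - {a})"
  have r: "?r \<in> H" by (rule finsum_in_subalg) (use assms in auto)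
  then have rc: "?r \<in> carrier A" using assms(2) by (auto simp: subalg_def)
  have fa: "f a \<in> carrier A" using assms(4,6) by auto
  have "finsum A f (insert a (I - {a})) = f a \<oplus>\<^bsub>A\<^esub> ?r"
    by (rule A.finsum_insert) (use assms in auto)
  moreover have "insert a (I - {a}) = I" using assms(6) by auto
  ultimately have "f a \<oplus>\<^bsub>A\<^esub> ?r = \<zero>\<^bsub>A\<^esub>" using assms(5) by simp
  then have "f a = \<ominus>\<^bsub>A\<^esub> ?r" using A.minus_equality[of "f a" ?r] fa rc by simp
  also have "\<dots> = (- 1) \<odot>\<^bsub>A\<^esub> ?r" using A.scale_minus_one[OF rc] by simp
  also have "\<dots> \<in> H" using r assms(2) by (simp add: subalg_def)
  finally show ?thesis .
qed

lemma ym_relator_eq: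
  "ym_relator n j = (\<Oplus>\<^bsub>free_lie {1..n}\<^esub>i\<in>{1..n}. free_lie_gen {1..n} i \<otimes>\<^bsub>free_lie {1..n}\<^esub>
     (free_lie_gen {1..n} i \<otimes>\<^bsub>free_lie {1..n}\<^esub> free_lie_gen {1..n} j))"
  by (simp add: ym_relator_def Let_def)

lemma free_lie_double_bracket_closed:
  assumes "i \<in> S" "j \<in> S"
  shows "free_lie_gen S i \<otimes>\<^bsub>free_lie S\<^esub> (free_lie_gen S i \<otimes>\<^bsub>free_lie S\<^esub> free_lie_gen S j)
    \<in> carrier (free_lie S)"
  by (intro nonassoc_algebra.mult_closed[OF free_lie_nonassoc] free_lie_gen_closed assms)

lemma lie_hom_double_bracket:
  assumes "nonassoc_algebra A" "h \<in> lie_hom A B" "x \<in> carrier A" "y \<in> carrier A"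
  shows "h (x \<otimes>\<^bsub>A\<^esub> (x \<otimes>\<^bsub>A\<^esub> y)) = h x \<otimes>\<^bsub>B\<^esub> (h x \<otimes>\<^bsub>B\<^esub> h y)"
proof -
  interpret A: nonassoc_algebra A by fact
  show ?thesis using assms by (simp add: lie_homD(3)[OF assms(2)])
qed

lemma ym_relators_subset: "{ym_relator n j | j. j \<in> {1..n}} \<subseteq> carrier (free_lie {1..n} :: ('k::field, _) module)"
proof -
  interpret F: nonassoc_algebra "free_lie {1..n} :: ('k::field, (nat magma \<Rightarrow> 'k) set) module"
    by (rule free_lie_nonassoc)
  have "ym_relator n j \<in> carrier (free_lie {1..n} :: ('k, (nat magma \<Rightarrow> 'k) set) module)"
    if "j \<in> {1..n}" for j
    unfolding ym_relator_eq by (intro F.finsum_closed Pi_I free_lie_double_bracket_closed that)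
  then show ?thesis by blast
qed

lemma ym_with_ideal: "algebra_with_ideal (free_lie {1..n}) (ym_ideal n)"
  unfolding ym_ideal_def
  by (intro algebra_with_ideal.intro algebra_with_ideal_axioms.intro free_lie_nonassoc
      alg_ideal_gen_ideal ym_relators_subset)

lemma ym_lie: "lie_algebra (ym n)"
  unfolding ym_def by (rule algebra_with_ideal.lie_quot[OF ym_with_ideal free_lie_algebra])

abbreviation ym_proj :: "nat \<Rightarrow> (nat magma \<Rightarrow> 'k::field) set \<Rightarrow> (nat magma \<Rightarrow> 'k) set set"
  where "ym_proj n x \<equiv> ym_ideal n +>\<^bsub>free_lie {1..n}\<^esub> x"

definition ym_gen :: "nat \<Rightarrow> nat \<Rightarrow> (nat magma \<Rightarrow> 'k::field) set set"
  where "ym_gen n i = ym_proj n (free_lie_gen {1..n} i)"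

lemma ym_proj_hom: "ym_proj n \<in> lie_hom (free_lie {1..n}) (ym n)"
  unfolding ym_def by (rule algebra_with_ideal.proj_hom[OF ym_with_ideal])

lemma ym_proj_surj: "ym_proj n ` carrier (free_lie {1..n}) = carrier (ym n)"
  unfolding ym_def by (rule algebra_with_ideal.proj_carrier[OF ym_with_ideal])

lemma generates_ym: "generates (ym n) (ym_gen n ` {1..n})"
  using algebra_with_ideal.generates_quot[OF ym_with_ideal generates_free_lie]
  by (simp add: ym_def ym_gen_def[abs_def] image_image)

lemma ym_gen_closed: "i \<in> {1..n} \<Longrightarrow> ym_gen n i \<in> carrier (ym n)"
  by (rule subsetD[OF generates_subset[OF generates_ym] imageI])

lemma ym_relation:
  assumes "j \<in> {1..n}"
  shows "(\<Oplus>\<^bsub>ym n\<^esub>i\<in>{1..n}. ym_gen n i \<otimes>\<^bsub>ym n\<^esub> (ym_gen n i \<otimes>\<^bsub>ym n\<^esub> ym_gen n j))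
    = \<zero>\<^bsub>ym n :: ('k::field, _) module\<^esub>"
proof -
  let ?F = "free_lie {1..n} :: ('k, (nat magma \<Rightarrow> 'k) set) module"
  interpret F: nonassoc_algebra ?F by (rule free_lie_nonassoc)
  have g: "free_lie_gen {1..n} i \<in> carrier ?F" if "i \<in> {1..n}" for i
    using that by (rule free_lie_gen_closed)
  have mem: "ym_relator n j \<in> {ym_relator n j | j. j \<in> {1..n}}" using assms by blast
  have "ym_relator n j \<in> ym_ideal n"
    unfolding ym_ideal_def by (rule subsetD[OF gen_ideal_superset mem])
  moreover have "ym_relator n j \<in> carrier ?F" by (rule subsetD[OF ym_relators_subset mem])
  ultimately have "ym_proj n (ym_relator n j) = \<zero>\<^bsub>ym n :: ('k, _) module\<^esub>"
    using algebra_with_ideal.proj_zero_iff[OF ym_with_ideal] unfolding ym_def by blast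
  moreover have "ym_proj n (ym_relator n j)
      = (\<Oplus>\<^bsub>ym n\<^esub>i\<in>{1..n}. ym_proj n (free_lie_gen {1..n} i \<otimes>\<^bsub>?F\<^esub>
          (free_lie_gen {1..n} i \<otimes>\<^bsub>?F\<^esub> free_lie_gen {1..n} j)))"
    unfolding ym_relator_eq
    by (intro lie_hom_finsum free_lie_nonassoc lie_nonassoc ym_lie ym_proj_hom Pi_I
        free_lie_double_bracket_closed assms finite_atLeastAtMost)
  moreover have "\<dots> = (\<Oplus>\<^bsub>ym n\<^esub>i\<in>{1..n}. ym_gen n i \<otimes>\<^bsub>ym n\<^esub> (ym_gen n i \<otimes>\<^bsub>ym n\<^esub> ym_gen n j))"
  proof -
    interpret Q: lie_algebra "ym n :: ('k, _) module" by (rule ym_lie)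
    show ?thesis
    proof (rule Q.finsum_cong')
      fix i assume "i \<in> {1..n}"
      then show "ym_proj n (free_lie_gen {1..n} i \<otimes>\<^bsub>?F\<^esub> (free_lie_gen {1..n} i \<otimes>\<^bsub>?F\<^esub> free_lie_gen {1..n} j))
          = ym_gen n i \<otimes>\<^bsub>ym n\<^esub> (ym_gen n i \<otimes>\<^bsub>ym n\<^esub> ym_gen n j)"
        unfolding ym_gen_def
        by (intro lie_hom_double_bracket free_lie_nonassoc ym_proj_hom free_lie_gen_closed assms)
    qed (rule refl, intro Pi_I Q.mult_closed ym_gen_closed assms)
  qed
  ultimately show ?thesis by simp
qed

lemma finsum_type_algebra:
  assumes "type_lie sc br" "finite I"
  shows "finsum (type_algebra sc br) f I = sum f I"
  using assms(2)
proof (induction I)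
  interpret T: type_lie sc br by fact
  interpret A: lie_algebra "type_algebra sc br" by (rule T.lie_algebra)
  {
    case empty show ?case by simp
  next
    case (insert i I) then show ?case by (subst A.finsum_insert) auto
  }
qed

lemma ym_universal:
  fixes sc :: "'k::field \<Rightarrow> 'b::ab_group_add \<Rightarrow> 'b"
  assumes "type_lie sc br" "\<And>j. j \<in> {1..n} \<Longrightarrow> (\<Sum>i\<in>{1..n}. br (\<phi> i) (br (\<phi> i) (\<phi> j))) = 0"
  obtains h where "h \<in> lie_hom (ym n) (type_algebra sc br)" "\<And>i. i \<in> {1..n} \<Longrightarrow> h (ym_gen n i) = \<phi> i"
proof -
  interpret T: type_lie sc br by fact
  let ?F = "free_lie {1..n} :: ('k, (nat magma \<Rightarrow> 'k) set) module"
  interpret F: nonassoc_algebra ?F by (rule free_lie_nonassoc)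
  note A = lie_nonassoc[OF T.lie_algebra]
  have g: "free_lie_gen {1..n} i \<in> carrier ?F" if "i \<in> {1..n}" for i
    using that by (rule free_lie_gen_closed)
  obtain g where h: "g \<in> lie_hom ?F (type_algebra sc br)" "\<And>i. i \<in> {1..n} \<Longrightarrow> g (free_lie_gen {1..n} i) = \<phi> i"
    by (rule free_lie_universal[OF T.lie_algebra, of \<phi> "{1..n}"]) (use that in auto)
  have rel: "g (ym_relator n j) = 0" if j: "j \<in> {1..n}" for j
  proof -
    have "g (ym_relator n j) = finsum (type_algebra sc br) (\<lambda>i. g (free_lie_gen {1..n} i \<otimes>\<^bsub>?F\<^esub>
          (free_lie_gen {1..n} i \<otimes>\<^bsub>?F\<^esub> free_lie_gen {1..n} j))) {1..n}"
      unfolding ym_relator_eq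
      by (intro lie_hom_finsum free_lie_nonassoc A h(1) Pi_I free_lie_double_bracket_closed j
          finite_atLeastAtMost)
    also have "\<dots> = (\<Sum>i\<in>{1..n}. br (\<phi> i) (br (\<phi> i) (\<phi> j)))"
      unfolding finsum_type_algebra[OF assms(1) finite_atLeastAtMost]
    proof (rule sum.cong)
      fix i assume i: "i \<in> {1..n}"
      show "g (free_lie_gen {1..n} i \<otimes>\<^bsub>?F\<^esub> (free_lie_gen {1..n} i \<otimes>\<^bsub>?F\<^esub> free_lie_gen {1..n} j))
          = br (\<phi> i) (br (\<phi> i) (\<phi> j))"
        unfolding lie_hom_double_bracket[OF free_lie_nonassoc h(1) free_lie_gen_closed[OF i] free_lie_gen_closed[OF j]]
        by (simp only: h(2)[OF i] h(2)[OF j] type_algebra_simps)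
    qed simp
    finally show ?thesis using assms(2)[OF j] by simp
  qed
  have "g x = \<zero>\<^bsub>type_algebra sc br\<^esub>" if "x \<in> ym_ideal n" for x
    using free_lie_nonassoc A h(1) ym_relators_subset _ that[unfolded ym_ideal_def]
    by (rule gen_ideal_kills) (auto simp: rel)
  from algebra_with_ideal.quot_universal[OF ym_with_ideal A h(1) this]
  obtain k where k: "k \<in> lie_hom (ym n) (type_algebra sc br)" "\<And>x. x \<in> carrier ?F \<Longrightarrow> k (ym_proj n x) = g x"
    unfolding ym_def by metis
  show ?thesis
    by (rule that[OF k(1)]) (simp only: ym_gen_def k(2)[OF g] h(2))
qed


section \<open>The characters of the Yang-Mills algebra\<close>

abbreviation line :: "('k::field, 'k) module"
  where "line \<equiv> type_algebra (*) (\<lambda>_ _. 0)"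

lemma type_lie_line: "type_lie ((*) :: 'k::field \<Rightarrow> _) (\<lambda>_ _. 0)"
  by unfold_locales (simp_all add: algebra_simps)

text \<open>
  The coordinate characters: \<open>ym_char n i\<close> is the Lie homomorphism to the field, regarded as an abelian
  Lie algebra, that sends \<open>x\<^sub>i\<close> to 1 and the other generators to 0. It exists because the relations
  are sums of brackets.
\<close>

definition ym_char :: "nat \<Rightarrow> nat \<Rightarrow> (nat magma \<Rightarrow> 'k::field) set set \<Rightarrow> 'k"
  where "ym_char n i = (SOME h. h \<in> lie_hom (ym n) line \<and> (\<forall>j\<in>{1..n}. h (ym_gen n j) = (if i = j then 1 else 0)))"

lemma ym_char:
  shows "ym_char n i \<in> lie_hom (ym n) (line :: ('k::field, 'k) module)"
    and "\<And>j. j \<in> {1..n} \<Longrightarrow> ym_char n i (ym_gen n j) = (if i = j then 1 else 0 :: 'k)"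
proof -
  obtain h :: "_ \<Rightarrow> 'k" where "h \<in> lie_hom (ym n) line"
      "\<And>j. j \<in> {1..n} \<Longrightarrow> h (ym_gen n j) = (if i = j then 1 else 0)"
    by (rule ym_universal[OF type_lie_line, of n "\<lambda>j. if i = j then 1 else 0"]) (use that in auto)
  then have "\<exists>h::_ \<Rightarrow> 'k. h \<in> lie_hom (ym n) line \<and> (\<forall>j\<in>{1..n}. h (ym_gen n j) = (if i = j then 1 else 0))"
    by blast
  from someI_ex[OF this]
  show "ym_char n i \<in> lie_hom (ym n) (line :: ('k, 'k) module)"
    "\<And>j. j \<in> {1..n} \<Longrightarrow> ym_char n i (ym_gen n j) = (if i = j then 1 else 0 :: 'k)"
    unfolding ym_char_def by blast+
qed

lemmas ym_char_hom = lie_homD(2-4)[OF ym_char(1), simplified]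

text \<open>
  These subalgebras interpolate between the Yang-Mills algebra, for \<open>i = 0\<close>, and its part of degree
  at least 2, for \<open>i = n\<close>. Passing from \<open>i\<close> to \<open>i + 1\<close> eliminates one generator.
\<close>

definition ym_kernel :: "nat \<Rightarrow> nat \<Rightarrow> (nat magma \<Rightarrow> 'k::field) set set set"
  where "ym_kernel n i = {y \<in> carrier (ym n). \<forall>j\<in>{1..i}. ym_char n j y = 0}"

lemma ym_kernel_mono: "i \<le> j \<Longrightarrow> ym_kernel n j \<subseteq> ym_kernel n i"
  by (auto simp: ym_kernel_def)

lemma ym_nonassoc: "nonassoc_algebra (ym n)"
  by (rule lie_nonassoc[OF ym_lie])

lemma bracket_in_ym_kernel:
  "x \<in> carrier (ym n) \<Longrightarrow> y \<in> carrier (ym n) \<Longrightarrow> x \<otimes>\<^bsub>ym n\<^esub> y \<in> ym_kernel n i"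
  by (simp add: ym_kernel_def ym_char_hom nonassoc_algebra.mult_closed[OF ym_nonassoc])

lemma ym_char_zero: "ym_char n i \<zero>\<^bsub>ym n\<^esub> = 0"
  using lie_hom_zero[OF ym_nonassoc lie_nonassoc[OF type_lie.lie_algebra[OF type_lie_line]] ym_char(1), of n i]
  by simp

lemma subalg_ym_kernel: "subalg (ym_kernel n i) (ym n :: ('k::field, _) module)"
proof -
  interpret nonassoc_algebra "ym n :: ('k, _) module" by (rule ym_nonassoc)
  show ?thesis by (auto simp: subalg_def ym_kernel_def ym_char_hom ym_char_zero)
qed

lemma ym_gen_in_ym_kernel: "j \<in> {1..n} \<Longrightarrow> ym_gen n j \<in> ym_kernel n i \<longleftrightarrow> i < j"
  by (auto simp: ym_kernel_def ym_char(2) ym_gen_closed)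

abbreviation ym_rep :: "nat \<Rightarrow> (nat magma \<Rightarrow> 'k::field) \<Rightarrow> (nat magma \<Rightarrow> 'k) set set"
  where "ym_rep n f \<equiv> ym_proj n (free_lie_proj {1..n} f)"

lemma ym_rep_hom: "ym_rep n \<in> lie_hom (free_nonassoc {1..n} :: ('k::field, _) module) (ym n)"
  using lie_hom_comp[OF free_lie_proj_hom ym_proj_hom] by (simp add: comp_def)

lemma ym_rep_surj: "ym_rep n ` carrier (free_nonassoc {1..n}) = carrier (ym n)"
  using ym_proj_surj[of n] unfolding free_lie_proj_surj[symmetric] by (simp add: image_image)

lemma ym_component_eq:
  "ym_component n j = ym_rep n ` {f \<in> carrier (free_nonassoc {1..n}). \<forall>w. f w \<noteq> 0 \<longrightarrow> magma_deg w = j}"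
  unfolding ym_component_def free_lie_component_def by blast

lemma magma_deg_pos: "magma_deg w > 0"
  by (induction w) auto

text \<open>
  A monomial of degree at least 2 is a product, and the characters vanish on products.
\<close>

lemma ym_char_high_degree:
  fixes f :: "nat magma \<Rightarrow> 'k::field"
  assumes "f \<in> carrier (free_nonassoc {1..n})" "\<And>w. f w \<noteq> 0 \<Longrightarrow> magma_deg w \<ge> 2"
  shows "ym_char n i (ym_rep n f) = 0"
proof -
  let ?N = "free_nonassoc {1..n} :: ('k, _) module"
  let ?V = "{w. set_magma w \<subseteq> {1..n}}"
  let ?W = "{w. set_magma w \<subseteq> {1..n} \<and> magma_deg w \<ge> 2}"
  have hom: "(\<lambda>f. ym_char n i (ym_rep n f)) \<in> lie_hom ?N line"
    using lie_hom_comp[OF ym_rep_hom ym_char(1)] by (simp add: comp_def)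
  note h = lie_homD(2-4)[OF hom, simplified type_algebra_simps]
  have W: "finsupp ?W \<subseteq> carrier ?N" by (auto simp: carrier_free_nonassoc finsupp_def)
  have f: "f \<in> finsupp ?W" using assms by (auto simp: carrier_free_nonassoc finsupp_def)
  then show ?thesis
  proof (induction f rule: finsupp_induct)
    case zero
    show ?case using h(3)[of "\<lambda>w. 0" 0] finsupp_zero[of ?V] by (simp add: carrier_free_nonassoc free_nonassoc_simps)
  next
    case (add f g)
    then show ?case using h(1)[of f g] W by (auto simp: free_nonassoc_simps)
  next
    case (scale c f)
    then show ?case using h(3)[of f c] W by (auto simp: free_nonassoc_simps)
  next
    case (monomial w)
    then obtain u v where w: "w = Prod u v" by (cases w) auto
    have "monomial u \<in> carrier ?N" "monomial v \<in> carrier ?N"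
      using monomial w by (auto simp: carrier_free_nonassoc intro!: finsupp_monomial)
    then show ?case using h(2) unfolding w monomial_Prod[of u v "{1..n}"] by blast
  qed
qed

lemma subset_lin_span: "S \<subseteq> lin_span A S"
  by (auto simp: lin_span_def)

lemma lin_span_closed:
  assumes "nonassoc_algebra A"
  shows "x \<in> lin_span A S \<Longrightarrow> y \<in> lin_span A S \<Longrightarrow> x \<oplus>\<^bsub>A\<^esub> y \<in> lin_span A S"
    and "x \<in> lin_span A S \<Longrightarrow> c \<odot>\<^bsub>A\<^esub> x \<in> lin_span A S"
    and "\<zero>\<^bsub>A\<^esub> \<in> lin_span A S"
  by (auto simp: lin_span_def submodule_iff[OF assms])

text \<open>
  The components of degree at least 2 lie in the kernel by \<open>ym_char_high_degree\<close>. Conversely, every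
  element \<open>y\<close> is congruent to \<open>r y\<close> modulo their span, where \<open>r y\<close> is
  \<open>\<Sum>\<^sub>i \<chi>\<^sub>i(y) x\<^sub>i\<close> for the coordinate characters \<open>\<chi>\<^sub>i\<close>; this is linear in \<open>y\<close> and clear on
  monomials. If all characters vanish on \<open>y\<close>, then \<open>r y = 0\<close>.
\<close>

lemma ym_component_span:
  "lin_span (ym n) (\<Union>j\<in>{2..}. ym_component n j) = (ym_kernel n n :: (nat magma \<Rightarrow> 'k::field) set set set)"
proof
  let ?Y = "ym n :: ('k, _) module"
  let ?N = "free_nonassoc {1..n} :: ('k, _) module"
  let ?T = "lin_span ?Y (\<Union>j\<in>{2..}. ym_component n j)"
  interpret Y: lie_algebra ?Y by (rule ym_lie)
  have rep: "ym_rep n f \<in> carrier ?Y" if "f \<in> carrier ?N" for f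
    using lie_homD(1)[OF ym_rep_hom that] .
  have "submodule (ym_kernel n n) ring_of_type_algebra ?Y"
    using subalg_ym_kernel[of n n, where ?'k = 'k] by (simp add: submodule_iff[OF ym_nonassoc] subalg_def)
  moreover have "(\<Union>j\<in>{2..}. ym_component n j) \<subseteq> (ym_kernel n n :: (nat magma \<Rightarrow> 'k) set set set)"
  proof
    fix y :: "(nat magma \<Rightarrow> 'k) set set"
    assume "y \<in> (\<Union>j\<in>{2..}. ym_component n j)"
    then obtain f j where "j \<ge> 2" "f \<in> carrier ?N" "\<forall>w. f w \<noteq> 0 \<longrightarrow> magma_deg w = j" "y = ym_rep n f"
      unfolding ym_component_eq by auto
    then show "y \<in> ym_kernel n n"
      using ym_char_high_degree[of f n] rep by (auto simp: ym_kernel_def)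
  qed
  ultimately show "?T \<subseteq> ym_kernel n n" unfolding lin_span_def by blast
  have T: "?T \<subseteq> carrier ?Y"
    using \<open>?T \<subseteq> ym_kernel n n\<close> by (auto simp: ym_kernel_def)
  define r where "r y = (\<Oplus>\<^bsub>?Y\<^esub>i\<in>{1..n}. ym_char n i y \<odot>\<^bsub>?Y\<^esub> ym_gen n i)" for y
  have term_closed: "c \<odot>\<^bsub>?Y\<^esub> ym_gen n i \<in> carrier ?Y" if "i \<in> {1..n}" for c i
    by (intro Y.scale_closed ym_gen_closed that)
  have rc: "r y \<in> carrier ?Y" for y unfolding r_def by (intro Y.finsum_closed Pi_I term_closed)
  have r_add: "r (y \<oplus>\<^bsub>?Y\<^esub> z) = r y \<oplus>\<^bsub>?Y\<^esub> r z" if "y \<in> carrier ?Y" "z \<in> carrier ?Y" for y z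
  proof -
    have "r (y \<oplus>\<^bsub>?Y\<^esub> z) = (\<Oplus>\<^bsub>?Y\<^esub>i\<in>{1..n}. ym_char n i y \<odot>\<^bsub>?Y\<^esub> ym_gen n i \<oplus>\<^bsub>?Y\<^esub> ym_char n i z \<odot>\<^bsub>?Y\<^esub> ym_gen n i)"
      unfolding r_def
    proof (rule Y.finsum_cong')
      fix i assume i: "i \<in> {1..n}"
      show "ym_char n i (y \<oplus>\<^bsub>?Y\<^esub> z) \<odot>\<^bsub>?Y\<^esub> ym_gen n i
          = ym_char n i y \<odot>\<^bsub>?Y\<^esub> ym_gen n i \<oplus>\<^bsub>?Y\<^esub> ym_char n i z \<odot>\<^bsub>?Y\<^esub> ym_gen n i"
        using that by (simp only: ym_char_hom Y.add_scale[OF ym_gen_closed[OF i]])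
    qed (rule refl, intro Pi_I Y.a_closed term_closed)
    also have "\<dots> = r y \<oplus>\<^bsub>?Y\<^esub> r z"
      unfolding r_def by (intro Y.finsum_addf Pi_I term_closed)
    finally show ?thesis .
  qed
  have r_scale: "r (c \<odot>\<^bsub>?Y\<^esub> y) = c \<odot>\<^bsub>?Y\<^esub> r y" if "y \<in> carrier ?Y" for y c
  proof -
    have "r (c \<odot>\<^bsub>?Y\<^esub> y) = (\<Oplus>\<^bsub>?Y\<^esub>i\<in>{1..n}. c \<odot>\<^bsub>?Y\<^esub> (ym_char n i y \<odot>\<^bsub>?Y\<^esub> ym_gen n i))"
      unfolding r_def
    proof (rule Y.finsum_cong')
      fix i assume i: "i \<in> {1..n}"
      show "ym_char n i (c \<odot>\<^bsub>?Y\<^esub> y) \<odot>\<^bsub>?Y\<^esub> ym_gen n i = c \<odot>\<^bsub>?Y\<^esub> (ym_char n i y \<odot>\<^bsub>?Y\<^esub> ym_gen n i)"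
        using that by (simp only: ym_char_hom Y.scale_scale[OF ym_gen_closed[OF i]])
    qed (rule refl, intro Pi_I Y.scale_closed term_closed)
    also have "\<dots> = c \<odot>\<^bsub>?Y\<^esub> r y"
      unfolding r_def by (intro Y.finsum_smult_ldistr[symmetric] Pi_I term_closed) simp_all
    finally show ?thesis .
  qed
  have sum_case: "\<exists>t\<in>?T. t \<oplus>\<^bsub>?Y\<^esub> r (y \<oplus>\<^bsub>?Y\<^esub> z) = y \<oplus>\<^bsub>?Y\<^esub> z"
    if "y \<in> carrier ?Y" "z \<in> carrier ?Y" and s: "s \<in> ?T" "s \<oplus>\<^bsub>?Y\<^esub> r y = y"
      and t: "t \<in> ?T" "t \<oplus>\<^bsub>?Y\<^esub> r z = z" for y z s t
  proof -
    have "(s \<oplus>\<^bsub>?Y\<^esub> t) \<oplus>\<^bsub>?Y\<^esub> (r y \<oplus>\<^bsub>?Y\<^esub> r z) = (s \<oplus>\<^bsub>?Y\<^esub> r y) \<oplus>\<^bsub>?Y\<^esub> (t \<oplus>\<^bsub>?Y\<^esub> r z)"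
      using subsetD[OF T s(1)] subsetD[OF T t(1)] rc[of y] rc[of z] by (simp add: Y.a_ac)
    then have "(s \<oplus>\<^bsub>?Y\<^esub> t) \<oplus>\<^bsub>?Y\<^esub> r (y \<oplus>\<^bsub>?Y\<^esub> z) = y \<oplus>\<^bsub>?Y\<^esub> z"
      by (simp only: r_add[OF that(1,2)] s(2) t(2))
    then show ?thesis using lin_span_closed(1)[OF ym_nonassoc s(1) t(1)] by (rule bexI)
  qed
  have scale_case: "\<exists>t\<in>?T. t \<oplus>\<^bsub>?Y\<^esub> r (c \<odot>\<^bsub>?Y\<^esub> y) = c \<odot>\<^bsub>?Y\<^esub> y"
    if "y \<in> carrier ?Y" and t: "t \<in> ?T" "t \<oplus>\<^bsub>?Y\<^esub> r y = y" for y t c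
  proof -
    have "c \<odot>\<^bsub>?Y\<^esub> t \<oplus>\<^bsub>?Y\<^esub> c \<odot>\<^bsub>?Y\<^esub> r y = c \<odot>\<^bsub>?Y\<^esub> (t \<oplus>\<^bsub>?Y\<^esub> r y)"
      by (rule Y.scale_add[OF subsetD[OF T t(1)] rc, symmetric])
    then have "c \<odot>\<^bsub>?Y\<^esub> t \<oplus>\<^bsub>?Y\<^esub> r (c \<odot>\<^bsub>?Y\<^esub> y) = c \<odot>\<^bsub>?Y\<^esub> y"
      by (simp only: r_scale[OF that(1)] t(2))
    then show ?thesis using lin_span_closed(2)[OF ym_nonassoc t(1)] by (rule bexI)
  qed
  have split: "\<exists>t\<in>?T. t \<oplus>\<^bsub>?Y\<^esub> r y = y" if y: "y \<in> carrier ?Y" for y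
  proof -
    obtain f where f: "f \<in> carrier ?N" "y = ym_rep n f" using y unfolding ym_rep_surj[symmetric] by blast
    let ?V = "{w. set_magma w \<subseteq> {1..n}}"
    have "\<exists>t\<in>?T. t \<oplus>\<^bsub>?Y\<^esub> r (ym_rep n f) = ym_rep n f"
      using f(1) unfolding carrier_free_nonassoc
    proof (induction f rule: finsupp_induct)
      case zero
      have z: "ym_rep n (\<lambda>w. 0) = \<zero>\<^bsub>?Y\<^esub>"
        using lie_hom_zero[OF free_nonassoc_algebra ym_nonassoc ym_rep_hom[of n, where ?'k = 'k]]
        by (simp only: free_nonassoc_simps)
      have "r \<zero>\<^bsub>?Y\<^esub> = \<zero>\<^bsub>?Y\<^esub>"
        using r_scale[of "\<zero>\<^bsub>?Y\<^esub>" 0] rc by simp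
      then show ?case unfolding z using lin_span_closed(3)[OF ym_nonassoc]
        by (intro bexI[of _ "\<zero>\<^bsub>?Y\<^esub>"]) auto
    next
      case (add f g)
      then obtain s t where st: "s \<in> ?T" "s \<oplus>\<^bsub>?Y\<^esub> r (ym_rep n f) = ym_rep n f"
        "t \<in> ?T" "t \<oplus>\<^bsub>?Y\<^esub> r (ym_rep n g) = ym_rep n g" by blast
      have fg: "f \<in> carrier ?N" "g \<in> carrier ?N" using add by (simp_all only: carrier_free_nonassoc)
      have "ym_rep n (\<lambda>w. f w + g w) = ym_rep n f \<oplus>\<^bsub>?Y\<^esub> ym_rep n g"
        using lie_homD(2)[OF ym_rep_hom fg] by (simp only: free_nonassoc_simps)
      then show ?case using sum_case[OF rep[OF fg(1)] rep[OF fg(2)] st] by (simp only:)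
    next
      case (scale c f)
      then obtain t where t: "t \<in> ?T" "t \<oplus>\<^bsub>?Y\<^esub> r (ym_rep n f) = ym_rep n f" by blast
      have f: "f \<in> carrier ?N" using scale by (simp only: carrier_free_nonassoc)
      have "ym_rep n (\<lambda>w. c * f w) = c \<odot>\<^bsub>?Y\<^esub> ym_rep n f"
        using lie_homD(4)[OF ym_rep_hom f] by (simp only: free_nonassoc_simps)
      then show ?case using scale_case[OF rep[OF f] t] by (simp only:)
    next
      case (monomial w)
      show ?case
      proof (cases w)
        case (Gen i)
        then have i: "i \<in> {1..n}" using monomial by simp
        have w: "ym_rep n (monomial w) = ym_gen n i"
          by (simp only: Gen ym_gen_def free_lie_gen_def)
        have gi: "ym_gen n i \<in> carrier ?Y" by (rule ym_gen_closed[OF i])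
        have "r (ym_gen n i) = (\<Oplus>\<^bsub>?Y\<^esub>j\<in>{1..n}. if i = j then ym_gen n j else \<zero>\<^bsub>?Y\<^esub>)"
          unfolding r_def
        proof (rule Y.finsum_cong')
          fix j assume j: "j \<in> {1..n}"
          have "ym_gen n j \<in> carrier ?Y" by (rule ym_gen_closed[OF j])
          then show "ym_char n j (ym_gen n i) \<odot>\<^bsub>?Y\<^esub> ym_gen n j = (if i = j then ym_gen n j else \<zero>\<^bsub>?Y\<^esub>)"
            using ym_char(2)[OF i, of j, where ?'k = 'k] by simp
        qed (auto simp: ym_gen_closed)
        also have "\<dots> = ym_gen n i"
          by (rule Y.finsum_singleton[OF i]) (auto simp: ym_gen_closed)
        finally have "\<zero>\<^bsub>?Y\<^esub> \<oplus>\<^bsub>?Y\<^esub> r (ym_gen n i) = ym_gen n i" using gi by simp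
        then show ?thesis unfolding w using lin_span_closed(3)[OF ym_nonassoc] by (rule bexI)
      next
        case (Prod u v)
        have m: "(monomial w :: _ \<Rightarrow> 'k) \<in> carrier ?N"
          using monomial by (auto simp: carrier_free_nonassoc intro!: finsupp_monomial)
        have deg: "magma_deg w \<ge> 2" using magma_deg_pos[of u] magma_deg_pos[of v] by (simp add: Prod)
        have supp: "magma_deg w' = magma_deg w" if "(monomial w :: _ \<Rightarrow> 'k) w' \<noteq> 0" for w'
          using that by (auto simp: monomial_def split: if_splits)
        have "ym_rep n (monomial w) \<in> (ym_component n (magma_deg w) :: (nat magma \<Rightarrow> 'k) set set set)"
          unfolding ym_component_eq using m supp by blast
        then have "ym_rep n (monomial w) \<in> (\<Union>j\<in>{2..}. ym_component n j :: (nat magma \<Rightarrow> 'k) set set set)"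
          using deg by (intro UN_I[of "magma_deg w"]) simp_all
        then have t: "ym_rep n (monomial w) \<in> ?T" by (rule subsetD[OF subset_lin_span])
        then have tc: "ym_rep n (monomial w) \<in> carrier ?Y" using T by blast
        have "ym_char n i (ym_rep n (monomial w)) = (0 :: 'k)" for i
          by (rule ym_char_high_degree[OF m]) (use supp deg in simp)
        then have "r (ym_rep n (monomial w)) = (\<Oplus>\<^bsub>?Y\<^esub>j\<in>{1..n}. \<zero>\<^bsub>?Y\<^esub>)"
          unfolding r_def by (intro Y.finsum_cong') (auto simp: ym_gen_closed)
        then show ?thesis using t tc by (intro bexI[OF _ t]) simp
      qed
    qed
    then show ?thesis using f(2) by simp
  qed
  show "ym_kernel n n \<subseteq> ?T"
  proof
    fix y :: "(nat magma \<Rightarrow> 'k) set set"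
    assume y: "y \<in> ym_kernel n n"
    then have yc: "y \<in> carrier ?Y" and 0: "\<And>i. i \<in> {1..n} \<Longrightarrow> ym_char n i y = 0"
      by (simp_all add: ym_kernel_def)
    have "r y = (\<Oplus>\<^bsub>?Y\<^esub>j\<in>{1..n}. \<zero>\<^bsub>?Y\<^esub>)"
      unfolding r_def by (intro Y.finsum_cong') (auto simp: ym_gen_closed 0)
    then have "r y = \<zero>\<^bsub>?Y\<^esub>" by simp
    moreover obtain t where t: "t \<in> ?T" "t \<oplus>\<^bsub>?Y\<^esub> r y = y" using split[OF yc] by (rule bexE)
    ultimately have "y = t" using subsetD[OF T t(1)] by simp
    then show "y \<in> ?T" using t(1) by (simp only:)
  qed
qed

lemma tym_eq: "tym n = (ym n)\<lparr>carrier := ym_kernel n n\<rparr>"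
  by (simp add: tym_def ym_component_span)


section \<open>Eliminating the first two generators\<close>

lemma ym_interval_split: "2 \<le> n \<Longrightarrow> {1..n} = insert 1 (insert 2 {3..n})" for n :: nat
  by auto

lemma ad_funpow_Suc: "(ad L x ^^ Suc k) u = x \<otimes>\<^bsub>L\<^esub> (ad L x ^^ k) u"
  by (simp add: ad_def)

text \<open>
  The argument is that of \<open>lazard_elimination\<close>, carried out for \<open>s = x\<^sub>2\<close> and \<open>t = x\<^sub>1\<close> at
  once. Let \<open>H\<close> be the subalgebra generated by the asserted basis. The Yang-Mills relations make
  \<open>H\<close> stable under \<open>ad(s)\<close> and \<open>ad(t)\<close>, hence \<open>H\<close>, \<open>s\<close> and \<open>t\<close> span
  everything, and \<open>H\<close> is the common kernel. In the opposite direction, the free Lie algebra on \<open>ym_var\<close>, extended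
  by \<open>Ds\<close> and then by \<open>Dt\<close>, satisfies the Yang-Mills relations and therefore receives a
  homomorphism from the Yang-Mills algebra. The two inclusions about the basis
  describe its position with respect to the remaining generators.
\<close>

lemma ym_kernel_2_free:
  fixes n :: nat
  assumes n: "n \<ge> 2"
  shows "\<exists>B. free_on ((ym n :: ('k::field, _) module)\<lparr>carrier := ym_kernel n 2\<rparr>) B \<and>
    ym_gen n ` {3..n} \<subseteq> B \<and> B \<subseteq> ym_gen n ` {3..n} \<union> ym_kernel n n"
proof -
  let ?Y = "ym n :: ('k, _) module"
  interpret Y: lie_algebra ?Y by (rule ym_lie)
  define x where "x i = (ym_gen n i :: (nat magma \<Rightarrow> 'k) set set)" for i
  have x: "x i \<in> carrier ?Y" if "i \<in> {1..n}" for i unfolding x_def by (rule ym_gen_closed[OF that])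
  have x1: "x 1 \<in> carrier ?Y" and x2: "x 2 \<in> carrier ?Y" using n by (auto intro: x)
  have xi: "x i \<in> carrier ?Y" if "i \<in> {3..n}" for i using that by (intro x) auto
  let ?ad = "\<lambda>k u. (ad ?Y (x 2) ^^ k) u"
  define b where "b v = (case v of VY \<Rightarrow> x 1 \<otimes>\<^bsub>?Y\<^esub> x 2 | VX k i \<Rightarrow> ?ad k (x i)
      | VZ k i \<Rightarrow> ?ad k (x 1 \<otimes>\<^bsub>?Y\<^esub> x i))" for v
  define J where "J = insert VY ({VX k i | k i. i \<in> {3..n}} \<union> {VZ k i | k i. i \<in> {3..n}})"
  have b_simps: "b VY = x 1 \<otimes>\<^bsub>?Y\<^esub> x 2" "b (VX 0 i) = x i" "b (VZ 0 i) = x 1 \<otimes>\<^bsub>?Y\<^esub> x i"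
    "b (VX (Suc k) i) = x 2 \<otimes>\<^bsub>?Y\<^esub> b (VX k i)" "b (VZ (Suc k) i) = x 2 \<otimes>\<^bsub>?Y\<^esub> b (VZ k i)" for k i
    by (simp_all add: b_def ad_def)
  have bX: "b (VX k i) \<in> carrier ?Y" and bZ: "b (VZ k i) \<in> carrier ?Y" if "i \<in> {3..n}" for k i
    by (induction k) (use xi[OF that] x1 x2 in \<open>simp_all add: b_simps\<close>)
  have bY: "b VY \<in> carrier ?Y" using x1 x2 by (simp add: b_simps)
  let ?S = "b ` J"
  have S: "?S \<subseteq> carrier ?Y" using bX bZ bY unfolding J_def by blast
  let ?M = "ym_kernel n 2 :: (nat magma \<Rightarrow> 'k) set set set"
  have M: "subalg ?M ?Y" by (rule subalg_ym_kernel)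
  have ker: "ym_kernel n n \<subseteq> ?M" by (rule ym_kernel_mono[OF n])
  have b_ker: "b (VX k i) \<in> ym_gen n ` {3..n} \<union> ym_kernel n n" "b (VZ k i) \<in> ym_kernel n n"
    if i: "i \<in> {3..n}" for k i
  proof -
    show "b (VX k i) \<in> ym_gen n ` {3..n} \<union> ym_kernel n n"
    proof (cases k)
      case 0
      then show ?thesis using i by (simp add: b_simps x_def)
    next
      case (Suc l)
      then show ?thesis using bracket_in_ym_kernel[OF x2 bX[OF i]] by (simp add: b_simps)
    qed
    show "b (VZ k i) \<in> ym_kernel n n"
    proof (cases k)
      case 0
      then show ?thesis using bracket_in_ym_kernel[OF x1 xi[OF i]] by (simp add: b_simps)
    next
      case (Suc l)
      then show ?thesis using bracket_in_ym_kernel[OF x2 bZ[OF i]] by (simp add: b_simps)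
    qed
  qed
  have S_sub: "?S \<subseteq> ym_gen n ` {3..n} \<union> ym_kernel n n"
    using b_ker bracket_in_ym_kernel[OF x1 x2] unfolding J_def by (auto simp: b_simps)
  have "ym_gen n ` {3..n} \<subseteq> ?M"
    by (rule image_subsetI) (simp add: ym_gen_in_ym_kernel)
  then have SM: "?S \<subseteq> ?M" using ker by (intro subset_trans[OF S_sub] Un_least)
  have gens: "ym_gen n ` {3..n} \<subseteq> ?S"
  proof
    fix y :: "(nat magma \<Rightarrow> 'k) set set" assume "y \<in> ym_gen n ` {3..n}"
    then obtain i where i: "i \<in> {3..n}" "y = ym_gen n i" by (rule imageE)
    have "VX 0 i \<in> J" unfolding J_def using i(1) by blast
    moreover have "y = b (VX 0 i)" by (simp only: i(2) b_simps x_def)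
    ultimately show "y \<in> ?S" by (rule rev_image_eqI)
  qed

  \<comment> \<open>Generation: \<open>?H\<close> is stable under both eliminated elements.\<close>
  let ?H = "lie_span ?Y ?S"
  have H: "subalg ?H ?Y" by (rule subalg_lie_span[OF ym_nonassoc S])
  have HM: "?H \<subseteq> ?M" by (rule lie_span_least[OF M SM])
  have Hc: "u \<in> carrier ?Y" if "u \<in> ?H" for u using that H by (auto simp: subalg_def)
  have H_add: "u \<oplus>\<^bsub>?Y\<^esub> v \<in> ?H" and H_mult: "u \<otimes>\<^bsub>?Y\<^esub> v \<in> ?H" if "u \<in> ?H" "v \<in> ?H" for u v
    using H that by (simp_all add: subalg_def)
  have H_neg: "\<ominus>\<^bsub>?Y\<^esub> u \<in> ?H" if "u \<in> ?H" for u
  proof -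
    have "(- 1) \<odot>\<^bsub>?Y\<^esub> u \<in> ?H" using H that by (simp add: subalg_def)
    then show ?thesis using Y.scale_minus_one[OF Hc[OF that]] by simp
  qed
  have H_zero: "\<zero>\<^bsub>?Y\<^esub> \<in> ?H" using H by (simp add: subalg_def)
  have J: "VY \<in> J" "\<And>k i. i \<in> {3..n} \<Longrightarrow> VX k i \<in> J" "\<And>k i. i \<in> {3..n} \<Longrightarrow> VZ k i \<in> J"
    unfolding J_def by blast+
  have bH: "b v \<in> ?H" if "v \<in> J" for v
    by (rule subsetD[OF lie_span_superset imageI[OF that]])
  have HX: "b (VX k i) \<in> ?H" and HZ: "b (VZ k i) \<in> ?H" if "i \<in> {3..n}" for k i
    using bH J that by auto
  have HY: "b VY \<in> ?H" using bH J by auto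
  have xH: "x i \<in> ?H" if "i \<in> {3..n}" for i using HX[OF that, of 0] by (simp add: b_simps)
  have skew_H: "v \<otimes>\<^bsub>?Y\<^esub> u \<in> ?H" if "u \<otimes>\<^bsub>?Y\<^esub> v \<in> ?H" "u \<in> carrier ?Y" "v \<in> carrier ?Y" for u v
    using H_neg[OF that(1)] Y.skew[OF that(2,3)] by simp
  let ?f = "\<lambda>j i. x i \<otimes>\<^bsub>?Y\<^esub> (x i \<otimes>\<^bsub>?Y\<^esub> x j)"
  have relation_H: "?f j a \<in> ?H" if "j \<in> {1..n}" "a \<in> {1..n}" "\<And>i. i \<in> {1..n} - {a} \<Longrightarrow> ?f j i \<in> ?H" for j a
  proof (rule summand_in_subalg[OF ym_nonassoc H finite_atLeastAtMost _ _ that(2,3)])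
    show "?f j \<in> {1..n} \<rightarrow> carrier ?Y" by (intro Pi_I Y.mult_closed x that(1))
    show "finsum ?Y (?f j) {1..n} = \<zero>\<^bsub>?Y\<^esub>" unfolding x_def by (rule ym_relation[OF that(1)])
  qed

  have x1_bracket: "x i \<otimes>\<^bsub>?Y\<^esub> (x i \<otimes>\<^bsub>?Y\<^esub> x 1) \<in> ?H" if "i \<in> {3..n}" for i
    using HZ[OF that, of 0] by (intro H_mult[OF xH[OF that] skew_H[OF _ x1 xi[OF that]]]) (simp add: b_simps)
  have x2_bracket: "x i \<otimes>\<^bsub>?Y\<^esub> (x i \<otimes>\<^bsub>?Y\<^esub> x 2) \<in> ?H" if "i \<in> {3..n}" for i
    using HX[OF that, of "Suc 0"] by (intro H_mult[OF xH[OF that] skew_H[OF _ x2 xi[OF that]]]) (simp add: b_simps)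
  have stable2: "x 2 \<otimes>\<^bsub>?Y\<^esub> u \<in> ?H" if "u \<in> ?H" for u
    using ym_lie S x2 _ that
  proof (rule lie_span_ad_stable)
    fix s assume "s \<in> ?S"
    then obtain v where v: "v \<in> J" "s = b v" by blast
    show "x 2 \<otimes>\<^bsub>?Y\<^esub> s \<in> ?H"
    proof (cases v)
      case VY
      \<comment> \<open>The relation with index 1 expresses \<open>[x\<^sub>2, [x\<^sub>2, x\<^sub>1]]\<close>.\<close>
      have "?f 1 2 \<in> ?H"
      proof (rule relation_H)
        fix i assume "i \<in> {1..n} - {2}"
        then have "i = 1 \<or> i \<in> {3..n}" by auto
        then show "?f 1 i \<in> ?H" using x1_bracket x1 H_zero by (auto simp: Y.bracket_self)
      qed (use n in auto)
      moreover have "x 2 \<otimes>\<^bsub>?Y\<^esub> x 1 = \<ominus>\<^bsub>?Y\<^esub> (x 1 \<otimes>\<^bsub>?Y\<^esub> x 2)" by (rule Y.skew[OF x1 x2])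
      ultimately have "\<ominus>\<^bsub>?Y\<^esub> (x 2 \<otimes>\<^bsub>?Y\<^esub> (x 1 \<otimes>\<^bsub>?Y\<^esub> x 2)) \<in> ?H"
        using x1 x2 by (simp add: Y.mult_minus_right)
      from H_neg[OF this] show ?thesis using x1 x2 by (simp add: v(2) VY b_simps)
    next
      case (VX k i)
      then have "i \<in> {3..n}" using v(1) by (auto simp: J_def)
      then show ?thesis using HX[of i "Suc k"] by (simp add: v(2) VX b_simps)
    next
      case (VZ k i)
      then have "i \<in> {3..n}" using v(1) by (auto simp: J_def)
      then show ?thesis using HZ[of i "Suc k"] by (simp add: v(2) VZ b_simps)
    qed
  qed
  have step: "x 1 \<otimes>\<^bsub>?Y\<^esub> (x 2 \<otimes>\<^bsub>?Y\<^esub> u) \<in> ?H" if "u \<in> ?H" "x 1 \<otimes>\<^bsub>?Y\<^esub> u \<in> ?H" for u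
    unfolding Y.leibniz[OF x1 x2 Hc[OF that(1)]]
    by (rule H_add[OF H_mult[OF HY[unfolded b_simps(1)] that(1)] stable2[OF that(2)]])
  have stable1: "x 1 \<otimes>\<^bsub>?Y\<^esub> u \<in> ?H" if "u \<in> ?H" for u
    using ym_lie S x1 _ that
  proof (rule lie_span_ad_stable)
    fix s assume "s \<in> ?S"
    then obtain v where v: "v \<in> J" "s = b v" by blast
    show "x 1 \<otimes>\<^bsub>?Y\<^esub> s \<in> ?H"
    proof (cases v)
      case VY
      \<comment> \<open>The relation with index 2 expresses \<open>[x\<^sub>1, [x\<^sub>1, x\<^sub>2]]\<close>.\<close>
      have "?f 2 1 \<in> ?H"
      proof (rule relation_H)
        fix i assume "i \<in> {1..n} - {1}"
        then have "i = 2 \<or> i \<in> {3..n}" by auto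
        then show "?f 2 i \<in> ?H" using x2_bracket x2 H_zero by (auto simp: Y.bracket_self)
      qed (use n in auto)
      then show ?thesis by (simp add: v(2) VY b_simps)
    next
      case (VX k i)
      then have i: "i \<in> {3..n}" using v(1) by (auto simp: J_def)
      have "x 1 \<otimes>\<^bsub>?Y\<^esub> b (VX k i) \<in> ?H"
      proof (induction k)
        case 0 then show ?case using HZ[OF i, of 0] by (simp add: b_simps)
      next
        case (Suc k) then show ?case using step[OF HX[OF i]] by (simp add: b_simps)
      qed
      then show ?thesis by (simp add: v(2) VX)
    next
      case (VZ k i)
      then have i: "i \<in> {3..n}" using v(1) by (auto simp: J_def)
      have "x 1 \<otimes>\<^bsub>?Y\<^esub> b (VZ k i) \<in> ?H"
      proof (induction k)
        case 0
        \<comment> \<open>The relation with index \<open>i\<close> expresses \<open>[x\<^sub>1, [x\<^sub>1, x\<^sub>i]]\<close>.\<close>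
        have "?f i 1 \<in> ?H"
        proof (rule relation_H)
          fix a assume "a \<in> {1..n} - {1}"
          then consider "a = 2" | "a \<in> {3..n}" by force
          then show "?f i a \<in> ?H"
          proof cases
            case 1
            then show ?thesis using HX[OF i, of 2] by (simp add: b_simps numeral_2_eq_2)
          next
            case 2
            then show ?thesis by (intro H_mult xH i)
          qed
        qed (use n i in auto)
        then show ?case by (simp add: b_simps)
      next
        case (Suc k) then show ?case using step[OF HZ[OF i]] by (simp add: b_simps)
      qed
      then show ?thesis by (simp add: v(2) VZ)
    qed
  qed
  let ?K = "{u \<oplus>\<^bsub>?Y\<^esub> c \<odot>\<^bsub>?Y\<^esub> x 2 | u c. u \<in> ?H}"
  have K: "subalg ?K ?Y" by (rule subalg_adjoin[OF ym_lie H x2 stable2])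
  have HK: "?H \<subseteq> ?K"
  proof
    fix u assume u: "u \<in> ?H"
    have "u = u \<oplus>\<^bsub>?Y\<^esub> 0 \<odot>\<^bsub>?Y\<^esub> x 2" using Hc[OF u] x2 by simp
    then show "u \<in> ?K" using u by blast
  qed
  have x2K: "x 2 \<in> ?K"
  proof -
    have "x 2 = \<zero>\<^bsub>?Y\<^esub> \<oplus>\<^bsub>?Y\<^esub> 1 \<odot>\<^bsub>?Y\<^esub> x 2" using x2 by simp
    then show ?thesis using H_zero by blast
  qed
  have stableK: "x 1 \<otimes>\<^bsub>?Y\<^esub> p \<in> ?K" if p: "p \<in> ?K" for p
  proof -
    obtain u c where u: "p = u \<oplus>\<^bsub>?Y\<^esub> c \<odot>\<^bsub>?Y\<^esub> x 2" "u \<in> ?H" using p by blast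
    have "x 1 \<otimes>\<^bsub>?Y\<^esub> p = x 1 \<otimes>\<^bsub>?Y\<^esub> u \<oplus>\<^bsub>?Y\<^esub> c \<odot>\<^bsub>?Y\<^esub> b VY"
      using Hc[OF u(2)] x1 x2 by (simp add: u(1) b_simps Y.mult_add_right Y.mult_smult_right)
    moreover have "\<dots> \<in> ?H" using HY H by (intro H_add stable1[OF u(2)]) (simp add: subalg_def)
    ultimately show ?thesis using HK by auto
  qed
  let ?L = "{p \<oplus>\<^bsub>?Y\<^esub> d \<odot>\<^bsub>?Y\<^esub> x 1 | p d. p \<in> ?K}"
  have L: "subalg ?L ?Y" by (rule subalg_adjoin[OF ym_lie K x1 stableK])
  have Kc: "p \<in> carrier ?Y" if "p \<in> ?K" for p using that K by (auto simp: subalg_def)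
  have KL: "?K \<subseteq> ?L"
  proof
    fix p assume p: "p \<in> ?K"
    have "p = p \<oplus>\<^bsub>?Y\<^esub> 0 \<odot>\<^bsub>?Y\<^esub> x 1" using Kc[OF p] x1 by simp
    then show "p \<in> ?L" using p by blast
  qed
  have x1L: "x 1 \<in> ?L"
  proof -
    have "x 1 = \<zero>\<^bsub>?Y\<^esub> \<oplus>\<^bsub>?Y\<^esub> 1 \<odot>\<^bsub>?Y\<^esub> x 1" using x1 by simp
    moreover have "\<zero>\<^bsub>?Y\<^esub> \<in> ?K" using H_zero HK by blast
    ultimately show ?thesis by blast
  qed
  have "ym_gen n ` {1..n} \<subseteq> ?L"
  proof
    fix y :: "(nat magma \<Rightarrow> 'k) set set" assume "y \<in> ym_gen n ` {1..n}"
    then obtain i where i: "i \<in> {1..n}" "y = x i" unfolding x_def by (rule imageE)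
    then consider "i = 1" | "i = 2" | "i \<in> {3..n}" by force
    then show "y \<in> ?L"
    proof cases
      case 1 then show ?thesis using x1L i(2) by simp
    next
      case 2 then show ?thesis using subsetD[OF KL x2K] i(2) by simp
    next
      case 3 then show ?thesis using subsetD[OF KL subsetD[OF HK xH]] i(2) by simp
    qed
  qed
  then have all: "carrier ?Y \<subseteq> ?L" by (rule generatesD[OF generates_ym L])
  \<comment> \<open>The first two characters read off the coefficients of \<open>x 1\<close> and \<open>x 2\<close>.\<close>
  have "?M \<subseteq> ?H"
  proof
    fix m assume m: "m \<in> ?M"
    then have "m \<in> ?L" using all by (auto simp: ym_kernel_def)
    then obtain p d where p: "m = p \<oplus>\<^bsub>?Y\<^esub> d \<odot>\<^bsub>?Y\<^esub> x 1" "p \<in> ?K" by blast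
    then obtain u c where u: "p = u \<oplus>\<^bsub>?Y\<^esub> c \<odot>\<^bsub>?Y\<^esub> x 2" "u \<in> ?H" by blast
    have uM: "u \<in> ?M" using HM u(2) by blast
    have chars: "ym_char n i m = ym_char n i u + c * ym_char n i (x 2) + d * ym_char n i (x 1)" for i
      unfolding p(1) u(1) using Hc[OF u(2)] x1 x2 by (simp add: ym_char_hom)
    have "ym_char n i (x j) = (if i = j then 1 else 0)" if "j \<in> {1..n}" for i j
      unfolding x_def by (rule ym_char(2)[OF that])
    then have c1: "ym_char n 1 (x 1) = 1" "ym_char n 1 (x 2) = 0" "ym_char n 2 (x 1) = 0" "ym_char n 2 (x 2) = 1"
      using n by simp_all
    have "ym_char n i m = 0" "ym_char n i u = 0" if "i \<in> {1..2}" for i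
      using m uM that by (simp_all add: ym_kernel_def)
    then have "ym_char n 1 m = 0" "ym_char n 1 u = 0" "ym_char n 2 m = 0" "ym_char n 2 u = 0" by simp_all
    then have "d = 0" "c = 0" using chars[of 1] chars[of 2] c1 by simp_all
    then have "m = u" using Hc[OF u(2)] x1 x2 by (simp add: p(1) u(1))
    then show "m \<in> ?H" using u(2) by simp
  qed
  then have gen: "generates (?Y\<lparr>carrier := ?M\<rparr>) ?S" by (rule generates_lie_span[OF M SM])
  have lieM: "lie_algebra (?Y\<lparr>carrier := ?M\<rparr>)" by (rule lie_algebra_subalg[OF ym_lie M])

  \<comment> \<open>Freeness: in \<open>((u, c), d)\<close> the scalars are the coefficients of \<open>x 2\<close> and \<open>x 1\<close>.\<close>
  let ?br = "fl_bracket :: (ym_var, 'k) flie \<Rightarrow> _"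
  let ?g = "fl_gen :: ym_var \<Rightarrow> (ym_var, 'k) flie"
  obtain Ds Dt :: "(ym_var, 'k) flie \<Rightarrow> (ym_var, 'k) flie" where
    Ds: "type_derivation fl_scale fl_bracket Ds" and Dt: "type_derivation fl_scale fl_bracket Dt"
    and DsX: "\<And>k i. Ds (fl_gen (VX k i)) = fl_gen (VX (Suc k) i)"
    and DsZ: "\<And>k i. Ds (fl_gen (VZ k i)) = fl_gen (VZ (Suc k) i)"
    and DsY: "Ds (fl_gen VY) = - (\<Sum>i\<in>{3..n}. ?br (?g (VX 0 i)) (?g (VZ 0 i)))"
    and DtX: "\<And>i. Dt (fl_gen (VX 0 i)) = fl_gen (VZ 0 i)"
    and DtZ: "\<And>i. Dt (fl_gen (VZ 0 i)) = - fl_gen (VX 2 i)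
      - (\<Sum>j\<in>{3..n}. ?br (?g (VX 0 j)) (?br (?g (VX 0 j)) (?g (VX 0 i))))"
    and DtY: "Dt (fl_gen VY) = (\<Sum>i\<in>{3..n}. ?br (?g (VX 0 i)) (?g (VX 1 i)))"
    and comm: "\<And>u. Dt (Ds u) = ?br (?g VY) u + Ds (Dt u)"
    by (rule ym_derivations[OF finite_atLeastAtMost[of 3 n]]) (rule that)
  interpret Ds: type_derivation fl_scale fl_bracket Ds by (rule Ds)
  define E where "E p = (Dt (fst p) + fl_scale (snd p) (?g VY), 0 :: 'k)" for p
  interpret E: type_derivation Ds.ext_sc Ds.ext_br E
    unfolding E_def[abs_def] by (rule Ds.extension_of_derivation[OF Dt comm])
  interpret Dt: type_derivation fl_scale fl_bracket Dt by (rule Dt)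
  interpret P: type_lie E.ext_sc E.ext_br by (rule E.type_lie_ext)
  define \<phi> :: "nat \<Rightarrow> ((ym_var, 'k) flie \<times> 'k) \<times> 'k"
    where "\<phi> i = (if i = 1 then ((0, 0), 1) else if i = 2 then ((0, 1), 0) else ((?g (VX 0 i), 0), 0))" for i
  have phi: "\<phi> (Suc 0) = ((0, 0), 1)" "\<phi> 2 = ((0, 1), 0)" by (simp_all add: \<phi>_def)
  have phi3: "\<phi> i = ((?g (VX 0 i), 0), 0)" if "i \<in> {3..n}" for i using that by (simp add: \<phi>_def)
  note ops = E.ext_br_def Ds.ext_br_def E.ext_sc_def Ds.ext_sc_def E_def
  have sum_split: "(\<Sum>i\<in>{1..n}. F i) = F 1 + F 2 + (\<Sum>i\<in>{3..n}. F i)" for F :: "nat \<Rightarrow> ((ym_var, 'k) flie \<times> 'k) \<times> 'k"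
    unfolding ym_interval_split[OF n] by (simp add: add.assoc)
  have sum_pair: "(\<Sum>i\<in>I. ((F i, 0), 0)) = (((\<Sum>i\<in>I. F i), 0), 0 :: 'k)" for F :: "nat \<Rightarrow> (ym_var, 'k) flie" and I
    by (induction I rule: infinite_finite_induct) (simp_all add: zero_prod_def)
  obtain h where h: "h \<in> lie_hom ?Y (type_algebra E.ext_sc E.ext_br)"
    "\<And>i. i \<in> {1..n} \<Longrightarrow> h (ym_gen n i) = \<phi> i"
  proof (rule ym_universal[OF E.type_lie_ext])
    fix j assume j: "j \<in> {1..n}"
    have tail: "(\<Sum>i\<in>{3..n}. E.ext_br (\<phi> i) (E.ext_br (\<phi> i) q)) =
        (((\<Sum>i\<in>{3..n}. fst (fst (E.ext_br ((?g (VX 0 i), 0), 0) (E.ext_br ((?g (VX 0 i), 0), 0) q)))), 0), 0)" for q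
      unfolding sum_pair[symmetric]
      by (rule sum.cong) (simp_all add: phi3 ops)
    consider "j = 1" | "j = 2" | "j \<in> {3..n}" using j by force
    then show "(\<Sum>i\<in>{1..n}. E.ext_br (\<phi> i) (E.ext_br (\<phi> i) (\<phi> j))) = 0"
    proof cases
      case 1
      have t: "(\<Sum>i\<in>{3..n}. E.ext_br (\<phi> i) (E.ext_br (\<phi> i) (\<phi> 1)))
          = ((- (\<Sum>i\<in>{3..n}. ?br (?g (VX 0 i)) (?g (VZ 0 i))), 0), 0)"
        unfolding tail sum_negf[symmetric]
        by (simp add: phi ops DtX flie.br_minus_right zero_prod_def)
      show ?thesis unfolding sum_split 1 t
        by (simp add: phi ops zero_prod_def DsY Ds.D_minus Dt.D_zero)
    next
      case 2
      have t: "(\<Sum>i\<in>{3..n}. E.ext_br (\<phi> i) (E.ext_br (\<phi> i) (\<phi> 2)))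
          = ((- (\<Sum>i\<in>{3..n}. ?br (?g (VX 0 i)) (?g (VX 1 i))), 0), 0)"
        unfolding tail sum_negf[symmetric]
        by (simp add: phi ops DsX flie.br_minus_right zero_prod_def)
      show ?thesis unfolding sum_split 2 t
        by (simp add: phi ops zero_prod_def DtY Dt.D_zero)
    next
      case 3
      have t: "(\<Sum>i\<in>{3..n}. E.ext_br (\<phi> i) (E.ext_br (\<phi> i) (\<phi> j)))
          = (((\<Sum>i\<in>{3..n}. ?br (?g (VX 0 i)) (?br (?g (VX 0 i)) (?g (VX 0 j)))), 0), 0)"
        unfolding tail by (simp add: phi3[OF 3] ops)
      show ?thesis unfolding sum_split t
        by (simp add: phi phi3[OF 3] ops zero_prod_def DtX DtZ[unfolded numeral_2_eq_2] DsX)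
    qed
  next
    fix h assume "h \<in> lie_hom ?Y (type_algebra E.ext_sc E.ext_br)"
      "\<And>i. i \<in> {1..n} \<Longrightarrow> h (ym_gen n i) = \<phi> i"
    then show thesis by (rule that)
  qed
  have hx: "h (x (Suc 0)) = ((0, 0), 1)" "h (x 2) = ((0, 1), 0)" "\<And>i. i \<in> {3..n} \<Longrightarrow> h (x i) = ((?g (VX 0 i), 0), 0)"
    unfolding x_def using h(2) n phi phi3 by auto
  note h_br = lie_homD(3)[OF h(1), simplified]
  have hb: "h (b v) = ((?g v, 0), 0)" if "v \<in> J" for v
  proof (cases v)
    case VY
    then show ?thesis using x1 x2 by (simp add: b_simps h_br hx ops)
  next
    case (VX k i)
    then have i: "i \<in> {3..n}" using that by (auto simp: J_def)
    have "h (b (VX k i)) = ((?g (VX k i), 0), 0)"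
    proof (induction k)
      case 0 show ?case using hx(3)[OF i] by (simp add: b_simps)
    next
      case (Suc k) then show ?case using bX[OF i] x2 by (simp add: b_simps h_br hx ops DsX)
    qed
    then show ?thesis using VX by simp
  next
    case (VZ k i)
    then have i: "i \<in> {3..n}" using that by (auto simp: J_def)
    have "h (b (VZ k i)) = ((?g (VZ k i), 0), 0)"
    proof (induction k)
      case 0 show ?case using hx(3)[OF i] x1 xi[OF i] by (simp add: b_simps h_br hx ops DtX)
    next
      case (Suc k) then show ?case using bZ[OF i] x2 by (simp add: b_simps h_br hx ops DsZ)
    qed
    then show ?thesis using VZ by simp
  qed
  have hM: "h \<in> lie_hom (?Y\<lparr>carrier := ?M\<rparr>) (type_algebra E.ext_sc E.ext_br)"
    using h(1) M by (auto simp: lie_hom_def subalg_def subset_iff)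
  have h1: "(\<lambda>m. fst (h m)) \<in> lie_hom (?Y\<lparr>carrier := ?M\<rparr>) (type_algebra Ds.ext_sc Ds.ext_br)"
    by (rule E.fst_ext_hom[OF lie_nonassoc[OF lieM] gen hM]) (use hb in auto)
  have h2: "(\<lambda>m. fst (fst (h m))) \<in> lie_hom (?Y\<lparr>carrier := ?M\<rparr>) fl_algebra"
    by (rule Ds.fst_ext_hom[OF lie_nonassoc[OF lieM] gen h1]) (use hb in auto)
  have "free_on (?Y\<lparr>carrier := ?M\<rparr>) ?S"
    by (rule free_on_from_flie[OF lieM gen h2]) (simp add: hb)
  then show ?thesis using gens S_sub by blast
qed

section \<open>Eliminating the remaining generators\<close>

text \<open>
  The description of the position of the basis is an invariant of elimination: the new basis consists of
  the remaining \<open>x\<^sub>j\<close>, which are the elements with \<open>k = 0\<close>, and of elements in the kernel of all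
  characters, since these vanish on brackets.
\<close>

lemma ym_kernel_free:
  fixes n i :: nat
  assumes "2 \<le> i" "i \<le> n"
  shows "\<exists>B. free_on ((ym n :: ('k::field, _) module)\<lparr>carrier := ym_kernel n i\<rparr>) B \<and>
    ym_gen n ` {Suc i..n} \<subseteq> B \<and> B \<subseteq> ym_gen n ` {Suc i..n} \<union> ym_kernel n n"
  using assms
proof (induction i rule: dec_induct)
  case base
  then show ?case using ym_kernel_2_free[of n, where ?'k = 'k] by (simp add: numeral_3_eq_3 numeral_2_eq_2)
next
  case (step i)
  let ?Y = "ym n :: ('k, _) module"
  let ?K = "\<lambda>i. ym_kernel n i :: (nat magma \<Rightarrow> 'k) set set set"
  let ?L = "?Y\<lparr>carrier := ?K i\<rparr>"
  let ?x = "ym_gen n (Suc i) :: (nat magma \<Rightarrow> 'k) set set"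
  obtain B where B: "free_on ?L B" "ym_gen n ` {Suc i..n} \<subseteq> B" "B \<subseteq> ym_gen n ` {Suc i..n} \<union> ?K n"
    using step by auto
  have Bc: "B \<subseteq> ?K i" using B(1) by (simp add: free_on_def)
  have sub: "?K n \<subseteq> ?K (Suc i)" by (rule ym_kernel_mono) (use step in simp)
  have subc: "?K i \<subseteq> carrier ?Y" by (auto simp: ym_kernel_def)
  have xB: "?x \<in> B" using B(2) step by auto
  have mono: "?K (Suc i) \<subseteq> ?K i" by (rule ym_kernel_mono) simp
  have M: "subalg (?K (Suc i)) ?L"
    using subalg_ym_kernel[of n "Suc i", where ?'k = 'k] mono by (simp add: subalg_def)
  have xM: "?x \<notin> ?K (Suc i)" using ym_gen_in_ym_kernel[of "Suc i" n "Suc i"] step by simp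
  have gens: "ym_gen n j \<in> ?K (Suc i)" if "j \<in> {Suc (Suc i)..n}" for j
    using ym_gen_in_ym_kernel[of j n "Suc i"] that by simp
  have rest: "B - {?x} \<subseteq> ym_gen n ` {Suc (Suc i)..n} \<union> ?K n"
  proof
    fix b assume b: "b \<in> B - {?x}"
    then consider j where "j \<in> {Suc i..n}" "b = ym_gen n j" | "b \<in> ?K n" using B(3) by blast
    then show "b \<in> ym_gen n ` {Suc (Suc i)..n} \<union> ?K n"
    proof cases
      case 1
      then have "j \<noteq> Suc i" using b by auto
      then have "j \<in> {Suc (Suc i)..n}" using 1(1) by simp
      then show ?thesis using 1(2) by simp
    qed simp
  qed
  have ad_closed: "(ad ?L ?x ^^ k) b \<in> ?K i" if "b \<in> B" for k b
  proof (induction k)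
    case (Suc k)
    then have "(ad ?L ?x ^^ k) b \<in> carrier ?Y" "?x \<in> carrier ?Y" using subc Bc xB by auto
    from bracket_in_ym_kernel[OF this(2,1), of i] show ?case by (simp add: ad_funpow_Suc del: funpow.simps)
  qed (use that Bc in auto)
  have ad_Suc: "(ad ?L ?x ^^ Suc k) b \<in> ?K n" if "b \<in> B" for k b
  proof -
    have "(ad ?L ?x ^^ k) b \<in> carrier ?Y" "?x \<in> carrier ?Y" using subc Bc xB ad_closed[OF that] by auto
    from bracket_in_ym_kernel[OF this(2,1), of n] show ?thesis by (simp add: ad_funpow_Suc del: funpow.simps)
  qed
  have ad_M: "(ad ?L ?x ^^ k) b \<in> ym_gen n ` {Suc (Suc i)..n} \<union> ?K n" if b: "b \<in> B - {?x}" for k b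
  proof (cases k)
    case 0
    then show ?thesis using subsetD[OF rest b] by simp
  next
    case (Suc l)
    then show ?thesis using ad_Suc[of b l] b by blast
  qed
  let ?B = "(\<lambda>(k, b). (ad ?L ?x ^^ k) b) ` (UNIV \<times> (B - {?x}))"
  have "free_on (?L\<lparr>carrier := ?K (Suc i)\<rparr>) ?B"
  proof (rule lazard_elimination[OF B(1) xB M xM])
    show "(ad ?L ?x ^^ k) b \<in> ?K (Suc i)" if "b \<in> B - {?x}" for k b
      by (rule subsetD[OF Un_least[OF image_subsetI[OF gens] sub] ad_M[OF that]])
  qed
  then have "free_on (?Y\<lparr>carrier := ?K (Suc i)\<rparr>) ?B" by simp
  moreover have "?B \<subseteq> ym_gen n ` {Suc (Suc i)..n} \<union> ?K n" using ad_M by auto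
  moreover have "ym_gen n ` {Suc (Suc i)..n} \<subseteq> ?B"
  proof
    fix b :: "(nat magma \<Rightarrow> 'k) set set" assume "b \<in> ym_gen n ` {Suc (Suc i)..n}"
    then obtain j where j: "j \<in> {Suc (Suc i)..n}" "b = ym_gen n j" by (rule imageE)
    then have "b \<in> B" using B(2) by auto
    moreover have "b \<noteq> ?x" using gens[OF j(1)] xM j(2) by auto
    ultimately have "(0, b) \<in> UNIV \<times> (B - {?x})" by simp
    then show "b \<in> ?B" by (rule rev_image_eqI) simp
  qed
  ultimately show ?case by blast
qed

theorem theorem3p11:
  fixes n :: nat
  assumes "n \<ge> 2"
  shows "is_free_lie_algebra (tym n :: ('k::{alg_closed_field,field_char_0}, _) module) \<and>
         is_free_assoc_algebra (TYM n :: ('k, _) module)"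
proof -
  obtain B where "free_on (tym n :: ('k, _) module) B"
    using ym_kernel_free[OF assms order_refl, where ?'k = 'k] unfolding tym_eq by blast
  then show ?thesis
    unfolding TYM_def using uea_of_free_lie_algebra is_free_lie_algebra_iff by blast
qed

end
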